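(* Suppose that for each $K\in\mathscr T$ there are real numbers $\eta_{\mathbf y,K},\eta_{p,K},\eta_{\mathbf w,K},\eta_{q,K}$ such that $$\|\hat{\mathbf y}-\bar{\mathbf y}_{\mathscr T}\|_{\mathbf V,\Omega}^2\le \sum_{K\in\mathscr T}\eta_{\mathbf y,K}^2,\quad \|\hat p-\bar p_{\mathscr T}\|_{Q,\Omega}^2\le\sum_{K\in\mathscr T}\eta_{p,K}^2,$$ $$\|\hat{\mathbf w}-\bar{\mathbf w}_{\mathscr T}\|_{\mathbf V,\Omega}^2\le \sum_{K\in\mathscr T}\eta_{\mathbf w,K}^2,\quad \|\hat q-\bar q_{\mathscr T}\|_{Q,\Omega}^2\le\sum_{K\in\mathscr T}\eta_{q,K}^2 .$$ Then $$E_\Omega^2\le\sum_{K\in\mathscr T}\Upsilon_K^2,\qquad \Upsilon_K^2:=\mathfrak C_{\mathbf y}\eta_{\mathbf y,K}^2+2\varrho\,\eta_{p,K}^2+\mathfrak C_{\mathbf w}\eta_{\mathbf w,K}^2+2\varrho\,\eta_{q,K}^2+\mathfrak C_{\mathbf u}\eta_{\mathbf u,K}^2 ,$$ where $E_\Omega$ is the total error, $\eta_{\mathbf u,K}$ the local control indicator and, with $\mu=4\vartheta^{-2}$ and $\omega=C_{is}^2(1+C_{ct})^2$, $$\mathfrak C_{\mathbf y}=2+2\mu C_\Omega^6+4(1+\varrho\omega)(C_\Omega^4+\mu C_\Omega^8+2\mu C_\Omega^{12}),$$ $$\mathfrak C_{\mathbf w}=2+\mu C_\Omega^2+2\mu(1+\varrho\omega)(C_\Omega^4+2C_\Omega^8),$$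 $$\mathfrak C_{\mathbf u}=2+2\mu C_\Omega^8+4(1+\varrho\omega)(C_\Omega^2+2C_\Omega^6+\mu C_\Omega^{10}+2\mu C_\Omega^{14}).$$
   Context: Setting. $d\in\{2,3\}$; $\Omega\subset\mathbb R^d$ is an open bounded polytopal domain with Lipschitz boundary; $\mathbf f,\mathbf y_\Omega\in L^2(\Omega)^d$; $\varepsilon>0$, $\kappa\ge0$, $\vartheta>0$, $\varrho\ge 0$ are real; $\mathbf c\in W^{1,\infty}(\Omega)^d$ with $\nabla\cdot\mathbf c=0$; $\mathbf a,\mathbf b\in\mathbb R^d$ with $\mathbf a<\mathbf b$ (vector inequalities are componentwise). $\mathbf V=H^1_0(\Omega)^d$, $Q=L^2_0(\Omega)$ (zero-mean $L^2$ functions), $\mathbf U_{ad}=\{\mathbf v\in L^2(\Omega)^d:\mathbf a\le\mathbf v\le\mathbf b\text{ a.e. in }\Omega\}$. $\mathscr T$ is a conforming partition of $\bar\Omega$ into simplices $K$, a member of a shape-regular family. Norms: $\|\boldsymbol\xi\|_{\mathbf V,K}^2=\varepsilon\|\nabla\boldsymbol\xi\|_{L^2(K)}^2+\kappa\|\boldsymbol\xi\|_{L^2(K)}^2$, $\|\phi\|_{Q,K}=\|\phi\|_{L^2(K)}$, and $\|\cdot\|^2_{\mathbf V,\Omega}=\sum_{K\in\mathscr T}\|\cdot\|^2_{\mathbf V,K}$, $\|\cdot\|^2_{Q,\Omega}=\sum_{K\in\mathscr T}\|\cdot\|_{Q,K}^2$. Forms: $\mathcal A(\boldsymbol\xi,\boldsymbol\zeta)=\varepsilon(\nabla\boldsymbol\xi,\nabla\boldsymbol\zeta)_\Omega+(\kappa\boldsymbol\xi+(\mathbf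 c\cdot\nabla)\boldsymbol\xi,\boldsymbol\zeta)_\Omega$, $\mathcal B(\boldsymbol\zeta,\phi)=(\phi,\nabla\cdot\boldsymbol\zeta)_\Omega$, $\mathcal C(\boldsymbol\xi,\boldsymbol\zeta)=\varepsilon(\nabla\boldsymbol\xi,\nabla\boldsymbol\zeta)_\Omega+(\kappa\boldsymbol\xi-(\mathbf c\cdot\nabla)\boldsymbol\xi,\boldsymbol\zeta)_\Omega$, with $(\cdot,\cdot)_\Omega$ the $L^2(\Omega)$ inner product. Constants: $C_{P,\Omega}=\frac1\pi\big(\sum_{i=1}^d |l_i|^{-2}\big)^{-1/2}$, where $|l_1|,\dots,|l_d|$ are the side lengths of a $d$-dimensional box containing $\Omega$; $C_\Omega=C_{P,\Omega}/\sqrt\varepsilon$ if $\kappa=0$ and $C_\Omega=\min\{C_{P,\Omega}/\sqrt\varepsilon,1/\sqrt\kappa\}$ if $\kappa\ne0$; $C_{ct}=1+\frac{C_\Omega}{\sqrt\varepsilon}\||\mathbf c|\|_{L^\infty(\Omega)}$; $\beta>0$ is a constant with $\beta\|\phi\|_{L^2(\Omega)}\le\sup_{\boldsymbol\xi\in\mathbf V\setminus\{0\}}\mathcal B(\boldsymbol\xi,\phi)/\|\nabla\boldsymbol\xi\|_{L^2(\Omega)}$ for all $\phi\in Q$; $C_{is}=\sqrt{\varepsilon+\kappa C_{P,\Omega}^2}/\beta$. Continuous optimality system: $(\bar{\mathbf y},\bar p,\bar{\mathbf w},\bar q,\bar{\mathbf u})\in\mathbf V\times Q\times\mathbf V\times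 Q\times\mathbf U_{ad}$ is the unique solution of: $\mathcal A(\bar{\mathbf y},\boldsymbol\xi)-\mathcal B(\boldsymbol\xi,\bar p)=(\mathbf f+\bar{\mathbf u},\boldsymbol\xi)_\Omega$, $\mathcal B(\bar{\mathbf y},\phi)=0$, $\mathcal C(\bar{\mathbf w},\boldsymbol\zeta)+\mathcal B(\boldsymbol\zeta,\bar q)=(\bar{\mathbf y}-\mathbf y_\Omega,\boldsymbol\zeta)_\Omega$, $\mathcal B(\bar{\mathbf w},\psi)=0$, $(\bar{\mathbf w}+\vartheta\bar{\mathbf u},\mathbf u-\bar{\mathbf u})_\Omega\ge0$ for all $\boldsymbol\xi,\boldsymbol\zeta\in\mathbf V$, $\phi,\psi\in Q$, $\mathbf u\in\mathbf U_{ad}$. Discrete system: $\mathbf V(\mathscr T)\subset\mathbf V$ and $Q(\mathscr T)\subset Q$ are (discrete) subspaces and $\mathbf U_{ad}(\mathscr T)\subset\mathbf U_{ad}$ is a (discrete) subset. $\mathcal S,\mathcal H,\mathcal Q,\mathcal K$ are real-valued stabilization terms (possibly zero, with no relation between them assumed). $(\bar{\mathbf y}_{\mathscr T},\bar p_{\mathscr T},\bar{\mathbf w}_{\mathscr T},\bar q_{\mathscr T},\bar{\mathbf u}_{\mathscr T})\in\mathbf V(\mathscr T)\times Q(\mathscr T)\times\mathbf V(\mathscr T)\times Q(\mathscr T)\times\mathbf U_{ad}(\mathscr T)$ is a solution (at least one is assumed to exist) of: $\mathcal A(\bar{\mathbf y}_{\mathscr T},\boldsymbol\xi)-\mathcal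 B(\boldsymbol\xi,\bar p_{\mathscr T})+\mathcal S(\bar{\mathbf y}_{\mathscr T},\bar p_{\mathscr T},\mathbf f+\bar{\mathbf u}_{\mathscr T};\boldsymbol\xi)=(\mathbf f+\bar{\mathbf u}_{\mathscr T},\boldsymbol\xi)_\Omega$, $\mathcal B(\bar{\mathbf y}_{\mathscr T},\phi)+\mathcal H(\bar{\mathbf y}_{\mathscr T},\bar p_{\mathscr T},\mathbf f+\bar{\mathbf u}_{\mathscr T};\phi)=0$, $\mathcal C(\bar{\mathbf w}_{\mathscr T},\boldsymbol\zeta)+\mathcal B(\boldsymbol\zeta,\bar q_{\mathscr T})+\mathcal Q(\bar{\mathbf w}_{\mathscr T},\bar q_{\mathscr T},\bar{\mathbf y}_{\mathscr T}-\mathbf y_\Omega;\boldsymbol\zeta)=(\bar{\mathbf y}_{\mathscr T}-\mathbf y_\Omega,\boldsymbol\zeta)_\Omega$, $\mathcal B(\bar{\mathbf w}_{\mathscr T},\psi)+\mathcal K(\bar{\mathbf w}_{\mathscr T},\bar q_{\mathscr T},\bar{\mathbf y}_{\mathscr T}-\mathbf y_\Omega;\psi)=0$, $(\bar{\mathbf w}_{\mathscr T}+\vartheta\bar{\mathbf u}_{\mathscr T},\mathbf u-\bar{\mathbf u}_{\mathscr T})_\Omega\ge0$ for all $\boldsymbol\xi,\boldsymbol\zeta\in\mathbf V(\mathscr T)$, $\phi,\psi\in Q(\mathscr T)$, $\mathbf u\in\mathbf U_{ad}(\mathscr T)$. Auxiliary solutions: $(\hat{\mathbf y},\hat p)\in\mathbf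 V\times Q$ solves $\mathcal A(\hat{\mathbf y},\boldsymbol\xi)-\mathcal B(\boldsymbol\xi,\hat p)=(\mathbf f+\bar{\mathbf u}_{\mathscr T},\boldsymbol\xi)_\Omega$, $\mathcal B(\hat{\mathbf y},\phi)=0$ for all $(\boldsymbol\xi,\phi)\in\mathbf V\times Q$; $(\hat{\mathbf w},\hat q)\in\mathbf V\times Q$ solves $\mathcal C(\hat{\mathbf w},\boldsymbol\zeta)+\mathcal B(\boldsymbol\zeta,\hat q)=(\bar{\mathbf y}_{\mathscr T}-\mathbf y_\Omega,\boldsymbol\zeta)_\Omega$, $\mathcal B(\hat{\mathbf w},\psi)=0$ for all $(\boldsymbol\zeta,\psi)\in\mathbf V\times Q$. Control indicator: $\tilde{\mathbf u}=\Pi_{[\mathbf a,\mathbf b]}(-\frac1\vartheta\bar{\mathbf w}_{\mathscr T})$ with $\Pi_{[\mathbf a,\mathbf b]}(\boldsymbol\zeta)(x)=\min\{\mathbf b,\max\{\mathbf a,\boldsymbol\zeta(x)\}\}$ componentwise; $\eta_{\mathbf u,K}=\|\tilde{\mathbf u}-\bar{\mathbf u}_{\mathscr T}\|_{L^2(K)}$. Errors: $\mathbf e_{\mathbf y}=\bar{\mathbf y}-\bar{\mathbf y}_{\mathscr T}$, $e_p=\bar p-\bar p_{\mathscr T}$, $\mathbf e_{\mathbf w}=\bar{\mathbf w}-\bar{\mathbf w}_{\mathscr T}$, $e_q=\bar q-\bar q_{\mathscr T}$, $\mathbf e_{\mathbf u}=\bar{\mathbf u}-\bar{\mathbf u}_{\mathscr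 T}$; $E_K^2=\|\mathbf e_{\mathbf y}\|_{\mathbf V,K}^2+\varrho\|e_p\|_{Q,K}^2+\|\mathbf e_{\mathbf w}\|_{\mathbf V,K}^2+\varrho\|e_q\|_{Q,K}^2+\|\mathbf e_{\mathbf u}\|_{L^2(K)}^2$ and $E_\Omega^2=\sum_{K\in\mathscr T}E_K^2$. *)

theory Defs
  imports "HOL-Analysis.Analysis" "HOL-Probability.Essential_Supremum"
begin

section \<open>Domains and meshes\<close>

definition lipschitz_boundary :: "(real^'n) set \<Rightarrow> bool" where
  "lipschitz_boundary \<Omega> \<longleftrightarrow>
     (\<forall>x0\<in>frontier \<Omega>. \<exists>\<nu> r L \<gamma>. norm \<nu> = 1 \<and> 0 < r \<and> L-lipschitz_on {y. y \<bullet> \<nu> = 0} \<gamma> \<and>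
        \<Omega> \<inter> ball x0 r = {x \<in> ball x0 r. \<gamma> (x - (x \<bullet> \<nu>) *\<^sub>R \<nu>) < x \<bullet> \<nu>})"

definition polytopal :: "(real^'n) set \<Rightarrow> bool" where
  "polytopal \<Omega> \<longleftrightarrow>
     (\<exists>\<F>. finite \<F> \<and> (\<forall>F\<in>\<F>. polytope F \<and> aff_dim F = int CARD('n) - 1) \<and> frontier \<Omega> = \<Union>\<F>)"

definition polytopal_lipschitz_domain :: "(real^'n) set \<Rightarrow> bool" where
  "polytopal_lipschitz_domain \<Omega> \<longleftrightarrow>
     open \<Omega> \<and> connected \<Omega> \<and> \<Omega> \<noteq> {} \<and> bounded \<Omega> \<and> polytopal \<Omega> \<and> lipschitz_boundary \<Omega>"

definition conforming_partition :: "(real^'n) set \<Rightarrow> (real^'n) set set \<Rightarrow> bool" where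
  "conforming_partition \<Omega> \<T> \<longleftrightarrow>
     triangulation \<T> \<and> (\<forall>K\<in>\<T>. int CARD('n) simplex K) \<and> \<Union>\<T> = closure \<Omega>"

definition inball_diameter :: "(real^'n) set \<Rightarrow> real" where
  "inball_diameter K = Sup {2 * r | r. 0 \<le> r \<and> (\<exists>x. cball x r \<subseteq> K)}"

definition shape_regular_family :: "(real^'n) set set set \<Rightarrow> bool" where
  "shape_regular_family \<TT> \<longleftrightarrow>
     (\<exists>\<sigma>>0. \<forall>\<T>\<in>\<TT>. \<forall>K\<in>\<T>. diameter K \<le> \<sigma> * inball_diameter K)"

section \<open>Lebesgue spaces\<close>

text \<open>Elements of function spaces over \<open>\<Omega>\<close> are represented by functions on the whole space;
  only their values almost everywhere in \<open>\<Omega>\<close> matter.\<close>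

definition L2 :: "(real^'n) set \<Rightarrow> (real^'n \<Rightarrow> 'b::euclidean_space) set" where
  "L2 S = {f \<in> borel_measurable (lebesgue_on S). integrable (lebesgue_on S) (\<lambda>x. (norm (f x))\<^sup>2)}"

definition L2_inner ::
    "(real^'n) set \<Rightarrow> (real^'n \<Rightarrow> 'b::euclidean_space) \<Rightarrow> (real^'n \<Rightarrow> 'b) \<Rightarrow> real" where
  "L2_inner S f g = (\<integral>x. f x \<bullet> g x \<partial>lebesgue_on S)"

definition L2_norm :: "(real^'n) set \<Rightarrow> (real^'n \<Rightarrow> 'b::euclidean_space) \<Rightarrow> real" where
  "L2_norm S f = sqrt (\<integral>x. (norm (f x))\<^sup>2 \<partial>lebesgue_on S)"

definition Linf :: "(real^'n) set \<Rightarrow> (real^'n \<Rightarrow> 'b::euclidean_space) set" where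
  "Linf S = {f \<in> borel_measurable (lebesgue_on S).
               esssup (lebesgue_on S) (\<lambda>x. ereal (norm (f x))) < \<infinity>}"

text \<open>For a vector field this is the essential supremum of its pointwise Euclidean norm.\<close>

definition Linf_norm :: "(real^'n) set \<Rightarrow> (real^'n \<Rightarrow> 'b::euclidean_space) \<Rightarrow> real" where
  "Linf_norm S f = real_of_ereal (esssup (lebesgue_on S) (\<lambda>x. ereal (norm (f x))))"

section \<open>Weak derivatives and Sobolev spaces\<close>

primrec Ck :: "nat \<Rightarrow> (real^'n \<Rightarrow> real) \<Rightarrow> bool" where
  "Ck 0 f \<longleftrightarrow> continuous_on UNIV f"
| "Ck (Suc k) f \<longleftrightarrow>
     (\<exists>g::real^'n \<Rightarrow> real^'n. (\<forall>x. (f has_derivative (\<lambda>h. g x \<bullet> h)) (at x)) \<and>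
        (\<forall>i. Ck k (\<lambda>x. g x $ i)))"

definition test_functions :: "(real^'n) set \<Rightarrow> (real^'n \<Rightarrow> real) set" where
  "test_functions \<Omega> =
     {\<phi>. (\<forall>k. Ck k \<phi>) \<and> compact (closure {x. \<phi> x \<noteq> 0}) \<and> closure {x. \<phi> x \<noteq> 0} \<subseteq> \<Omega>}"

definition locally_integrable :: "(real^'n) set \<Rightarrow> (real^'n \<Rightarrow> 'b::euclidean_space) \<Rightarrow> bool" where
  "locally_integrable \<Omega> f \<longleftrightarrow> (\<forall>K. compact K \<and> K \<subseteq> \<Omega> \<longrightarrow> f absolutely_integrable_on K)"

definition has_weak_gradient ::
    "(real^'n) set \<Rightarrow> (real^'n \<Rightarrow> real) \<Rightarrow> (real^'n \<Rightarrow> real^'n) \<Rightarrow> bool" where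
  "has_weak_gradient \<Omega> u g \<longleftrightarrow>
     locally_integrable \<Omega> u \<and> locally_integrable \<Omega> g \<and>
     (\<forall>\<phi>\<in>test_functions \<Omega>. \<forall>i.
        (\<integral>x. u x * frechet_derivative \<phi> (at x) (axis i 1) \<partial>lebesgue_on \<Omega>)
          = - (\<integral>x. g x $ i * \<phi> x \<partial>lebesgue_on \<Omega>))"

text \<open>For open \<open>\<Omega>\<close> a weak gradient is unique up to a null set, so that the choice is immaterial.\<close>

definition weak_gradient :: "(real^'n) set \<Rightarrow> (real^'n \<Rightarrow> real) \<Rightarrow> real^'n \<Rightarrow> real^'n" where
  "weak_gradient \<Omega> u = (SOME g. has_weak_gradient \<Omega> u g)"

text \<open>Row \<open>i\<close> is the gradient of the \<open>i\<close>-th component; \<open>norm\<close> and \<open>\<bullet>\<close> of matrices are the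
  Frobenius norm and inner product.\<close>

definition weak_jacobian ::
    "(real^'n) set \<Rightarrow> (real^'n \<Rightarrow> real^'n) \<Rightarrow> real^'n \<Rightarrow> real^'n^'n" where
  "weak_jacobian \<Omega> \<xi> x = (\<chi> i. weak_gradient \<Omega> (\<lambda>y. \<xi> y $ i) x)"

definition weak_divergence :: "(real^'n) set \<Rightarrow> (real^'n \<Rightarrow> real^'n) \<Rightarrow> real^'n \<Rightarrow> real" where
  "weak_divergence \<Omega> \<xi> x = (\<Sum>i\<in>UNIV. weak_gradient \<Omega> (\<lambda>y. \<xi> y $ i) x $ i)"

definition H1 :: "(real^'n) set \<Rightarrow> (real^'n \<Rightarrow> real) set" where
  "H1 \<Omega> = {u \<in> L2 \<Omega>. \<exists>g\<in>L2 \<Omega>. has_weak_gradient \<Omega> u g}"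

definition H1_norm :: "(real^'n) set \<Rightarrow> (real^'n \<Rightarrow> real) \<Rightarrow> real" where
  "H1_norm \<Omega> u = sqrt ((L2_norm \<Omega> u)\<^sup>2 + (L2_norm \<Omega> (weak_gradient \<Omega> u))\<^sup>2)"

definition H10 :: "(real^'n) set \<Rightarrow> (real^'n \<Rightarrow> real) set" where
  "H10 \<Omega> = {u \<in> H1 \<Omega>. \<forall>e>0. \<exists>\<phi>\<in>test_functions \<Omega>. H1_norm \<Omega> (\<lambda>x. u x - \<phi> x) < e}"

definition W1inf :: "(real^'n) set \<Rightarrow> (real^'n \<Rightarrow> real) set" where
  "W1inf \<Omega> = {u \<in> Linf \<Omega>. \<exists>g\<in>Linf \<Omega>. has_weak_gradient \<Omega> u g}"

definition W1inf_vec :: "(real^'n) set \<Rightarrow> (real^'n \<Rightarrow> real^'n) set" where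
  "W1inf_vec \<Omega> = {c. \<forall>i. (\<lambda>x. c x $ i) \<in> W1inf \<Omega>}"

section \<open>The spaces, norms and forms of the Oseen problem\<close>

definition velocity_space :: "(real^'n) set \<Rightarrow> (real^'n \<Rightarrow> real^'n) set" where
  "velocity_space \<Omega> = {\<xi>. \<forall>i. (\<lambda>x. \<xi> x $ i) \<in> H10 \<Omega>}"

definition pressure_space :: "(real^'n) set \<Rightarrow> (real^'n \<Rightarrow> real) set" where
  "pressure_space \<Omega> = {\<phi> \<in> L2 \<Omega>. (\<integral>x. \<phi> x \<partial>lebesgue_on \<Omega>) = 0}"

definition admissible_controls ::
    "(real^'n) set \<Rightarrow> real^'n \<Rightarrow> real^'n \<Rightarrow> (real^'n \<Rightarrow> real^'n) set" where
  "admissible_controls \<Omega> a b =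
     {v \<in> L2 \<Omega>. AE x in lebesgue_on \<Omega>. \<forall>i. a $ i \<le> v x $ i \<and> v x $ i \<le> b $ i}"

text \<open>The local norm of the velocity space on a mesh cell \<open>K\<close>; the weak derivatives are those
  on \<open>\<Omega>\<close>. Cells are closed, but \<open>K - \<Omega> \<subseteq> frontier \<Omega>\<close> is a null set for polytopal \<open>\<Omega>\<close>, so values
  outside \<open>\<Omega>\<close> do not contribute.\<close>

definition V_norm ::
    "(real^'n) set \<Rightarrow> real \<Rightarrow> real \<Rightarrow> (real^'n) set \<Rightarrow> (real^'n \<Rightarrow> real^'n) \<Rightarrow> real" where
  "V_norm \<Omega> \<epsilon> \<kappa> K \<xi> =
     sqrt (\<epsilon> * (L2_norm K (weak_jacobian \<Omega> \<xi>))\<^sup>2 + \<kappa> * (L2_norm K \<xi>)\<^sup>2)"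

definition V_norm_mesh ::
    "(real^'n) set \<Rightarrow> real \<Rightarrow> real \<Rightarrow> (real^'n) set set \<Rightarrow> (real^'n \<Rightarrow> real^'n) \<Rightarrow> real" where
  "V_norm_mesh \<Omega> \<epsilon> \<kappa> \<T> \<xi> = sqrt (\<Sum>K\<in>\<T>. (V_norm \<Omega> \<epsilon> \<kappa> K \<xi>)\<^sup>2)"

definition Q_norm_mesh :: "(real^'n) set set \<Rightarrow> (real^'n \<Rightarrow> real) \<Rightarrow> real" where
  "Q_norm_mesh \<T> \<phi> = sqrt (\<Sum>K\<in>\<T>. (L2_norm K \<phi>)\<^sup>2)"

definition convection ::
    "(real^'n) set \<Rightarrow> (real^'n \<Rightarrow> real^'n) \<Rightarrow> (real^'n \<Rightarrow> real^'n) \<Rightarrow> real^'n \<Rightarrow> real^'n" where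
  "convection \<Omega> c \<xi> x = weak_jacobian \<Omega> \<xi> x *v c x"

definition form_A ::
    "(real^'n) set \<Rightarrow> real \<Rightarrow> real \<Rightarrow> (real^'n \<Rightarrow> real^'n) \<Rightarrow>
     (real^'n \<Rightarrow> real^'n) \<Rightarrow> (real^'n \<Rightarrow> real^'n) \<Rightarrow> real" where
  "form_A \<Omega> \<epsilon> \<kappa> c \<xi> \<zeta> =
     \<epsilon> * L2_inner \<Omega> (weak_jacobian \<Omega> \<xi>) (weak_jacobian \<Omega> \<zeta>)
     + L2_inner \<Omega> (\<lambda>x. \<kappa> *\<^sub>R \<xi> x + convection \<Omega> c \<xi> x) \<zeta>"

definition form_B ::
    "(real^'n) set \<Rightarrow> (real^'n \<Rightarrow> real^'n) \<Rightarrow> (real^'n \<Rightarrow> real) \<Rightarrow> real" where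
  "form_B \<Omega> \<zeta> \<phi> = L2_inner \<Omega> \<phi> (weak_divergence \<Omega> \<zeta>)"

definition form_C ::
    "(real^'n) set \<Rightarrow> real \<Rightarrow> real \<Rightarrow> (real^'n \<Rightarrow> real^'n) \<Rightarrow>
     (real^'n \<Rightarrow> real^'n) \<Rightarrow> (real^'n \<Rightarrow> real^'n) \<Rightarrow> real" where
  "form_C \<Omega> \<epsilon> \<kappa> c \<xi> \<zeta> =
     \<epsilon> * L2_inner \<Omega> (weak_jacobian \<Omega> \<xi>) (weak_jacobian \<Omega> \<zeta>)
     + L2_inner \<Omega> (\<lambda>x. \<kappa> *\<^sub>R \<xi> x - convection \<Omega> c \<xi> x) \<zeta>"

section \<open>Constants\<close>

text \<open>A box with edge vectors \<open>l i\<close>, not necessarily parallel to the coordinate axes.\<close>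

definition is_box :: "real^'n \<Rightarrow> ('n \<Rightarrow> real^'n) \<Rightarrow> (real^'n) set \<Rightarrow> bool" where
  "is_box x0 l S \<longleftrightarrow>
     (\<forall>i j. i \<noteq> j \<longrightarrow> l i \<bullet> l j = 0) \<and> (\<forall>i. l i \<noteq> 0) \<and>
     S = {x0 + (\<Sum>i\<in>UNIV. t i *\<^sub>R l i) | t. \<forall>i. 0 \<le> t i \<and> t i \<le> 1}"

definition poincare_const :: "('n::finite \<Rightarrow> real^'n) \<Rightarrow> real" where
  "poincare_const l = 1 / pi * (\<Sum>i\<in>UNIV. 1 / (norm (l i))\<^sup>2) powr (-1/2)"

definition C_Omega :: "real \<Rightarrow> real \<Rightarrow> real \<Rightarrow> real" where
  "C_Omega \<epsilon> \<kappa> C\<^sub>P = (if \<kappa> = 0 then C\<^sub>P / sqrt \<epsilon> else min (C\<^sub>P / sqrt \<epsilon>) (1 / sqrt \<kappa>))"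

definition inf_sup_constant :: "(real^'n) set \<Rightarrow> real \<Rightarrow> bool" where
  "inf_sup_constant \<Omega> \<beta> \<longleftrightarrow> 0 < \<beta> \<and>
     (\<forall>\<phi>\<in>pressure_space \<Omega>.
        ereal (\<beta> * L2_norm \<Omega> \<phi>) \<le>
          (SUP \<xi>\<in>{\<xi> \<in> velocity_space \<Omega>. \<not> (AE x in lebesgue_on \<Omega>. \<xi> x = 0)}.
             ereal (form_B \<Omega> \<xi> \<phi> / L2_norm \<Omega> (weak_jacobian \<Omega> \<xi>))))"

section \<open>State, adjoint and optimality systems\<close>

definition state_solution ::
    "(real^'n) set \<Rightarrow> real \<Rightarrow> real \<Rightarrow> (real^'n \<Rightarrow> real^'n) \<Rightarrow> (real^'n \<Rightarrow> real^'n) \<Rightarrow>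
     (real^'n \<Rightarrow> real^'n) \<Rightarrow> (real^'n \<Rightarrow> real) \<Rightarrow> bool" where
  "state_solution \<Omega> \<epsilon> \<kappa> c g y p \<longleftrightarrow>
     y \<in> velocity_space \<Omega> \<and> p \<in> pressure_space \<Omega> \<and>
     (\<forall>\<xi>\<in>velocity_space \<Omega>. form_A \<Omega> \<epsilon> \<kappa> c y \<xi> - form_B \<Omega> \<xi> p = L2_inner \<Omega> g \<xi>) \<and>
     (\<forall>\<phi>\<in>pressure_space \<Omega>. form_B \<Omega> y \<phi> = 0)"

definition adjoint_solution ::
    "(real^'n) set \<Rightarrow> real \<Rightarrow> real \<Rightarrow> (real^'n \<Rightarrow> real^'n) \<Rightarrow> (real^'n \<Rightarrow> real^'n) \<Rightarrow>
     (real^'n \<Rightarrow> real^'n) \<Rightarrow> (real^'n \<Rightarrow> real) \<Rightarrow> bool" where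
  "adjoint_solution \<Omega> \<epsilon> \<kappa> c g w q \<longleftrightarrow>
     w \<in> velocity_space \<Omega> \<and> q \<in> pressure_space \<Omega> \<and>
     (\<forall>\<zeta>\<in>velocity_space \<Omega>. form_C \<Omega> \<epsilon> \<kappa> c w \<zeta> + form_B \<Omega> \<zeta> q = L2_inner \<Omega> g \<zeta>) \<and>
     (\<forall>\<psi>\<in>pressure_space \<Omega>. form_B \<Omega> w \<psi> = 0)"

definition optimality_system ::
    "(real^'n) set \<Rightarrow> real \<Rightarrow> real \<Rightarrow> (real^'n \<Rightarrow> real^'n) \<Rightarrow> real \<Rightarrow>
     (real^'n \<Rightarrow> real^'n) \<Rightarrow> (real^'n \<Rightarrow> real^'n) \<Rightarrow> real^'n \<Rightarrow> real^'n \<Rightarrow>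
     (real^'n \<Rightarrow> real^'n) \<Rightarrow> (real^'n \<Rightarrow> real) \<Rightarrow> (real^'n \<Rightarrow> real^'n) \<Rightarrow> (real^'n \<Rightarrow> real) \<Rightarrow>
     (real^'n \<Rightarrow> real^'n) \<Rightarrow> bool" where
  "optimality_system \<Omega> \<epsilon> \<kappa> c \<theta> f y\<^sub>\<Omega> a b y p w q u \<longleftrightarrow>
     state_solution \<Omega> \<epsilon> \<kappa> c (\<lambda>x. f x + u x) y p \<and>
     adjoint_solution \<Omega> \<epsilon> \<kappa> c (\<lambda>x. y x - y\<^sub>\<Omega> x) w q \<and>
     u \<in> admissible_controls \<Omega> a b \<and>
     (\<forall>v\<in>admissible_controls \<Omega> a b.
        L2_inner \<Omega> (\<lambda>x. w x + \<theta> *\<^sub>R u x) (\<lambda>x. v x - u x) \<ge> 0)"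

definition function_subspace :: "('a \<Rightarrow> 'b::real_vector) set \<Rightarrow> bool" where
  "function_subspace X \<longleftrightarrow> (\<lambda>x. 0) \<in> X \<and>
     (\<forall>f\<in>X. \<forall>g\<in>X. (\<lambda>x. f x + g x) \<in> X) \<and> (\<forall>r. \<forall>f\<in>X. (\<lambda>x. r *\<^sub>R f x) \<in> X)"

definition discrete_optimality_system ::
    "(real^'n) set \<Rightarrow> real \<Rightarrow> real \<Rightarrow> (real^'n \<Rightarrow> real^'n) \<Rightarrow> real \<Rightarrow>
     (real^'n \<Rightarrow> real^'n) \<Rightarrow> (real^'n \<Rightarrow> real^'n) \<Rightarrow>
     (real^'n \<Rightarrow> real^'n) set \<Rightarrow> (real^'n \<Rightarrow> real) set \<Rightarrow> (real^'n \<Rightarrow> real^'n) set \<Rightarrow>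
     ((real^'n \<Rightarrow> real^'n) \<Rightarrow> (real^'n \<Rightarrow> real) \<Rightarrow> (real^'n \<Rightarrow> real^'n) \<Rightarrow> (real^'n \<Rightarrow> real^'n) \<Rightarrow> real) \<Rightarrow>
     ((real^'n \<Rightarrow> real^'n) \<Rightarrow> (real^'n \<Rightarrow> real) \<Rightarrow> (real^'n \<Rightarrow> real^'n) \<Rightarrow> (real^'n \<Rightarrow> real) \<Rightarrow> real) \<Rightarrow>
     ((real^'n \<Rightarrow> real^'n) \<Rightarrow> (real^'n \<Rightarrow> real) \<Rightarrow> (real^'n \<Rightarrow> real^'n) \<Rightarrow> (real^'n \<Rightarrow> real^'n) \<Rightarrow> real) \<Rightarrow>
     ((real^'n \<Rightarrow> real^'n) \<Rightarrow> (real^'n \<Rightarrow> real) \<Rightarrow> (real^'n \<Rightarrow> real^'n) \<Rightarrow> (real^'n \<Rightarrow> real) \<Rightarrow> real) \<Rightarrow>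
     (real^'n \<Rightarrow> real^'n) \<Rightarrow> (real^'n \<Rightarrow> real) \<Rightarrow> (real^'n \<Rightarrow> real^'n) \<Rightarrow> (real^'n \<Rightarrow> real) \<Rightarrow>
     (real^'n \<Rightarrow> real^'n) \<Rightarrow> bool" where
  "discrete_optimality_system \<Omega> \<epsilon> \<kappa> c \<theta> f y\<^sub>\<Omega> V\<^sub>T Q\<^sub>T U\<^sub>T \<S> \<H> \<Q> \<K> y p w q u \<longleftrightarrow>
     y \<in> V\<^sub>T \<and> p \<in> Q\<^sub>T \<and> w \<in> V\<^sub>T \<and> q \<in> Q\<^sub>T \<and> u \<in> U\<^sub>T \<and>
     (\<forall>\<xi>\<in>V\<^sub>T. form_A \<Omega> \<epsilon> \<kappa> c y \<xi> - form_B \<Omega> \<xi> p + \<S> y p (\<lambda>x. f x + u x) \<xi>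
              = L2_inner \<Omega> (\<lambda>x. f x + u x) \<xi>) \<and>
     (\<forall>\<phi>\<in>Q\<^sub>T. form_B \<Omega> y \<phi> + \<H> y p (\<lambda>x. f x + u x) \<phi> = 0) \<and>
     (\<forall>\<zeta>\<in>V\<^sub>T. form_C \<Omega> \<epsilon> \<kappa> c w \<zeta> + form_B \<Omega> \<zeta> q + \<Q> w q (\<lambda>x. y x - y\<^sub>\<Omega> x) \<zeta>
              = L2_inner \<Omega> (\<lambda>x. y x - y\<^sub>\<Omega> x) \<zeta>) \<and>
     (\<forall>\<psi>\<in>Q\<^sub>T. form_B \<Omega> w \<psi> + \<K> w q (\<lambda>x. y x - y\<^sub>\<Omega> x) \<psi> = 0) \<and>
     (\<forall>v\<in>U\<^sub>T. L2_inner \<Omega> (\<lambda>x. w x + \<theta> *\<^sub>R u x) (\<lambda>x. v x - u x) \<ge> 0)"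

section \<open>Control indicator and errors\<close>

definition box_projection ::
    "real^'n \<Rightarrow> real^'n \<Rightarrow> (real^'n \<Rightarrow> real^'n) \<Rightarrow> real^'n \<Rightarrow> real^'n" where
  "box_projection a b \<zeta> x = (\<chi> i. min (b $ i) (max (a $ i) (\<zeta> x $ i)))"

definition control_indicator ::
    "real \<Rightarrow> real^'n \<Rightarrow> real^'n \<Rightarrow> (real^'n \<Rightarrow> real^'n) \<Rightarrow> (real^'n \<Rightarrow> real^'n) \<Rightarrow>
     (real^'n) set \<Rightarrow> real" where
  "control_indicator \<theta> a b w\<^sub>T u\<^sub>T K =
     L2_norm K (\<lambda>x. box_projection a b (\<lambda>z. (- 1 / \<theta>) *\<^sub>R w\<^sub>T z) x - u\<^sub>T x)"

definition local_error ::
    "(real^'n) set \<Rightarrow> real \<Rightarrow> real \<Rightarrow> real \<Rightarrow> (real^'n \<Rightarrow> real^'n) \<Rightarrow> (real^'n \<Rightarrow> real) \<Rightarrow>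
     (real^'n \<Rightarrow> real^'n) \<Rightarrow> (real^'n \<Rightarrow> real) \<Rightarrow> (real^'n \<Rightarrow> real^'n) \<Rightarrow> (real^'n) set \<Rightarrow> real" where
  "local_error \<Omega> \<epsilon> \<kappa> \<rho> e\<^sub>y e\<^sub>p e\<^sub>w e\<^sub>q e\<^sub>u K =
     sqrt ((V_norm \<Omega> \<epsilon> \<kappa> K e\<^sub>y)\<^sup>2 + \<rho> * (L2_norm K e\<^sub>p)\<^sup>2
         + (V_norm \<Omega> \<epsilon> \<kappa> K e\<^sub>w)\<^sup>2 + \<rho> * (L2_norm K e\<^sub>q)\<^sup>2 + (L2_norm K e\<^sub>u)\<^sup>2)"

definition total_error ::
    "(real^'n) set \<Rightarrow> real \<Rightarrow> real \<Rightarrow> real \<Rightarrow> (real^'n) set set \<Rightarrow>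
     (real^'n \<Rightarrow> real^'n) \<Rightarrow> (real^'n \<Rightarrow> real) \<Rightarrow>
     (real^'n \<Rightarrow> real^'n) \<Rightarrow> (real^'n \<Rightarrow> real) \<Rightarrow> (real^'n \<Rightarrow> real^'n) \<Rightarrow> real" where
  "total_error \<Omega> \<epsilon> \<kappa> \<rho> \<T> e\<^sub>y e\<^sub>p e\<^sub>w e\<^sub>q e\<^sub>u =
     sqrt (\<Sum>K\<in>\<T>. (local_error \<Omega> \<epsilon> \<kappa> \<rho> e\<^sub>y e\<^sub>p e\<^sub>w e\<^sub>q e\<^sub>u K)\<^sup>2)"

end

theory Submission
  imports Defs "HOL-Computational_Algebra.Polynomial"
begin

text \<open>All error components are compared with the auxiliary solutions belonging to the discrete data,
  so that everything reduces to \<open>\<parallel>u - u\<^sub>T\<parallel>\<close>: testing the difference systems with the energy and the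
  inf-sup condition bounds the state, the adjoint and the pressures. For the control, adding the
  variational inequalities of \<open>u\<close> and of the projected control \<open>ut\<close> gives
  \<open>\<theta> \<parallel>u - ut\<parallel>\<^sup>2 \<le> (w\<^sub>T - w, u - ut)\<close>. Replacing \<open>w\<^sub>T\<close> by the adjoint of the state driven by \<open>ut\<close>
  makes the right-hand side nonpositive by duality, and the remainder is controlled by the indicators.
  That state need not exist exactly: a Galerkin solution in the span of the two error functions it is
  paired with is enough, so no completeness of the Sobolev spaces is used.\<close>

section \<open>Square-integrable functions\<close>

text \<open>The detour through \<open>ut\<close> is forced: \<open>u\<^sub>T\<close> is optimal only
  among discrete controls, whereas the projection of - w_T / \<theta> satisfies an exact inequality
  against every admissible control. Its distance to \<open>u\<^sub>T\<close> is what the control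
  indicator measures. Two functions span a large enough trial space because the fictitious state and
  its adjoint are tested only with each other, with the two given errors and with themselves, and
  all of these lie in the span. Divergence-free test functions remove the pressures. Each solution
  operator costs one factor C_Omega from data in L2 to the energy norm, and each return to L2
  another. In squares, the control acts on the adjoint with C^6 and the control indicator on the
  control with C^8, whence the top power 14; the numerical factors come from (A + B)^2 \<le> 2 A^2 +
  2 B^2. An obstacle precedes all this: weak gradients are chosen by \<open>SOME\<close>, so their
  linearity holds only almost everywhere and rests on uniqueness. Hence the smooth bumps and the
  fundamental lemma.\<close>

lemma L2D:
  assumes "f \<in> L2 S"
  shows L2_measurable: "f \<in> borel_measurable (lebesgue_on S)"
    and L2_integrable: "integrable (lebesgue_on S) (\<lambda>x. (norm (f x))\<^sup>2)"
  using assms by (auto simp: L2_def)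

lemma L2_add:
  assumes f: "f \<in> L2 S" and g: "g \<in> L2 S"
  shows "(\<lambda>x. f x + g x) \<in> L2 S"
proof -
  have "(norm (f x + g x))\<^sup>2 \<le> 2 * (norm (f x))\<^sup>2 + 2 * (norm (g x))\<^sup>2" for x
  proof -
    have "(norm (f x + g x))\<^sup>2 \<le> (norm (f x) + norm (g x))\<^sup>2"
      by (simp add: norm_triangle_ineq power_mono)
    also have "\<dots> \<le> 2 * (norm (f x))\<^sup>2 + 2 * (norm (g x))\<^sup>2"
      using sum_squares_bound[of "norm (f x)" "norm (g x)"] by (simp add: power2_sum)
    finally show ?thesis .
  qed
  then have le: "AE x in lebesgue_on S. norm ((norm (f x + g x))\<^sup>2)
      \<le> norm (2 * (norm (f x))\<^sup>2 + 2 * (norm (g x))\<^sup>2)"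
    by simp
  have "integrable (lebesgue_on S) (\<lambda>x. (norm (f x + g x))\<^sup>2)"
    by (rule Bochner_Integration.integrable_bound[OF _ _ le])
      (use L2D[OF f] L2D[OF g] in auto)
  then show ?thesis
    using L2_measurable[OF f] L2_measurable[OF g] by (simp add: L2_def)
qed

lemma L2_scaleR:
  assumes "f \<in> L2 S"
  shows "(\<lambda>x. r *\<^sub>R f x) \<in> L2 S"
  using L2D[OF assms] by (simp add: L2_def power_mult_distrib)

lemma L2_diff:
  assumes "f \<in> L2 S" "g \<in> L2 S"
  shows "(\<lambda>x. f x - g x) \<in> L2 S"
  using L2_add[OF assms(1) L2_scaleR[OF assms(2), of "-1"]] by simp

lemma L2_sum:
  assumes "\<And>i. i \<in> I \<Longrightarrow> f i \<in> L2 S"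
  shows "(\<lambda>x. \<Sum>i\<in>I. f i x) \<in> L2 S"
  using assms
proof (induction I rule: infinite_finite_induct)
  case (insert i I)
  then show ?case by (simp add: L2_add)
qed (auto simp: L2_def)

text \<open>Square integrability by pointwise domination, where the two functions may take values in
  different spaces. Components, modifications on null sets, the projected control and products with
  \<open>c\<close> all enter \<open>L2\<close> this way.\<close>

lemma L2_bounded_mult:
  fixes f :: "real^'n \<Rightarrow> 'b::euclidean_space" and g :: "real^'n \<Rightarrow> 'c::euclidean_space"
  assumes "f \<in> L2 S" "g \<in> borel_measurable (lebesgue_on S)"
    "AE x in lebesgue_on S. norm (g x) \<le> M * norm (f x)"
  shows "g \<in> L2 S"
proof -
  have "AE x in lebesgue_on S. norm ((norm (g x))\<^sup>2) \<le> norm (M\<^sup>2 * (norm (f x))\<^sup>2)"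
    using assms(3)
  proof eventually_elim
    case (elim x)
    then have "(norm (g x))\<^sup>2 \<le> (M * norm (f x))\<^sup>2" by (intro power_mono) auto
    then show ?case by (simp add: power_mult_distrib)
  qed
  then have "integrable (lebesgue_on S) (\<lambda>x. (norm (g x))\<^sup>2)"
    by (rule Bochner_Integration.integrable_bound[rotated 2])
      (use assms(2) L2D[OF assms(1)] in auto)
  then show ?thesis using assms(2) by (simp add: L2_def)
qed

lemma L2_inner_integrable:
  assumes f: "f \<in> L2 S" and g: "g \<in> L2 S"
  shows "integrable (lebesgue_on S) (\<lambda>x. f x \<bullet> g x)"
proof (rule Bochner_Integration.integrable_bound
    [of _ "\<lambda>x. (norm (f x))\<^sup>2 + (norm (g x))\<^sup>2"])
  have "norm (f x \<bullet> g x) \<le> norm ((norm (f x))\<^sup>2 + (norm (g x))\<^sup>2)" for x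
  proof -
    have "\<bar>f x \<bullet> g x\<bar> \<le> norm (f x) * norm (g x)" by (rule Cauchy_Schwarz_ineq2)
    also have "\<dots> \<le> (norm (f x))\<^sup>2 + (norm (g x))\<^sup>2"
      using sum_squares_bound[of "norm (f x)" "norm (g x)"]
        mult_nonneg_nonneg[OF norm_ge_zero[of "f x"] norm_ge_zero[of "g x"]] by linarith
    finally show ?thesis by simp
  qed
  then show "AE x in lebesgue_on S. norm (f x \<bullet> g x) \<le> norm ((norm (f x))\<^sup>2 + (norm (g x))\<^sup>2)"
    by simp
qed (use L2D[OF f] L2D[OF g] in auto)

lemma L2_inner_commute: "L2_inner S f g = L2_inner S g f"
  by (simp add: L2_inner_def inner_commute)

lemma L2_inner_add_left:
  assumes "f \<in> L2 S" "g \<in> L2 S" "h \<in> L2 S"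
  shows "L2_inner S (\<lambda>x. f x + g x) h = L2_inner S f h + L2_inner S g h"
  by (simp add: L2_inner_def inner_add_left L2_inner_integrable assms)

lemma L2_inner_scaleR_left: "L2_inner S (\<lambda>x. r *\<^sub>R f x) h = r * L2_inner S f h"
  by (simp add: L2_inner_def)

lemma L2_inner_diff_left:
  assumes "f \<in> L2 S" "g \<in> L2 S" "h \<in> L2 S"
  shows "L2_inner S (\<lambda>x. f x - g x) h = L2_inner S f h - L2_inner S g h"
  by (simp add: L2_inner_def inner_diff_left L2_inner_integrable assms)

lemma L2_inner_add_right:
  assumes "f \<in> L2 S" "g \<in> L2 S" "h \<in> L2 S"
  shows "L2_inner S h (\<lambda>x. f x + g x) = L2_inner S h f + L2_inner S h g"
  using L2_inner_add_left[OF assms] by (simp add: L2_inner_commute)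

lemma L2_inner_scaleR_right: "L2_inner S h (\<lambda>x. r *\<^sub>R f x) = r * L2_inner S h f"
  by (simp add: L2_inner_def)

lemma L2_inner_diff_right:
  assumes "f \<in> L2 S" "g \<in> L2 S" "h \<in> L2 S"
  shows "L2_inner S h (\<lambda>x. f x - g x) = L2_inner S h f - L2_inner S h g"
  using L2_inner_diff_left[OF assms] by (simp add: L2_inner_commute)

lemma L2_norm_nonneg: "0 \<le> L2_norm S f"
  by (simp add: L2_norm_def)

lemma L2_norm_power2: "(L2_norm S f)\<^sup>2 = L2_inner S f f"
  by (simp add: L2_norm_def L2_inner_def power2_norm_eq_inner)

text \<open>A positive semidefinite form with associated seminorms \<open>n\<close>, \<open>m\<close> on the two arguments:
  its expansion along \<open>s f - t g\<close> gives the Cauchy-Schwarz inequality.\<close>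

lemma Cauchy_Schwarz_from_expansion:
  fixes i n m :: real
  assumes "\<And>s t. 0 \<le> s\<^sup>2 * n\<^sup>2 - 2 * s * t * i + t\<^sup>2 * m\<^sup>2" "0 \<le> n" "0 \<le> m"
  shows "\<bar>i\<bar> \<le> n * m"
proof -
  have sq: "i\<^sup>2 \<le> n\<^sup>2 * m\<^sup>2"
  proof (cases "m = 0")
    case True
    \<comment> \<open>For \<open>m = 0\<close> the expansion is affine in t, and these values make
      it equal to - i^2.\<close>
    have "0 \<le> i\<^sup>2 * n\<^sup>2 - 2 * i * ((n\<^sup>2 + 1) / 2) * i"
      using assms(1)[of i "(n\<^sup>2 + 1) / 2"] True by simp
    also have "\<dots> = - (i\<^sup>2)" by (simp add: power2_eq_square field_simps)
    finally show ?thesis using True by simp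
  next
    case False
    \<comment> \<open>The usual minimizer t / s = i / m^2, scaled to avoid a division.\<close>
    have "0 \<le> m\<^sup>2 * m\<^sup>2 * n\<^sup>2 - m\<^sup>2 * i\<^sup>2"
      using assms(1)[of "m\<^sup>2" i] by (simp add: power2_eq_square algebra_simps)
    then have "m\<^sup>2 * i\<^sup>2 \<le> m\<^sup>2 * (n\<^sup>2 * m\<^sup>2)" by (simp add: algebra_simps)
    then show ?thesis using False by simp
  qed
  then have "\<bar>i\<bar>\<^sup>2 \<le> (n * m)\<^sup>2" by (simp add: power_mult_distrib)
  then show ?thesis
    by (rule power2_le_imp_le) (simp add: assms)
qed

lemma L2_Cauchy_Schwarz:
  assumes f: "f \<in> L2 S" and g: "g \<in> L2 S"
  shows "\<bar>L2_inner S f g\<bar> \<le> L2_norm S f * L2_norm S g"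
proof (rule Cauchy_Schwarz_from_expansion)
  fix s t :: real
  have "0 \<le> L2_inner S (\<lambda>x. s *\<^sub>R f x - t *\<^sub>R g x) (\<lambda>x. s *\<^sub>R f x - t *\<^sub>R g x)"
    by (simp flip: L2_norm_power2)
  also have "\<dots> = s\<^sup>2 * (L2_norm S f)\<^sup>2 - 2 * s * t * L2_inner S f g + t\<^sup>2 * (L2_norm S g)\<^sup>2"
    unfolding L2_norm_power2 using f g
    by (simp add: L2_inner_diff_left L2_inner_diff_right L2_scaleR L2_diff L2_inner_scaleR_left
        L2_inner_scaleR_right L2_inner_commute[of S g f] power2_eq_square algebra_simps)
  finally show "0 \<le> s\<^sup>2 * (L2_norm S f)\<^sup>2 - 2 * s * t * L2_inner S f g + t\<^sup>2 * (L2_norm S g)\<^sup>2" .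
qed (auto simp: L2_norm_nonneg)

lemma L2_norm_triangle:
  assumes f: "f \<in> L2 S" and g: "g \<in> L2 S"
  shows "L2_norm S (\<lambda>x. f x + g x) \<le> L2_norm S f + L2_norm S g"
proof (rule power2_le_imp_le)
  have "(L2_norm S (\<lambda>x. f x + g x))\<^sup>2 =
      (L2_norm S f)\<^sup>2 + 2 * L2_inner S f g + (L2_norm S g)\<^sup>2"
    using f g by (simp add: L2_norm_power2 L2_inner_add_left L2_inner_add_right L2_add
        L2_inner_commute[of S g f])
  also have "\<dots> \<le> (L2_norm S f + L2_norm S g)\<^sup>2"
    using L2_Cauchy_Schwarz[OF f g] by (simp add: power2_sum)
  finally show "(L2_norm S (\<lambda>x. f x + g x))\<^sup>2 \<le> (L2_norm S f + L2_norm S g)\<^sup>2" .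
qed (simp add: L2_norm_nonneg)

lemma L2_norm_scaleR: "L2_norm S (\<lambda>x. r *\<^sub>R f x) = \<bar>r\<bar> * L2_norm S f"
  by (simp add: L2_norm_def power_mult_distrib real_sqrt_mult)

lemma L2_norm_minus_commute: "L2_norm S (\<lambda>x. f x - g x) = L2_norm S (\<lambda>x. g x - f x)"
  by (simp add: L2_norm_def norm_minus_commute)

section \<open>Invariance under changes on null sets\<close>

text \<open>Completeness of Lebesgue measure, transferred to the restricted space by extending both
  functions by zero. It is needed because weak gradients are determined only up to null
  sets.\<close>

lemma borel_measurable_lebesgue_on_AE:
  fixes f g :: "real^'n \<Rightarrow> 'b::euclidean_space"
  assumes S: "S \<in> sets lebesgue" and f: "f \<in> borel_measurable (lebesgue_on S)"
    and eq: "AE x in lebesgue_on S. f x = g x"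
  shows "g \<in> borel_measurable (lebesgue_on S)"
proof -
  have "AE x in lebesgue. (if x \<in> S then f x else 0) = (if x \<in> S then g x else 0)"
    using eq S by (auto simp: AE_restrict_space_iff elim: eventually_mono)
  with borel_measurable_if_I[OF f S] show ?thesis
    by (intro borel_measurable_if_D) (rule borel_measurable_AE)
qed

lemma L2_cong_AE:
  assumes S: "S \<in> sets lebesgue" and f: "f \<in> L2 S"
    and eq: "AE x in lebesgue_on S. f x = g x"
  shows "g \<in> L2 S"
proof (rule L2_bounded_mult[OF f])
  show "g \<in> borel_measurable (lebesgue_on S)"
    using borel_measurable_lebesgue_on_AE[OF S L2_measurable[OF f] eq] .
  show "AE x in lebesgue_on S. norm (g x) \<le> 1 * norm (f x)"
    using eq by eventually_elim simp
qed

lemma L2_inner_cong_AE: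
  assumes S: "S \<in> sets lebesgue" and "f \<in> L2 S" "h \<in> L2 S"
    and eq: "AE x in lebesgue_on S. f x = f' x" "AE x in lebesgue_on S. h x = h' x"
  shows "L2_inner S f h = L2_inner S f' h'"
proof -
  have "f' \<in> L2 S" "h' \<in> L2 S" using L2_cong_AE assms by blast+
  moreover have "AE x in lebesgue_on S. f x \<bullet> h x = f' x \<bullet> h' x"
    using eq by eventually_elim simp
  ultimately show ?thesis
    unfolding L2_inner_def using assms
    by (intro integral_cong_AE borel_measurable_inner) (auto dest: L2_measurable)
qed

lemma L2_norm_cong_AE:
  assumes "S \<in> sets lebesgue" "f \<in> L2 S" "AE x in lebesgue_on S. f x = g x"
  shows "L2_norm S f = L2_norm S g"
proof -
  have "(L2_norm S f)\<^sup>2 = (L2_norm S g)\<^sup>2"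
    using L2_inner_cong_AE[OF assms(1,2,2,3,3)] by (simp add: L2_norm_power2)
  then show ?thesis using L2_norm_nonneg by (metis power2_eq_iff_nonneg)
qed

lemma L2_norm_mono_AE:
  fixes f :: "real^'n \<Rightarrow> 'b::euclidean_space" and g :: "real^'n \<Rightarrow> 'c::euclidean_space"
  assumes f: "f \<in> L2 S" and g: "g \<in> borel_measurable (lebesgue_on S)"
    and le: "AE x in lebesgue_on S. norm (g x) \<le> M * norm (f x)" and M: "0 \<le> M"
  shows "L2_norm S g \<le> M * L2_norm S f"
proof (rule power2_le_imp_le)
  have "(L2_norm S g)\<^sup>2 = (\<integral>x. (norm (g x))\<^sup>2 \<partial>lebesgue_on S)"
    by (simp add: L2_norm_def)
  also have "\<dots> \<le> (\<integral>x. M\<^sup>2 * (norm (f x))\<^sup>2 \<partial>lebesgue_on S)"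
  proof (rule integral_mono_AE)
    show "AE x in lebesgue_on S. (norm (g x))\<^sup>2 \<le> M\<^sup>2 * (norm (f x))\<^sup>2"
      using le
    proof eventually_elim
      case (elim x)
      then have "(norm (g x))\<^sup>2 \<le> (M * norm (f x))\<^sup>2" by (intro power_mono) auto
      then show ?case by (simp add: power_mult_distrib)
    qed
  qed (use L2D[OF f] L2D[OF L2_bounded_mult[OF f g le]] in auto)
  also have "\<dots> = (M * L2_norm S f)\<^sup>2"
    by (simp add: L2_norm_def power_mult_distrib)
  finally show "(L2_norm S g)\<^sup>2 \<le> (M * L2_norm S f)\<^sup>2" .
qed (simp add: M L2_norm_nonneg)

section \<open>Vector fields and their components\<close>

lemma L2_component:
  fixes f :: "real^'n \<Rightarrow> 'b::euclidean_space^'m"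
  assumes "f \<in> L2 S"
  shows "(\<lambda>x. f x $ i) \<in> L2 S"
proof (rule L2_bounded_mult[OF assms])
  have "(\<lambda>v::'b^'m. v $ i) \<in> borel_measurable borel"
    by (intro borel_measurable_continuous_onI continuous_intros)
  with L2_measurable[OF assms] show "(\<lambda>x. f x $ i) \<in> borel_measurable (lebesgue_on S)"
    by (rule measurable_compose)
  show "AE x in lebesgue_on S. norm (f x $ i) \<le> 1 * norm (f x)"
    by (simp add: Finite_Cartesian_Product.norm_nth_le)
qed

lemma borel_measurable_vec_lambda:
  fixes f :: "'m::finite \<Rightarrow> 'a \<Rightarrow> 'b::euclidean_space"
  assumes "\<And>i. f i \<in> borel_measurable M"
  shows "(\<lambda>x. \<chi> i. f i x) \<in> borel_measurable M"
proof (rule borel_measurable_euclidean_space[THEN iffD2], rule ballI)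
  fix b :: "'b^'m" assume "b \<in> Basis"
  then obtain i u where "b = axis i u" "u \<in> Basis" by (auto simp: Basis_vec_def)
  then show "(\<lambda>x. (\<chi> i. f i x) \<bullet> b) \<in> borel_measurable M"
    using assms by (simp add: inner_axis)
qed

lemma L2_vec_iff:
  fixes f :: "real^'n \<Rightarrow> 'b::euclidean_space^'m"
  shows "f \<in> L2 S \<longleftrightarrow> (\<forall>i. (\<lambda>x. f x $ i) \<in> L2 S)"
proof
  assume R: "\<forall>i. (\<lambda>x. f x $ i) \<in> L2 S"
  have "(\<lambda>x. \<chi> i. f x $ i) \<in> borel_measurable (lebesgue_on S)"
    using R by (intro borel_measurable_vec_lambda) (auto dest: L2_measurable)
  moreover have "integrable (lebesgue_on S) (\<lambda>x. \<Sum>i\<in>UNIV. (norm (f x $ i))\<^sup>2)"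
    using R by (intro Bochner_Integration.integrable_sum) (auto dest: L2_integrable)
  then have "integrable (lebesgue_on S) (\<lambda>x. (norm (f x))\<^sup>2)"
    by (simp add: norm_vec_def L2_set_def sum_nonneg)
  ultimately show "f \<in> L2 S" by (simp add: L2_def)
qed (auto intro: L2_component)

lemma L2_inner_vec:
  fixes f g :: "real^'n \<Rightarrow> 'b::euclidean_space^'m"
  assumes "f \<in> L2 S" "g \<in> L2 S"
  shows "L2_inner S f g = (\<Sum>i\<in>UNIV. L2_inner S (\<lambda>x. f x $ i) (\<lambda>x. g x $ i))"
  unfolding L2_inner_def inner_vec_def
  by (intro Bochner_Integration.integral_sum L2_inner_integrable L2_component assms)

section \<open>Smooth bump functions\<close>

text \<open>Built from \<open>frechet_derivative\<close> on the axes so that it agrees literally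
  with the partial derivatives in \<open>has_weak_gradient\<close>.\<close>

definition grad :: "(real^'n \<Rightarrow> real) \<Rightarrow> real^'n \<Rightarrow> real^'n" where
  "grad \<phi> x = (\<chi> i. frechet_derivative \<phi> (at x) (axis i 1))"

lemma grad_eqI:
  assumes "(\<phi> has_derivative (\<lambda>h. g \<bullet> h)) (at x)"
  shows "grad \<phi> x = g"
  using frechet_derivative_at[OF assms, symmetric] by (simp add: grad_def vec_eq_iff inner_axis)

text \<open>The gradient quantified existentially in \<open>Ck\<close> can only be the classical
  one. With the canonical \<open>grad\<close> in its place, inductions on the order of smoothness
  can name the derivative.\<close>

lemma Ck_Suc_iff:
  "Ck (Suc k) \<phi> \<longleftrightarrow>
     (\<forall>x. (\<phi> has_derivative (\<lambda>h. grad \<phi> x \<bullet> h)) (at x)) \<and> (\<forall>i. Ck k (\<lambda>x. grad \<phi> x $ i))"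
    (is "_ \<longleftrightarrow> ?R")
proof
  assume "Ck (Suc k) \<phi>"
  then obtain g where g: "\<And>x. (\<phi> has_derivative (\<lambda>h. g x \<bullet> h)) (at x)" "\<And>i. Ck k (\<lambda>x. g x $ i)"
    by auto
  moreover have "grad \<phi> = g" using grad_eqI[OF g(1)] by auto
  ultimately show ?R by simp
qed auto

declare Ck.simps(2) [simp del]

lemma Ck_SucI:
  assumes "\<And>x. (\<phi> has_derivative (\<lambda>h. g x \<bullet> h)) (at x)" "\<And>i. Ck k (\<lambda>x. g x $ i)"
  shows "Ck (Suc k) \<phi>"
  using assms by (auto simp: Ck.simps(2))

lemma Ck_continuous:
  assumes "Ck k \<phi>"
  shows "continuous_on S \<phi>"
proof (cases k)
  case 0
  then show ?thesis using assms continuous_on_subset by auto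
next
  case (Suc j)
  then show ?thesis using assms
    by (auto simp: Ck_Suc_iff intro!: continuous_at_imp_continuous_on has_derivative_continuous)
qed

lemma Ck_mono: "Ck (Suc k) \<phi> \<Longrightarrow> Ck k \<phi>"
proof (induction k arbitrary: \<phi>)
  case 0
  then show ?case using Ck_continuous by simp
next
  case (Suc k)
  then show ?case
    by (subst Ck_Suc_iff) (auto simp: Ck_Suc_iff[of "Suc k"])
qed

lemma Ck_const: "Ck k (\<lambda>x. r)"
proof (induction k arbitrary: r)
  case (Suc k)
  show ?case by (rule Ck_SucI[of _ "\<lambda>x. 0"]) (simp_all add: Suc)
qed simp

lemma Ck_add: "Ck k \<phi> \<Longrightarrow> Ck k \<psi> \<Longrightarrow> Ck k (\<lambda>x. \<phi> x + \<psi> x)"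
proof (induction k arbitrary: \<phi> \<psi>)
  case (Suc k)
  show ?case
    by (rule Ck_SucI[of _ "\<lambda>x. grad \<phi> x + grad \<psi> x"])
      (use Suc in \<open>auto simp: Ck_Suc_iff inner_add_left intro!: has_derivative_add\<close>)
qed (simp add: continuous_on_add)

lemma Ck_mult: "Ck k \<phi> \<Longrightarrow> Ck k \<psi> \<Longrightarrow> Ck k (\<lambda>x. \<phi> x * \<psi> x)"
proof (induction k arbitrary: \<phi> \<psi>)
  case (Suc k)
  show ?case
  proof (rule Ck_SucI[of _ "\<lambda>x. \<phi> x *\<^sub>R grad \<psi> x + \<psi> x *\<^sub>R grad \<phi> x"])
    fix x
    have "((\<lambda>x. \<phi> x * \<psi> x) has_derivative
        (\<lambda>h. \<phi> x * (grad \<psi> x \<bullet> h) + (grad \<phi> x \<bullet> h) * \<psi> x)) (at x)"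
      using Suc.prems by (intro has_derivative_mult) (auto simp: Ck_Suc_iff)
    then show "((\<lambda>x. \<phi> x * \<psi> x) has_derivative
        (\<lambda>h. (\<phi> x *\<^sub>R grad \<psi> x + \<psi> x *\<^sub>R grad \<phi> x) \<bullet> h)) (at x)"
      by (simp add: inner_add_left mult.commute)
  next
    fix i
    show "Ck k (\<lambda>x. (\<phi> x *\<^sub>R grad \<psi> x + \<psi> x *\<^sub>R grad \<phi> x) $ i)"
      using Suc.prems Suc.prems[THEN Ck_mono]
      by (simp add: Ck_Suc_iff[of k]) (intro Ck_add Suc.IH; simp)
  qed
qed (simp add: continuous_on_mult)

lemma Ck_prod: "(\<And>i. i \<in> I \<Longrightarrow> Ck k (\<phi> i)) \<Longrightarrow> Ck k (\<lambda>x. \<Prod>i\<in>I. \<phi> i x)"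
  by (induction I rule: infinite_finite_induct) (auto intro: Ck_const Ck_mult)

text \<open>Functions of this shape are closed under differentiation, also at the origin, and so are
  smooth.\<close>

definition flat :: "real poly \<Rightarrow> real \<Rightarrow> real" where
  "flat p t = (if t > 0 then poly p (1 / t) * exp (- 1 / t) else 0)"

lemma poly_div_exp_tendsto_0: "((\<lambda>t. poly p t / exp t) \<longlongrightarrow> (0::real)) at_top"
proof -
  have "((\<lambda>t. \<Sum>i\<le>degree p. coeff p i * (t ^ i / exp t)) \<longlongrightarrow> (\<Sum>i\<le>degree p. coeff p i * 0)) at_top"
    by (intro tendsto_sum tendsto_mult_left tendsto_power_div_exp_0)
  then show ?thesis by (simp add: poly_altdef sum_divide_distrib)
qed

text \<open>For t > 0 the chain rule gives (p - p')(1/t) exp(-1/t) / t^2, and 1/t^2 is the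
  polynomial \<open>[:0, 0, 1:]\<close> at 1/t. At the origin exponential decay beats every power of
  1/t.\<close>

lemma flat_has_real_derivative:
  "(flat p has_real_derivative flat ([:0, 0, 1:] * (p - pderiv p)) t) (at t)"
proof -
  consider "t > 0" | "t < 0" | "t = 0" by linarith
  then show ?thesis
  proof cases
    case 1
    have "((\<lambda>t. poly p (1 / t) * exp (- 1 / t)) has_real_derivative
        flat ([:0, 0, 1:] * (p - pderiv p)) t) (at t)"
      using 1 by (auto intro!: derivative_eq_intros DERIV_chain2[of "poly p"] poly_DERIV
          simp: flat_def power2_eq_square field_simps)
    then show ?thesis
      by (rule DERIV_cong_ev[THEN iffD1, OF refl _ refl, rotated])
        (use 1 in \<open>auto simp: flat_def elim!: eventually_mono[OF eventually_gt_at_top]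
          intro: eventually_mono[OF eventually_nhds_in_open[of "{0<..}"]]\<close>)
  next
    case 2
    have "((\<lambda>t. 0) has_real_derivative flat ([:0, 0, 1:] * (p - pderiv p)) t) (at t)"
      using 2 by (simp add: flat_def)
    then show ?thesis
      by (rule DERIV_cong_ev[THEN iffD1, OF refl _ refl, rotated])
        (use 2 in \<open>auto simp: flat_def
          intro: eventually_mono[OF eventually_nhds_in_open[of "{..<0}"]]\<close>)
  next
    case 3
    \<comment> \<open>Dividing by h multiplies the polynomial by its variable 1/h, which is
      \<open>pCons 0 p\<close>; with t = 1/h the claim becomes decay at infinity.\<close>
    have "((\<lambda>h. poly (pCons 0 p) (inverse h) / exp (inverse h)) \<longlongrightarrow> 0) (at_right 0)"
      by (rule filterlim_compose[OF poly_div_exp_tendsto_0 filterlim_inverse_at_top_right])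
    then have "((\<lambda>h. flat p h / h) \<longlongrightarrow> 0) (at_right 0)"
      by (rule Lim_transform_eventually)
        (auto simp: flat_def eventually_at_filter exp_minus field_simps)
    moreover have "((\<lambda>h. flat p h / h) \<longlongrightarrow> 0) (at_left 0)"
      by (rule Lim_transform_eventually[OF tendsto_const])
        (auto simp: flat_def eventually_at_filter)
    ultimately have "((\<lambda>h. flat p h / h) \<longlongrightarrow> 0) (at 0)"
      by (simp add: filterlim_split_at)
    then show ?thesis using 3 by (simp add: DERIV_def flat_def)
  qed
qed

lemma flat_continuous: "continuous_on S (flat p)"
  using flat_has_real_derivative
  by (intro continuous_at_imp_continuous_on ballI DERIV_isCont)

lemma Ck_flat: "Ck k (\<lambda>x. flat p (v \<bullet> x + s))"
proof (induction k arbitrary: p)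
  case 0
  show ?case
    by (simp, intro continuous_on_compose2[OF flat_continuous[of UNIV]] continuous_intros) auto
next
  case (Suc k)
  let ?q = "[:0, 0, 1:] * (p - pderiv p)"
  show ?case
  proof (rule Ck_SucI[of _ "\<lambda>x. flat ?q (v \<bullet> x + s) *\<^sub>R v"])
    fix x
    have "((\<lambda>x. flat p (v \<bullet> x + s)) has_derivative (\<lambda>h. (v \<bullet> h) * flat ?q (v \<bullet> x + s))) (at x)"
      by (rule has_derivative_compose[OF _ flat_has_real_derivative[unfolded has_field_derivative_def],
            THEN has_derivative_eq_rhs]) (auto intro!: derivative_eq_intros)
    then show "((\<lambda>x. flat p (v \<bullet> x + s)) has_derivative
        (\<lambda>h. (flat ?q (v \<bullet> x + s) *\<^sub>R v) \<bullet> h)) (at x)"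
      by (simp add: mult.commute)
  next
    fix i
    show "Ck k (\<lambda>x. (flat ?q (v \<bullet> x + s) *\<^sub>R v) $ i)"
      by (simp, intro Ck_mult Ck_const Suc.IH)
  qed
qed

text \<open>A smooth minorant of the indicator of the open box rather than a normalized mollifier:
  growing \<open>m\<close> steepens the flanks, and the values inside tend to 1.\<close>

definition bump :: "real^'n \<Rightarrow> real^'n \<Rightarrow> nat \<Rightarrow> real^'n \<Rightarrow> real" where
  "bump a b m x = (\<Prod>i\<in>UNIV. flat 1 (m * (x $ i - a $ i)) * flat 1 (m * (b $ i - x $ i)))"

lemma Ck_bump:
  fixes a b :: "real^'n"
  shows "Ck k (bump a b m)"
proof -
  have "Ck k (\<lambda>x::real^'n. \<Prod>i\<in>UNIV.
      flat 1 ((real m *\<^sub>R axis i 1) \<bullet> x + - (real m * a $ i)) *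
      flat 1 ((- real m *\<^sub>R axis i 1) \<bullet> x + real m * b $ i))"
    by (intro Ck_prod Ck_mult Ck_flat)
  moreover have "bump a b m = (\<lambda>x::real^'n. \<Prod>i\<in>UNIV.
      flat 1 ((real m *\<^sub>R axis i 1) \<bullet> x + - (real m * a $ i)) *
      flat 1 ((- real m *\<^sub>R axis i 1) \<bullet> x + real m * b $ i))"
    unfolding bump_def by (intro ext prod.cong) (simp_all add: inner_axis' algebra_simps)
  ultimately show ?thesis by simp
qed

lemma flat_1_bounds: "0 \<le> flat 1 t" "flat 1 t \<le> 1"
  by (auto simp: flat_def)

lemma bump_bounds: "0 \<le> bump a b m x" "bump a b m x \<le> 1"
  unfolding bump_def
  by (auto intro!: prod_nonneg prod_le_1 mult_nonneg_nonneg mult_le_one flat_1_bounds)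

lemma bump_outside:
  assumes "x \<notin> box a b"
  shows "bump a b m x = 0"
proof -
  obtain i where "\<not> (a $ i < x $ i \<and> x $ i < b $ i)" using assms by (auto simp: mem_box_cart)
  then have "flat 1 (m * (x $ i - a $ i)) * flat 1 (m * (b $ i - x $ i)) = 0"
    by (auto simp: flat_def mult_less_0_iff zero_less_mult_iff)
  then show ?thesis unfolding bump_def by (intro prod_zero) auto
qed

lemma flat_1_tendsto:
  assumes "t > 0"
  shows "(\<lambda>m. flat 1 (real m * t)) \<longlonglongrightarrow> 1"
proof -
  have "(\<lambda>m. exp (- (1 / t) * inverse (real m))) \<longlonglongrightarrow> exp (- (1 / t) * 0)"
    by (intro tendsto_intros LIMSEQ_inverse_real_of_nat[THEN LIMSEQ_imp_Suc])
  then have "(\<lambda>m. exp (- (1 / t) * inverse (real m))) \<longlonglongrightarrow> 1" by simp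
  then show ?thesis
  proof (rule Lim_transform_eventually)
    show "\<forall>\<^sub>F m in sequentially. exp (- (1 / t) * inverse (real m)) = flat 1 (real m * t)"
      using eventually_gt_at_top[of 0]
      by eventually_elim (use assms in \<open>auto simp: flat_def field_simps\<close>)
  qed
qed

lemma bump_tendsto:
  fixes a b :: "real^'n"
  assumes "x \<in> box a b"
  shows "(\<lambda>m. bump a b m x) \<longlonglongrightarrow> 1"
proof -
  have "(\<lambda>m. \<Prod>i\<in>UNIV. flat 1 (real m * (x $ i - a $ i)) * flat 1 (real m * (b $ i - x $ i)))
      \<longlonglongrightarrow> (\<Prod>i\<in>(UNIV::'n set). 1 * 1)"
    by (rule tendsto_prod[OF tendsto_mult[OF flat_1_tendsto flat_1_tendsto]])
      (use assms in \<open>auto simp: mem_box_cart\<close>)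
  then show ?thesis by (simp add: bump_def)
qed

section \<open>Test functions\<close>

lemma test_functionsI:
  assumes "\<And>k. Ck k \<phi>" "compact K" "K \<subseteq> \<Omega>" "\<And>x. x \<notin> K \<Longrightarrow> \<phi> x = 0"
  shows "\<phi> \<in> test_functions \<Omega>"
proof -
  have "closure {x. \<phi> x \<noteq> 0} \<subseteq> K"
    using assms by (intro closure_minimal) (auto intro: compact_imp_closed)
  moreover have "compact (closure {x. \<phi> x \<noteq> 0})"
    using compact_Int_closed[OF assms(2) closed_closure[of "{x. \<phi> x \<noteq> 0}"]] calculation
    by (simp add: Int_absorb1)
  ultimately show ?thesis using assms by (auto simp: test_functions_def)
qed

lemma test_functionsE:
  assumes "\<phi> \<in> test_functions \<Omega>"
  obtains K where "compact K" "K \<subseteq> \<Omega>" "\<And>x. x \<notin> K \<Longrightarrow> \<phi> x = 0" "\<And>x. x \<notin> K \<Longrightarrow> grad \<phi> x = 0"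
proof -
  define K where "K = closure {x. \<phi> x \<noteq> 0}"
  have K: "compact K" "K \<subseteq> \<Omega>" using assms by (auto simp: test_functions_def K_def)
  have zero: "\<phi> x = 0" if "x \<notin> K" for x
    using that closure_subset[of "{x. \<phi> x \<noteq> 0}"] by (auto simp: K_def)
  have "grad \<phi> x = 0" if "x \<notin> K" for x
  proof (rule grad_eqI)
    have "open (- K)" using K(1) compact_imp_closed by auto
    then show "(\<phi> has_derivative (\<lambda>h. 0 \<bullet> h)) (at x)"
      by (rule has_derivative_transform_within_open[of "\<lambda>_. 0", rotated])
        (use that zero in auto)
  qed
  with K zero show thesis by (rule that)
qed

lemma test_function_derivative:
  assumes "\<phi> \<in> test_functions \<Omega>"
  shows "(\<phi> has_derivative (\<lambda>h. grad \<phi> x \<bullet> h)) (at x)"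
proof -
  have "Ck (Suc 0) \<phi>" using assms by (simp add: test_functions_def)
  then show ?thesis by (simp add: Ck_Suc_iff)
qed

lemma test_function_continuous:
  assumes "\<phi> \<in> test_functions \<Omega>"
  shows "continuous_on S \<phi>" "continuous_on S (grad \<phi>)" "continuous_on S (\<lambda>x. grad \<phi> x $ i)"
proof -
  have Ck: "Ck (Suc 0) \<phi>" using assms by (simp add: test_functions_def)
  show "continuous_on S \<phi>" using Ck by (rule Ck_continuous)
  show *: "continuous_on S (\<lambda>x. grad \<phi> x $ i)" for i
    using Ck Ck_continuous[of 0] by (auto simp: Ck_Suc_iff)
  have "continuous_on S (\<lambda>x. \<chi> i. grad \<phi> x $ i)"
    by (intro continuous_on_vec_lambda *)
  then show "continuous_on S (grad \<phi>)" by simp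
qed

lemma test_function_mult:
  assumes \<phi>: "\<phi> \<in> test_functions \<Omega>" and \<psi>: "\<psi> \<in> test_functions \<Omega>"
  shows "(\<lambda>x. \<phi> x * \<psi> x) \<in> test_functions \<Omega>"
    and "grad (\<lambda>x. \<phi> x * \<psi> x) x = \<phi> x *\<^sub>R grad \<psi> x + \<psi> x *\<^sub>R grad \<phi> x"
proof -
  obtain K where "compact K" "K \<subseteq> \<Omega>" "\<And>x. x \<notin> K \<Longrightarrow> \<phi> x = 0"
    using test_functionsE[OF \<phi>] by metis
  then show "(\<lambda>x. \<phi> x * \<psi> x) \<in> test_functions \<Omega>"
    using \<phi> \<psi> by (intro test_functionsI[of _ K]) (auto intro: Ck_mult simp: test_functions_def)
  have "((\<lambda>x. \<phi> x * \<psi> x) has_derivative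
      (\<lambda>h. \<phi> x * (grad \<psi> x \<bullet> h) + (grad \<phi> x \<bullet> h) * \<psi> x)) (at x)"
    using \<phi> \<psi> by (intro has_derivative_mult test_function_derivative)
  then show "grad (\<lambda>x. \<phi> x * \<psi> x) x = \<phi> x *\<^sub>R grad \<psi> x + \<psi> x *\<^sub>R grad \<phi> x"
    by (intro grad_eqI) (simp add: inner_add_left mult.commute)
qed

section \<open>The fundamental lemma of the calculus of variations\<close>

lemma absolutely_integrable_on_iff_integrable:
  fixes f :: "'a::euclidean_space \<Rightarrow> 'b::euclidean_space"
  assumes "S \<in> sets lebesgue"
  shows "f absolutely_integrable_on S \<longleftrightarrow> integrable (lebesgue_on S) f"
  using assms by (simp add: set_integrable_def integrable_restrict_space)

text \<open>The integral of a directional derivative of a compactly supported function is the limit of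
  integrals of difference quotients, which vanish by translation invariance.\<close>

lemma lborel_integral_directional_derivative_eq_0:
  fixes F G :: "'a::euclidean_space \<Rightarrow> real"
  assumes der: "\<And>x. (F has_derivative D x) (at x)" "\<And>x. D x v = G x"
    and contG: "continuous_on UNIV G"
    and K: "compact K" "\<And>x. x \<notin> K \<Longrightarrow> F x = 0" "\<And>x. x \<notin> K \<Longrightarrow> G x = 0"
  shows "(\<integral>x. G x \<partial>lborel) = 0"
proof -
  obtain R where R: "\<And>x. x \<in> K \<Longrightarrow> norm x \<le> R"
    using compact_imp_bounded[OF K(1)] by (auto simp: bounded_iff)
  \<comment> \<open>Difference quotients with step at most 1 vanish outside the ball of radius
    \<open>R'\<close>. The intermediate points of the mean value theorem stay within radius
    \<open>R' + norm v\<close>, where \<open>M\<close> bounds \<open>G\<close>; this yields the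
    integrable majorant.\<close>
  define R' where "R' = R + norm v"
  obtain M where M: "\<And>x. norm x \<le> R' + norm v \<Longrightarrow> \<bar>G x\<bar> \<le> M"
  proof -
    have "compact (G ` cball 0 (R' + norm v))"
      by (intro compact_continuous_image continuous_on_subset[OF contG]) auto
    from compact_imp_bounded[OF this] show ?thesis
      using that by (force simp: bounded_iff)
  qed
  have contF: "continuous_on UNIV F"
    using der(1) has_derivative_continuous by (blast intro: continuous_at_imp_continuous_on)
  have [measurable]: "F \<in> borel_measurable borel" "G \<in> borel_measurable borel"
    using contF contG by (auto intro: borel_measurable_continuous_onI)
  have "integrable lborel (\<lambda>x. indicator K x *\<^sub>R F x)"
    by (intro borel_integrable_compact K continuous_on_subset[OF contF]) simp
  moreover have "(\<lambda>x. indicator K x *\<^sub>R F x) = F"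
    using K(2) by (fastforce simp: indicator_def)
  ultimately have intF: "integrable lborel F" by simp
  define t :: "nat \<Rightarrow> real" where "t n = inverse (Suc n)" for n
  have t: "0 < t n" "t n \<le> 1" for n by (auto simp: t_def field_simps)
  have t0: "t \<longlonglongrightarrow> 0" unfolding t_def by (rule LIMSEQ_inverse_real_of_nat)
  define Q where "Q n x = (F (x + t n *\<^sub>R v) - F x) / t n" for n x
  have intQ: "(\<integral>x. Q n x \<partial>lborel) = 0" for n
  proof -
    have shift: "integrable lborel (\<lambda>x. F (t n *\<^sub>R v + x))"
      "(\<integral>x. F (t n *\<^sub>R v + x) \<partial>lborel) = (\<integral>x. F x \<partial>lborel)"
      using integrable_distr[of "(+) (t n *\<^sub>R v)" lborel borel F]
        integral_distr[of "(+) (t n *\<^sub>R v)" lborel borel F] intF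
      by (simp_all add: lborel_distr_plus)
    then show ?thesis using intF by (simp add: Q_def add.commute)
  qed
  have "(\<lambda>n. \<integral>x. Q n x \<partial>lborel) \<longlonglongrightarrow> (\<integral>x. G x \<partial>lborel)"
  proof (rule integral_dominated_convergence[where w = "\<lambda>x. indicator (cball 0 R') x *\<^sub>R M"])
    show "integrable lborel (\<lambda>x. indicator (cball 0 R') x *\<^sub>R M)"
      by (intro borel_integrable_compact) auto
    show "Q n \<in> borel_measurable lborel" for n unfolding Q_def by measurable
    show "AE x in lborel. (\<lambda>n. Q n x) \<longlonglongrightarrow> G x"
    proof (rule AE_I2)
      fix x
      have "((\<lambda>s. F (x + s *\<^sub>R v)) has_derivative (\<lambda>s. D x (s *\<^sub>R v))) (at 0)"
        by (rule has_derivative_compose[where f = "\<lambda>s. x + s *\<^sub>R v" and g = F])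
          (auto intro!: derivative_eq_intros der(1))
      moreover have "(\<lambda>s. D x (s *\<^sub>R v)) = (\<lambda>s. s * G x)"
        using has_derivative_bounded_linear[OF der(1)[of x]] der(2)
        by (auto simp: linear_simps)
      ultimately have "((\<lambda>s. F (x + s *\<^sub>R v)) has_real_derivative G x) (at 0)"
        by (simp add: has_field_derivative_def mult_commute_abs)
      then have "((\<lambda>s. (F (x + s *\<^sub>R v) - F x) / s) \<longlongrightarrow> G x) (at 0)"
        by (simp add: DERIV_def)
      moreover have "filterlim t (at 0) sequentially"
        using t0 t(1) by (auto simp: filterlim_at intro!: always_eventually less_imp_neq[symmetric])
      ultimately show "(\<lambda>n. Q n x) \<longlonglongrightarrow> G x"
        unfolding Q_def by (rule filterlim_compose)
    qed
    show "AE x in lborel. norm (Q n x) \<le> indicator (cball 0 R') x *\<^sub>R M" for n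
    proof (rule AE_I2)
      fix x
      have tv: "norm (s *\<^sub>R v) \<le> norm v" if "0 \<le> s" "s \<le> 1" for s
        using that by (simp add: mult_left_le_one_le)
      show "norm (Q n x) \<le> indicator (cball 0 R') x *\<^sub>R M"
      proof (cases "norm x \<le> R'")
        case True
        have "\<exists>s>0. s < t n \<and> F (x + t n *\<^sub>R v) - F (x + 0 *\<^sub>R v) = (t n - 0) * G (x + s *\<^sub>R v)"
        proof (rule MVT2)
          fix s :: real
          have "((\<lambda>s. F (x + s *\<^sub>R v)) has_derivative (\<lambda>h. D (x + s *\<^sub>R v) (h *\<^sub>R v))) (at s)"
            by (rule has_derivative_compose[where f = "\<lambda>s. x + s *\<^sub>R v" and g = F])
              (auto intro!: derivative_eq_intros der(1))
          moreover have "(\<lambda>h. D (x + s *\<^sub>R v) (h *\<^sub>R v)) = (\<lambda>h. h * G (x + s *\<^sub>R v))"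
            using has_derivative_bounded_linear[OF der(1)[of "x + s *\<^sub>R v"]] der(2)
            by (auto simp: linear_simps)
          ultimately show "((\<lambda>s. F (x + s *\<^sub>R v)) has_real_derivative G (x + s *\<^sub>R v)) (at s)"
            by (simp add: has_field_derivative_def mult_commute_abs)
        qed (use t in auto)
        then obtain s where s: "0 < s" "s < t n"
          "F (x + t n *\<^sub>R v) - F x = t n * G (x + s *\<^sub>R v)" by auto
        then have "Q n x = G (x + s *\<^sub>R v)" using t(1)[of n] by (simp add: Q_def)
        moreover have "norm (x + s *\<^sub>R v) \<le> R' + norm v"
          using True tv[of s] s t(2)[of n] norm_triangle_ineq[of x "s *\<^sub>R v"] by linarith
        ultimately show ?thesis using M[of "x + s *\<^sub>R v"] True by simp
      next
        case False
        have "x \<notin> K" using R[of x] False norm_ge_zero[of v] unfolding R'_def by linarith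
        moreover have "norm x \<le> norm (x + t n *\<^sub>R v) + norm (t n *\<^sub>R v)"
          using norm_triangle_ineq4[of "x + t n *\<^sub>R v" "t n *\<^sub>R v"] by simp
        then have "x + t n *\<^sub>R v \<notin> K"
          using R[of "x + t n *\<^sub>R v"] False tv[of "t n"] t[of n] unfolding R'_def by linarith
        ultimately show ?thesis using K(2) False by (simp add: Q_def)
      qed
    qed
  qed simp_all
  then show ?thesis by (simp add: intQ LIMSEQ_const_iff)
qed

lemma lebesgue_on_integral_supported:
  fixes G :: "real^'n \<Rightarrow> real"
  assumes "continuous_on UNIV G" "\<And>x. x \<notin> \<Omega> \<Longrightarrow> G x = 0" "\<Omega> \<in> sets lebesgue"
  shows "(\<integral>x. G x \<partial>lebesgue_on \<Omega>) = (\<integral>x. G x \<partial>lborel)"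
proof -
  have "(\<integral>x. G x \<partial>lebesgue_on \<Omega>) = (\<integral>x. (if x \<in> \<Omega> then G x else 0) \<partial>lebesgue)"
    using assms(3) by (simp add: Lebesgue_Measure.integral_restrict_UNIV)
  also have "(\<lambda>x. if x \<in> \<Omega> then G x else 0) = G" using assms(2) by auto
  also have "(\<integral>x. G x \<partial>lebesgue) = (\<integral>x. G x \<partial>lborel)"
    using assms(1) by (intro integral_completion) (simp add: borel_measurable_continuous_onI)
  finally show ?thesis .
qed

lemma continuous_on_UNIV_extend_0:
  fixes F :: "'a::euclidean_space \<Rightarrow> 'b::real_normed_vector"
  assumes "open S" "closed K" "K \<subseteq> S" "continuous_on S F" "\<And>x. x \<notin> K \<Longrightarrow> F x = 0"
  shows "continuous_on UNIV F"
proof -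
  have "continuous_on (- K) F"
    by (rule continuous_on_eq[of _ "\<lambda>_. 0"]) (use assms in auto)
  then have "continuous_on (S \<union> - K) F"
    using assms by (intro continuous_on_open_Un) auto
  moreover have "S \<union> - K = UNIV" using assms(3) by auto
  ultimately show ?thesis by simp
qed

text \<open>A local version, since the weight in the Poincare inequality may be singular on the
  boundary of \<Omega>. The support in \<open>K\<close> lets both functions be extended by
  zero.\<close>

lemma lebesgue_on_integral_directional_derivative_eq_0:
  fixes F G :: "real^'n \<Rightarrow> real"
  assumes \<Omega>: "open \<Omega>" and K: "compact K" "K \<subseteq> \<Omega>"
    and der: "\<And>x. x \<in> \<Omega> \<Longrightarrow> (F has_derivative D x) (at x)" "\<And>x. x \<in> \<Omega> \<Longrightarrow> D x v = G x"
    and contG: "continuous_on \<Omega> G"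
    and zero: "\<And>x. x \<notin> K \<Longrightarrow> F x = 0" "\<And>x. x \<notin> K \<Longrightarrow> G x = 0"
  shows "(\<integral>x. G x \<partial>lebesgue_on \<Omega>) = 0"
proof -
  have clK: "closed K" using K(1) by (rule compact_imp_closed)
  have cG: "continuous_on UNIV G"
    by (rule continuous_on_UNIV_extend_0[OF \<Omega> clK K(2) contG zero(2)])
  define D' where "D' x = (if x \<in> \<Omega> then D x else (\<lambda>_. 0))" for x
  have "(\<integral>x. G x \<partial>lborel) = 0"
  proof (rule lborel_integral_directional_derivative_eq_0[OF _ _ cG K(1) zero])
    fix x
    show "(F has_derivative D' x) (at x)"
    proof (cases "x \<in> \<Omega>")
      case True
      then show ?thesis using der by (simp add: D'_def)
    next
      case False
      then have "x \<in> - K" using K by auto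
      moreover have "open (- K)" using clK by auto
      moreover have "0 = F z" if "z \<in> - K" for z using zero(1)[of z] that by simp
      ultimately have "(F has_derivative (\<lambda>_. 0)) (at x)"
        using has_derivative_transform_within_open[of "\<lambda>_. 0" "\<lambda>_. 0" x UNIV "- K" F] by simp
      then show ?thesis using False by (simp add: D'_def)
    qed
    show "D' x v = G x"
    proof (cases "x \<in> \<Omega>")
      case False
      then have "x \<notin> K" using K(2) by auto
      then show ?thesis using False zero(2) by (simp add: D'_def)
    qed (simp add: D'_def der(2))
  qed
  moreover have "(\<integral>x. G x \<partial>lebesgue_on \<Omega>) = (\<integral>x. G x \<partial>lborel)"
    by (rule lebesgue_on_integral_supported[OF cG]) (use zero(2) K(2) \<Omega> in auto)
  ultimately show ?thesis by simp
qed

lemma locally_integrable_mult_integrable: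
  fixes u :: "real^'n \<Rightarrow> real"
  assumes \<Omega>: "\<Omega> \<in> sets lebesgue" and u: "locally_integrable \<Omega> u"
    and K: "compact K" "K \<subseteq> \<Omega>" and \<psi>: "continuous_on UNIV \<psi>" "\<And>x. x \<notin> K \<Longrightarrow> \<psi> x = 0"
  shows "integrable (lebesgue_on \<Omega>) (\<lambda>x. u x * \<psi> x)"
    and "(\<integral>x. u x * \<psi> x \<partial>lebesgue_on \<Omega>) = (\<integral>x. u x * \<psi> x \<partial>lebesgue_on K)"
proof -
  have Km: "K \<in> sets lebesgue" using K(1) by (simp add: lmeasurable_compact fmeasurableD)
  have "u absolutely_integrable_on K" using u K by (auto simp: locally_integrable_def)
  moreover have "bounded (\<psi> ` K)"
    using K \<psi> by (intro compact_imp_bounded compact_continuous_image) (auto intro: continuous_on_subset)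
  ultimately have "(\<lambda>x. \<psi> x * u x) absolutely_integrable_on K"
    using absolutely_integrable_bounded_measurable_product[OF bilinear_times, of \<psi> K u] Km \<psi>
    by (auto intro: continuous_imp_measurable_on_sets_lebesgue continuous_on_subset)
  then have "integrable (lebesgue_on K) (\<lambda>x. u x * \<psi> x)"
    using Km by (simp add: absolutely_integrable_on_iff_integrable mult.commute)
  moreover have eq: "(\<lambda>x. if x \<in> \<Omega> then u x * \<psi> x else 0) = (\<lambda>x. if x \<in> K then u x * \<psi> x else 0)"
    using K(2) \<psi>(2) by force
  ultimately show "integrable (lebesgue_on \<Omega>) (\<lambda>x. u x * \<psi> x)"
    using Lebesgue_Measure.integrable_restrict_UNIV[OF Km, of "\<lambda>x. u x * \<psi> x"]
      Lebesgue_Measure.integrable_restrict_UNIV[OF \<Omega>, of "\<lambda>x. u x * \<psi> x"] by simp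
  show "(\<integral>x. u x * \<psi> x \<partial>lebesgue_on \<Omega>) = (\<integral>x. u x * \<psi> x \<partial>lebesgue_on K)"
    using Km \<Omega> eq Lebesgue_Measure.integral_restrict_UNIV[OF Km, of "\<lambda>x. u x * \<psi> x"]
      Lebesgue_Measure.integral_restrict_UNIV[OF \<Omega>, of "\<lambda>x. u x * \<psi> x"] by simp
qed

text \<open>Lebesgue's differentiation theorem recovers \<open>h\<close> from its averages over boxes.\<close>

lemma AE_eq_0_if_box_integrals_eq_0:
  fixes h :: "real^'n \<Rightarrow> real"
  assumes \<Omega>: "open \<Omega>" and h: "locally_integrable \<Omega> h"
    and int0: "\<And>a b. cbox a b \<subseteq> \<Omega> \<Longrightarrow> integral (cbox a b) h = 0"
  shows "AE x in lebesgue_on \<Omega>. h x = 0"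
proof -
  have neg: "negligible {x \<in> cbox a b. h x \<noteq> 0}" if ab: "cbox a b \<subseteq> \<Omega>" for a b
  proof -
    \<comment> \<open>Extension by zero makes \<open>f\<close> integrable on every box, as the
      differentiation theorem requires.\<close>
    define f where "f x = (if x \<in> cbox a b then h x else 0)" for x
    have "h absolutely_integrable_on cbox a b"
      using h ab by (auto simp: locally_integrable_def)
    then have hint: "h integrable_on cbox a b" by (simp add: absolutely_integrable_on_def)
    have "f integrable_on UNIV"
      unfolding f_def using hint by (simp add: Henstock_Kurzweil_Integration.integrable_restrict_UNIV)
    then have "f integrable_on cbox c d" for c d
      by (rule integrable_on_subcbox) simp
    then obtain N where N: "negligible N"
      "\<And>x e. \<lbrakk>x \<notin> N; 0 < e\<rbrakk> \<Longrightarrow> \<exists>d>0. \<forall>k. 0 < k \<and> k < d \<longrightarrow>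
          norm (integral (cbox x (x + k *\<^sub>R One)) f /\<^sub>R k ^ DIM(real^'n) - f x) < e"
      using integrable_ccontinuous_explicit[of f] by metis
    have "h x = 0" if x: "x \<in> box a b" "x \<notin> N" for x
    proof (rule ccontr)
      assume "h x \<noteq> 0"
      then have "0 < \<bar>f x\<bar>" using x(1) box_subset_cbox by (auto simp: f_def)
      from N(2)[OF x(2) this] obtain d where d: "d > 0" "\<And>k. 0 < k \<Longrightarrow> k < d \<Longrightarrow>
          norm (integral (cbox x (x + k *\<^sub>R One)) f /\<^sub>R k ^ DIM(real^'n) - f x) < \<bar>f x\<bar>" by blast
      obtain r where r: "r > 0" "ball x r \<subseteq> box a b"
        using open_box[of a b] x(1) by (auto simp: open_contains_ball)
      \<comment> \<open>Half of \<open>d\<close> for strictness, and short enough that the corner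
        opposite to \<open>x\<close> stays in the ball and hence in \<open>box a b\<close>.\<close>
      define k where "k = min (d / 2) (r / (2 * norm (One::real^'n)))"
      have nOne: "norm (One::real^'n) > 0" using One_non_0 by simp
      have k: "0 < k" "k < d" "k * norm (One::real^'n) < r"
      proof -
        show "0 < k" "k < d" using d r nOne by (auto simp: k_def)
        have "k * norm (One::real^'n) \<le> r / (2 * norm (One::real^'n)) * norm (One::real^'n)"
          using nOne by (intro mult_right_mono) (auto simp: k_def)
        also have "\<dots> < r" using nOne r by simp
        finally show "k * norm (One::real^'n) < r" .
      qed
      have sub: "cbox x (x + k *\<^sub>R One) \<subseteq> cbox a b"
      proof -
        have "x \<in> box a b" "x + k *\<^sub>R One \<in> box a b"
          using x(1) r k by (auto simp: subset_iff dist_norm)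
        then show ?thesis by (force simp: mem_box subset_box)
      qed
      have "integral (cbox x (x + k *\<^sub>R One)) f = integral (cbox x (x + k *\<^sub>R One)) h"
        using sub by (intro Henstock_Kurzweil_Integration.integral_cong) (auto simp: f_def)
      also have "\<dots> = 0" using int0 sub ab by blast
      finally show False using d(2)[OF k(1,2)] by simp
    qed
    then have "{x \<in> cbox a b. h x \<noteq> 0} \<subseteq> N \<union> (cbox a b - box a b)" by auto
    moreover have "negligible (N \<union> (cbox a b - box a b))"
      using N(1) negligible_frontier_interval[of a b] by simp
    ultimately show ?thesis using negligible_subset by blast
  qed
  obtain \<D> where D: "countable \<D>" "\<D> \<subseteq> Pow \<Omega>" "\<And>X. X \<in> \<D> \<Longrightarrow> \<exists>a b. X = cbox a b" "\<Union>\<D> = \<Omega>"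
    using open_countable_Union_open_cbox[OF \<Omega>] by metis
  have "negligible (\<Union>X\<in>\<D>. {x \<in> X. h x \<noteq> 0})"
  proof (intro negligible_countable_Union)
    fix Y assume "Y \<in> (\<lambda>X. {x \<in> X. h x \<noteq> 0}) ` \<D>"
    then obtain X where X: "X \<in> \<D>" "Y = {x \<in> X. h x \<noteq> 0}" by auto
    moreover obtain a b where "X = cbox a b" using D(3)[OF X(1)] by auto
    moreover have "X \<subseteq> \<Omega>" using D(2) X(1) by auto
    ultimately show "negligible Y" using neg by simp
  qed (use D(1) in auto)
  moreover have "(\<Union>X\<in>\<D>. {x \<in> X. h x \<noteq> 0}) = {x \<in> \<Omega>. h x \<noteq> 0}" using D(4) by auto
  ultimately have "{x \<in> \<Omega>. h x \<noteq> 0} \<in> null_sets lebesgue"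
    by (simp add: negligible_iff_null_sets)
  from AE_not_in[OF this] have "AE x in lebesgue. x \<in> \<Omega> \<longrightarrow> h x = 0"
    by eventually_elim auto
  then show ?thesis
    using \<Omega> by (subst AE_restrict_space_iff) auto
qed

text \<open>The bumps of a closed box inside \<Omega> are test functions and converge boundedly to
  the indicator of its interior. Dominated convergence with majorant |h| makes every box integral of
  \<open>h\<close> vanish.\<close>

lemma fundamental_lemma:
  fixes h :: "real^'n \<Rightarrow> real"
  assumes \<Omega>: "open \<Omega>" and h: "locally_integrable \<Omega> h"
    and test: "\<And>\<phi>. \<phi> \<in> test_functions \<Omega> \<Longrightarrow> (\<integral>x. h x * \<phi> x \<partial>lebesgue_on \<Omega>) = 0"
  shows "AE x in lebesgue_on \<Omega>. h x = 0"
proof (rule AE_eq_0_if_box_integrals_eq_0[OF \<Omega> h])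
  fix a b assume ab: "cbox a b \<subseteq> \<Omega>"
  have \<Omega>m: "\<Omega> \<in> sets lebesgue" using \<Omega> by (simp add: borel_open)
  have hint: "integrable (lebesgue_on (cbox a b)) h"
    using h ab by (simp add: locally_integrable_def flip: absolutely_integrable_on_iff_integrable)
  have bump: "bump a b m \<in> test_functions \<Omega>" for m
    using ab by (intro test_functionsI[of _ "cbox a b"])
      (auto intro: Ck_bump bump_outside dest: subsetD[OF box_subset_cbox])
  have cont: "continuous_on S (bump a b m)" for S m
    using Ck_continuous[OF Ck_bump[of 0]] .
  have bump0: "(\<integral>x. h x * bump a b m x \<partial>lebesgue_on (cbox a b)) = 0" for m
    using locally_integrable_mult_integrable(2)[OF \<Omega>m h compact_cbox ab cont, of m]
      test[OF bump, of m] bump_outside subsetD[OF box_subset_cbox] by (metis (no_types, lifting))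
  have "(\<lambda>m. \<integral>x. h x * bump a b m x \<partial>lebesgue_on (cbox a b))
      \<longlonglongrightarrow> (\<integral>x. h x * indicator (box a b) x \<partial>lebesgue_on (cbox a b))"
  proof (rule integral_dominated_convergence[where w = "\<lambda>x. \<bar>h x\<bar>"])
    show "AE x in lebesgue_on (cbox a b). (\<lambda>m. h x * bump a b m x) \<longlonglongrightarrow> h x * indicator (box a b) x"
    proof (rule AE_I2)
      fix x
      show "(\<lambda>m. h x * bump a b m x) \<longlonglongrightarrow> h x * indicator (box a b) x"
      proof (cases "x \<in> box a b")
        case True
        then show ?thesis using tendsto_mult_left[OF bump_tendsto[OF True], of "h x"] by simp
      qed (simp add: bump_outside)
    qed
    show "AE x in lebesgue_on (cbox a b). norm (h x * bump a b m x) \<le> \<bar>h x\<bar>" for m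
      using bump_bounds[of a b m] by (simp add: abs_mult mult_left_le)
    show "integrable (lebesgue_on (cbox a b)) (\<lambda>x. \<bar>h x\<bar>)" using hint by simp
    have [measurable]: "h \<in> borel_measurable (lebesgue_on (cbox a b))"
      using hint by auto
    have [measurable]: "bump a b m \<in> borel_measurable (lebesgue_on (cbox a b))" for m
      by (intro continuous_imp_measurable_on_sets_lebesgue cont) simp
    have [measurable]: "indicat_real (box a b) \<in> borel_measurable (lebesgue_on (cbox a b))"
      by (intro measurable_restrict_space1 borel_measurable_indicator) simp
    show "(\<lambda>x. h x * bump a b m x) \<in> borel_measurable (lebesgue_on (cbox a b))" for m by measurable
    show "(\<lambda>x. h x * indicator (box a b) x) \<in> borel_measurable (lebesgue_on (cbox a b))" by measurable
  qed
  then have "(\<integral>x. h x * indicator (box a b) x \<partial>lebesgue_on (cbox a b)) = 0"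
    by (simp add: bump0 LIMSEQ_const_iff)
  moreover have "(\<integral>x. h x * indicator (box a b) x \<partial>lebesgue_on (cbox a b)) = integral (box a b) h"
  proof -
    have "integrable (lebesgue_on (cbox a b)) (\<lambda>x. indicator (box a b) x *\<^sub>R h x)"
      by (intro integrable_mult_indicator hint) (simp add: sets_restrict_space_iff box_subset_cbox)
    then have "(\<integral>x. h x * indicator (box a b) x \<partial>lebesgue_on (cbox a b)) =
        integral (cbox a b) (\<lambda>x. h x * indicator (box a b) x)"
      by (intro lebesgue_integral_eq_integral) (simp_all add: mult.commute)
    also have "\<dots> = integral (cbox a b) (\<lambda>x. if x \<in> box a b then h x else 0)"
      by (intro Henstock_Kurzweil_Integration.integral_cong) (auto simp: indicator_def)
    also have "\<dots> = integral (box a b) h"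
      by (simp add: Henstock_Kurzweil_Integration.integral_restrict_Int box_subset_cbox Int_absorb2)
    finally show ?thesis .
  qed
  ultimately show "integral (cbox a b) h = 0"
    by (simp add: integral_open_interval)
qed

section \<open>Weak gradients and zero boundary values\<close>

lemma open_sets_lebesgue: "open S \<Longrightarrow> S \<in> sets lebesgue"
  by (simp add: borel_open)

lemma compact_sets_lebesgue: "compact S \<Longrightarrow> S \<in> sets lebesgue"
  by (simp add: lmeasurable_compact fmeasurableD)

lemma AE_vec_eq:
  fixes f g :: "'a \<Rightarrow> 'b^'m"
  assumes "\<And>i. AE x in M. f x $ i = g x $ i"
  shows "AE x in M. f x = g x"
proof -
  have "AE x in M. \<forall>i\<in>UNIV. f x $ i = g x $ i"
    using assms by (intro AE_finite_allI) auto
  then show ?thesis by (simp add: vec_eq_iff)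
qed

lemma locally_integrable_component:
  assumes "locally_integrable \<Omega> (g :: real^'n \<Rightarrow> real^'m)"
  shows "locally_integrable \<Omega> (\<lambda>x. g x $ i)"
  using assms unfolding locally_integrable_def
  by (auto simp: absolutely_integrable_on_iff_component compact_sets_lebesgue)

lemma locally_integrable_lincomb:
  assumes "locally_integrable \<Omega> f" "locally_integrable \<Omega> g"
  shows "locally_integrable \<Omega> (\<lambda>x. r *\<^sub>R f x + s *\<^sub>R g x)"
  using assms unfolding locally_integrable_def
  by (auto simp: absolutely_integrable_on_iff_integrable compact_sets_lebesgue)

text \<open>On a compact set, which has finite measure, the bound |f| \<le> 1 + |f|^2
  suffices.\<close>

lemma L2_locally_integrable:
  assumes \<Omega>: "\<Omega> \<in> sets lebesgue" and f: "f \<in> L2 \<Omega>"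
  shows "locally_integrable \<Omega> f"
  unfolding locally_integrable_def
proof (intro allI impI, elim conjE)
  fix K assume K: "compact K" "K \<subseteq> \<Omega>"
  have Km: "K \<in> sets lebesgue" using K(1) by (rule compact_sets_lebesgue)
  have sq: "integrable (lebesgue_on K) (\<lambda>x. (norm (f x))\<^sup>2)"
    using L2_integrable[OF f] set_integrable_subset[of lebesgue \<Omega> "\<lambda>x. (norm (f x))\<^sup>2" K] \<Omega> Km K(2)
    by (simp add: absolutely_integrable_on_iff_integrable)
  have "finite_measure (lebesgue_on K)"
    using K(1) by (simp add: finite_measure_lebesgue_on lmeasurable_compact)
  then have one: "integrable (lebesgue_on K) (\<lambda>x. 1 + (norm (f x))\<^sup>2)"
    using sq by (simp add: finite_measure.integrable_const)
  have "norm (f x) \<le> norm (1 + (norm (f x))\<^sup>2)" for x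
    using sum_squares_bound[of 1 "norm (f x)"] norm_ge_zero[of "f x"]
    by (simp add: power2_eq_square del: norm_ge_zero)
  then have "AE x in lebesgue_on K. norm (f x) \<le> norm (1 + (norm (f x))\<^sup>2)" by simp
  from Bochner_Integration.integrable_bound[OF one _ this]
  have "integrable (lebesgue_on K) f"
    using measurable_restrict_mono[OF L2_measurable[OF f] K(2)] by simp
  then show "f absolutely_integrable_on K"
    using Km by (simp add: absolutely_integrable_on_iff_integrable)
qed

lemma L2_continuous_compact_support:
  fixes f :: "real^'n \<Rightarrow> 'b::euclidean_space"
  assumes \<Omega>: "\<Omega> \<in> sets lebesgue" and f: "continuous_on UNIV f" and K: "compact K" "\<And>x. x \<notin> K \<Longrightarrow> f x = 0"
  shows "f \<in> L2 \<Omega>"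
proof -
  have "integrable lborel (\<lambda>x. indicator K x *\<^sub>R (norm (f x))\<^sup>2)"
    by (intro borel_integrable_compact K continuous_intros continuous_on_subset[OF f]) simp
  moreover have "(\<lambda>x. indicator K x *\<^sub>R (norm (f x))\<^sup>2) = (\<lambda>x. (norm (f x))\<^sup>2)"
    using K(2) by (fastforce simp: indicator_def)
  ultimately have int: "integrable lborel (\<lambda>x. (norm (f x))\<^sup>2)" by simp
  then have "integrable lebesgue (\<lambda>x. (norm (f x))\<^sup>2)"
    by (subst integrable_completion) auto
  then have "integrable (lebesgue_on \<Omega>) (\<lambda>x. (norm (f x))\<^sup>2)"
    using \<Omega> integrable_mult_indicator[of \<Omega> lebesgue "\<lambda>x. (norm (f x))\<^sup>2"]
    by (simp add: integrable_restrict_space)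
  then show ?thesis
    using continuous_imp_measurable_on_sets_lebesgue[OF continuous_on_subset[OF f] \<Omega>]
    by (simp add: L2_def)
qed

lemma has_weak_gradientD:
  assumes "has_weak_gradient \<Omega> u g"
  shows "locally_integrable \<Omega> u" "locally_integrable \<Omega> g"
    and "\<phi> \<in> test_functions \<Omega> \<Longrightarrow> (\<integral>x. u x * grad \<phi> x $ i \<partial>lebesgue_on \<Omega>)
        = - (\<integral>x. g x $ i * \<phi> x \<partial>lebesgue_on \<Omega>)"
  using assms by (simp_all add: has_weak_gradient_def grad_def)

text \<open>The components of the difference integrate to zero against every test function, so the
  fundamental lemma applies. This makes the choice in \<open>weak_gradient\<close> harmless and
  linear almost everywhere.\<close>

lemma has_weak_gradient_unique:
  assumes \<Omega>: "open \<Omega>" and g: "has_weak_gradient \<Omega> u g" "has_weak_gradient \<Omega> u g'"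
  shows "AE x in lebesgue_on \<Omega>. g x = g' x"
proof (rule AE_vec_eq)
  fix i
  have loc: "locally_integrable \<Omega> (\<lambda>x. g x $ i)" "locally_integrable \<Omega> (\<lambda>x. g' x $ i)"
    using has_weak_gradientD(2)[OF g(1)] has_weak_gradientD(2)[OF g(2)]
    by (simp_all add: locally_integrable_component)
  have "locally_integrable \<Omega> (\<lambda>x. g x $ i - g' x $ i)"
    using locally_integrable_lincomb[OF loc, of 1 "-1"] by simp
  moreover have "(\<integral>x. (g x $ i - g' x $ i) * \<phi> x \<partial>lebesgue_on \<Omega>) = 0"
    if \<phi>: "\<phi> \<in> test_functions \<Omega>" for \<phi>
  proof -
    obtain K where K: "compact K" "K \<subseteq> \<Omega>" "\<And>x. x \<notin> K \<Longrightarrow> \<phi> x = 0"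
      using test_functionsE[OF \<phi>] by metis
    note int = locally_integrable_mult_integrable(1)
      [OF open_sets_lebesgue[OF \<Omega>] _ K(1,2) test_function_continuous(1)[OF \<phi>] K(3)]
    have "(\<integral>x. g x $ i * \<phi> x \<partial>lebesgue_on \<Omega>) = (\<integral>x. g' x $ i * \<phi> x \<partial>lebesgue_on \<Omega>)"
      using has_weak_gradientD(3)[OF g(1) \<phi>, of i] has_weak_gradientD(3)[OF g(2) \<phi>, of i] by simp
    then show ?thesis
      using int[OF loc(1)] int[OF loc(2)] by (simp add: left_diff_distrib)
  qed
  ultimately have "AE x in lebesgue_on \<Omega>. g x $ i - g' x $ i = 0"
    by (rule fundamental_lemma[OF \<Omega>])
  then show "AE x in lebesgue_on \<Omega>. g x $ i = g' x $ i" by simp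
qed

lemma has_weak_gradient_lincomb:
  assumes \<Omega>: "open \<Omega>" and g: "has_weak_gradient \<Omega> u g" "has_weak_gradient \<Omega> v g'"
  shows "has_weak_gradient \<Omega> (\<lambda>x. r * u x + s * v x) (\<lambda>x. r *\<^sub>R g x + s *\<^sub>R g' x)"
  unfolding has_weak_gradient_def
proof (intro conjI ballI allI)
  have loc: "locally_integrable \<Omega> u" "locally_integrable \<Omega> v"
    "locally_integrable \<Omega> g" "locally_integrable \<Omega> g'"
    using g by (auto simp: has_weak_gradient_def)
  show "locally_integrable \<Omega> (\<lambda>x. r * u x + s * v x)"
    using locally_integrable_lincomb[OF loc(1,2), of r s] by simp
  show "locally_integrable \<Omega> (\<lambda>x. r *\<^sub>R g x + s *\<^sub>R g' x)"
    using locally_integrable_lincomb[OF loc(3,4)] .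
  fix \<phi> i assume \<phi>: "\<phi> \<in> test_functions \<Omega>"
  obtain K where K: "compact K" "K \<subseteq> \<Omega>" "\<And>x. x \<notin> K \<Longrightarrow> \<phi> x = 0" "\<And>x. x \<notin> K \<Longrightarrow> grad \<phi> x = 0"
    using test_functionsE[OF \<phi>] by metis
  note int0 = locally_integrable_mult_integrable(1)
    [OF open_sets_lebesgue[OF \<Omega>] _ K(1,2) test_function_continuous(1)[OF \<phi>] K(3)]
  have "\<And>x. x \<notin> K \<Longrightarrow> grad \<phi> x $ i = 0" using K(4) by simp
  note int1 = locally_integrable_mult_integrable(1)
    [OF open_sets_lebesgue[OF \<Omega>] _ K(1,2) test_function_continuous(3)[OF \<phi>] this]
  have fd: "frechet_derivative \<phi> (at x) (axis i 1) = grad \<phi> x $ i" for x by (simp add: grad_def)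
  show "(\<integral>x. (r * u x + s * v x) * frechet_derivative \<phi> (at x) (axis i 1) \<partial>lebesgue_on \<Omega>)
      = - (\<integral>x. (r *\<^sub>R g x + s *\<^sub>R g' x) $ i * \<phi> x \<partial>lebesgue_on \<Omega>)"
    using has_weak_gradientD(3)[OF g(1) \<phi>, of i] has_weak_gradientD(3)[OF g(2) \<phi>, of i]
      int1[OF loc(1)] int1[OF loc(2)]
      int0[OF locally_integrable_component[OF loc(3)]] int0[OF locally_integrable_component[OF loc(4)]]
    unfolding fd by (simp add: distrib_right mult.assoc)
qed

lemma weak_gradient_AE_eq:
  assumes "open \<Omega>" "has_weak_gradient \<Omega> u g"
  shows "AE x in lebesgue_on \<Omega>. weak_gradient \<Omega> u x = g x"
  using has_weak_gradient_unique[OF assms(1) _ assms(2), of "weak_gradient \<Omega> u"] assms(2)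
  unfolding weak_gradient_def by (metis someI)

lemma H1D:
  assumes \<Omega>: "open \<Omega>" and u: "u \<in> H1 \<Omega>"
  shows "u \<in> L2 \<Omega>" "has_weak_gradient \<Omega> u (weak_gradient \<Omega> u)" "weak_gradient \<Omega> u \<in> L2 \<Omega>"
proof -
  obtain g where g: "g \<in> L2 \<Omega>" "has_weak_gradient \<Omega> u g" using u by (auto simp: H1_def)
  show "u \<in> L2 \<Omega>" using u by (auto simp: H1_def)
  show "has_weak_gradient \<Omega> u (weak_gradient \<Omega> u)"
    unfolding weak_gradient_def by (rule someI[of "has_weak_gradient \<Omega> u"]) (rule g(2))
  show "weak_gradient \<Omega> u \<in> L2 \<Omega>"
    using L2_cong_AE[OF open_sets_lebesgue[OF \<Omega>] g(1)] weak_gradient_AE_eq[OF \<Omega> g(2)]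
    by (simp add: eq_commute)
qed

lemma H1_lincomb:
  assumes \<Omega>: "open \<Omega>" and u: "u \<in> H1 \<Omega>" and v: "v \<in> H1 \<Omega>"
  shows "(\<lambda>x. r * u x + s * v x) \<in> H1 \<Omega>"
    and "AE x in lebesgue_on \<Omega>. weak_gradient \<Omega> (\<lambda>x. r * u x + s * v x) x
          = r *\<^sub>R weak_gradient \<Omega> u x + s *\<^sub>R weak_gradient \<Omega> v x"
proof -
  note w = has_weak_gradient_lincomb[OF \<Omega> H1D(2)[OF \<Omega> u] H1D(2)[OF \<Omega> v], of r s]
  have "(\<lambda>x. r *\<^sub>R u x + s *\<^sub>R v x) \<in> L2 \<Omega>"
    using H1D(1)[OF \<Omega>] u v by (intro L2_add L2_scaleR)
  moreover have "(\<lambda>x. r *\<^sub>R weak_gradient \<Omega> u x + s *\<^sub>R weak_gradient \<Omega> v x) \<in> L2 \<Omega>"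
    using H1D(3)[OF \<Omega>] u v by (intro L2_add L2_scaleR)
  ultimately show "(\<lambda>x. r * u x + s * v x) \<in> H1 \<Omega>" using w by (auto simp: H1_def)
  show "AE x in lebesgue_on \<Omega>. weak_gradient \<Omega> (\<lambda>x. r * u x + s * v x) x
          = r *\<^sub>R weak_gradient \<Omega> u x + s *\<^sub>R weak_gradient \<Omega> v x"
    using weak_gradient_AE_eq[OF \<Omega> w] .
qed

section \<open>Test functions as Sobolev functions and their closure\<close>

lemma test_function_integral_grad:
  assumes \<Omega>: "open \<Omega>" and \<phi>: "\<phi> \<in> test_functions \<Omega>"
  shows "(\<integral>x. grad \<phi> x $ i \<partial>lebesgue_on \<Omega>) = 0"
proof -
  obtain K where K: "compact K" "K \<subseteq> \<Omega>" "\<And>x. x \<notin> K \<Longrightarrow> \<phi> x = 0" "\<And>x. x \<notin> K \<Longrightarrow> grad \<phi> x = 0"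
    using test_functionsE[OF \<phi>] by metis
  show ?thesis
    by (rule lebesgue_on_integral_directional_derivative_eq_0
        [OF \<Omega> K(1,2) test_function_derivative[OF \<phi>], where v = "axis i 1"])
      (use K \<phi> in \<open>auto simp: inner_axis intro: test_function_continuous\<close>)
qed

lemma test_function_H1:
  assumes \<Omega>: "open \<Omega>" and \<phi>: "\<phi> \<in> test_functions \<Omega>"
  shows "\<phi> \<in> L2 \<Omega>" "grad \<phi> \<in> L2 \<Omega>" "has_weak_gradient \<Omega> \<phi> (grad \<phi>)" "\<phi> \<in> H1 \<Omega>"
proof -
  note \<Omega>m = open_sets_lebesgue[OF \<Omega>]
  obtain K where K: "compact K" "K \<subseteq> \<Omega>" "\<And>x. x \<notin> K \<Longrightarrow> \<phi> x = 0" "\<And>x. x \<notin> K \<Longrightarrow> grad \<phi> x = 0"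
    using test_functionsE[OF \<phi>] by metis
  show L2: "\<phi> \<in> L2 \<Omega>" "grad \<phi> \<in> L2 \<Omega>"
    using L2_continuous_compact_support[OF \<Omega>m _ K(1)] K(3,4) test_function_continuous[OF \<phi>] by blast+
  show w: "has_weak_gradient \<Omega> \<phi> (grad \<phi>)"
    unfolding has_weak_gradient_def
  proof (intro conjI ballI allI L2_locally_integrable[OF \<Omega>m] L2)
    fix \<psi> i assume \<psi>: "\<psi> \<in> test_functions \<Omega>"
    have int: "integrable (lebesgue_on \<Omega>) (\<lambda>x. \<phi> x * grad \<psi> x $ i)"
      "integrable (lebesgue_on \<Omega>) (\<lambda>x. grad \<phi> x $ i * \<psi> x)"
    proof -
      obtain L where L: "compact L" "\<And>x. x \<notin> L \<Longrightarrow> \<psi> x = 0" "\<And>x. x \<notin> L \<Longrightarrow> grad \<psi> x = 0"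
        using test_functionsE[OF \<psi>] by metis
      have "\<psi> \<in> L2 \<Omega>" "grad \<psi> \<in> L2 \<Omega>"
        using L2_continuous_compact_support[OF \<Omega>m _ L(1)] L(2,3) test_function_continuous[OF \<psi>]
        by blast+
      then show "integrable (lebesgue_on \<Omega>) (\<lambda>x. \<phi> x * grad \<psi> x $ i)"
        "integrable (lebesgue_on \<Omega>) (\<lambda>x. grad \<phi> x $ i * \<psi> x)"
        using L2_inner_integrable[OF L2(1) L2_component[of "grad \<psi>" \<Omega> i]]
          L2_inner_integrable[OF L2_component[OF L2(2), of i], of \<psi>] by simp_all
    qed
    \<comment> \<open>Integration by parts is the vanishing integral of the gradient of \<phi>
      \<psi>, which is again a test function.\<close>
    have "0 = (\<integral>x. \<phi> x * grad \<psi> x $ i + grad \<phi> x $ i * \<psi> x \<partial>lebesgue_on \<Omega>)"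
      using test_function_integral_grad[OF \<Omega> test_function_mult(1)[OF \<phi> \<psi>], of i]
      by (simp add: test_function_mult(2)[OF \<phi> \<psi>] mult.commute)
    then show "(\<integral>x. \<phi> x * frechet_derivative \<psi> (at x) (axis i 1) \<partial>lebesgue_on \<Omega>) =
        - (\<integral>x. grad \<phi> x $ i * \<psi> x \<partial>lebesgue_on \<Omega>)"
      using int by (simp add: grad_def)
  qed
  show "\<phi> \<in> H1 \<Omega>" using L2 w by (auto simp: H1_def)
qed

text \<open>\<open>H1_norm\<close> contains the chosen weak gradient of u - \<phi>. Almost
  everywhere this is the weak gradient of \<open>u\<close> minus the classical gradient of \<phi>,
  and two separate bounds are what density arguments use.\<close>

lemma H10_iff:
  assumes \<Omega>: "open \<Omega>"
  shows "u \<in> H10 \<Omega> \<longleftrightarrow> u \<in> H1 \<Omega> \<and> (\<forall>e>0. \<exists>\<phi>\<in>test_functions \<Omega>.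
      L2_norm \<Omega> (\<lambda>x. u x - \<phi> x) < e \<and> L2_norm \<Omega> (\<lambda>x. weak_gradient \<Omega> u x - grad \<phi> x) < e)"
    (is "_ \<longleftrightarrow> _ \<and> (\<forall>e>0. \<exists>\<phi>\<in>_. ?P e \<phi>)")
proof -
  have "(\<forall>e>0. \<exists>\<phi>\<in>test_functions \<Omega>. H1_norm \<Omega> (\<lambda>x. u x - \<phi> x) < e)
      \<longleftrightarrow> (\<forall>e>0. \<exists>\<phi>\<in>test_functions \<Omega>. ?P e \<phi>)" if u: "u \<in> H1 \<Omega>"
  proof -
    have norm_eq: "H1_norm \<Omega> (\<lambda>x. u x - \<phi> x) = sqrt ((L2_norm \<Omega> (\<lambda>x. u x - \<phi> x))\<^sup>2
        + (L2_norm \<Omega> (\<lambda>x. weak_gradient \<Omega> u x - grad \<phi> x))\<^sup>2)" if \<phi>: "\<phi> \<in> test_functions \<Omega>" for \<phi>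
    proof -
      have "AE x in lebesgue_on \<Omega>. weak_gradient \<Omega> u x - grad \<phi> x = weak_gradient \<Omega> (\<lambda>x. u x - \<phi> x) x"
        using H1_lincomb(2)[OF \<Omega> u test_function_H1(4)[OF \<Omega> \<phi>], of 1 "-1"]
          weak_gradient_AE_eq[OF \<Omega> test_function_H1(3)[OF \<Omega> \<phi>]]
        by eventually_elim simp
      then show ?thesis
        using L2_norm_cong_AE[OF open_sets_lebesgue[OF \<Omega>]
            L2_diff[OF H1D(3)[OF \<Omega> u] test_function_H1(2)[OF \<Omega> \<phi>]]]
        by (simp add: H1_norm_def)
    qed
    show ?thesis
    proof (intro iffI allI impI)
      fix e :: real assume e: "e > 0" and "\<forall>e>0. \<exists>\<phi>\<in>test_functions \<Omega>. H1_norm \<Omega> (\<lambda>x. u x - \<phi> x) < e"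
      then obtain \<phi> where \<phi>: "\<phi> \<in> test_functions \<Omega>" "H1_norm \<Omega> (\<lambda>x. u x - \<phi> x) < e" by blast
      then have "?P e \<phi>"
        using real_sqrt_sum_squares_ge1[of "L2_norm \<Omega> (\<lambda>x. u x - \<phi> x)"]
          real_sqrt_sum_squares_ge2[of "L2_norm \<Omega> (\<lambda>x. weak_gradient \<Omega> u x - grad \<phi> x)"]
        unfolding norm_eq[OF \<phi>(1)] by (meson le_less_trans)
      then show "\<exists>\<phi>\<in>test_functions \<Omega>. ?P e \<phi>" using \<phi>(1) by blast
    next
      fix e :: real assume e: "e > 0" and "\<forall>e>0. \<exists>\<phi>\<in>test_functions \<Omega>. ?P e \<phi>"
      then obtain \<phi> where \<phi>: "\<phi> \<in> test_functions \<Omega>" "?P (e / 2) \<phi>"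
        by (meson half_gt_zero)
      then have "H1_norm \<Omega> (\<lambda>x. u x - \<phi> x) < e"
        using sqrt_sum_squares_le_sum[OF L2_norm_nonneg[of \<Omega> "\<lambda>x. u x - \<phi> x"]
            L2_norm_nonneg[of \<Omega> "\<lambda>x. weak_gradient \<Omega> u x - grad \<phi> x"]]
        unfolding norm_eq[OF \<phi>(1)] by linarith
      then show "\<exists>\<phi>\<in>test_functions \<Omega>. H1_norm \<Omega> (\<lambda>x. u x - \<phi> x) < e" using \<phi>(1) by blast
    qed
  qed
  then show ?thesis by (auto simp: H10_def)
qed

lemma test_function_lincomb:
  assumes \<phi>: "\<phi> \<in> test_functions \<Omega>" and \<psi>: "\<psi> \<in> test_functions \<Omega>"
  shows "(\<lambda>x. r * \<phi> x + s * \<psi> x) \<in> test_functions \<Omega>"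
    and "grad (\<lambda>x. r * \<phi> x + s * \<psi> x) x = r *\<^sub>R grad \<phi> x + s *\<^sub>R grad \<psi> x"
proof -
  obtain K L where K: "compact K" "K \<subseteq> \<Omega>" "\<And>x. x \<notin> K \<Longrightarrow> \<phi> x = 0"
    and L: "compact L" "L \<subseteq> \<Omega>" "\<And>x. x \<notin> L \<Longrightarrow> \<psi> x = 0"
    using test_functionsE[OF \<phi>] test_functionsE[OF \<psi>] by metis
  show "(\<lambda>x. r * \<phi> x + s * \<psi> x) \<in> test_functions \<Omega>"
  proof (rule test_functionsI[of _ "K \<union> L"])
    show "Ck k (\<lambda>x. r * \<phi> x + s * \<psi> x)" for k
      using \<phi> \<psi> by (intro Ck_add Ck_mult Ck_const) (auto simp: test_functions_def)
  qed (use K L in auto)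
  show "grad (\<lambda>x. r * \<phi> x + s * \<psi> x) x = r *\<^sub>R grad \<phi> x + s *\<^sub>R grad \<psi> x"
  proof (rule grad_eqI)
    have "((\<lambda>x. r * \<phi> x + s * \<psi> x) has_derivative
        (\<lambda>h. r * (grad \<phi> x \<bullet> h) + s * (grad \<psi> x \<bullet> h))) (at x)"
      using \<phi> \<psi> by (intro has_derivative_add has_derivative_mult_right test_function_derivative)
    then show "((\<lambda>x. r * \<phi> x + s * \<psi> x) has_derivative
        (\<lambda>h. (r *\<^sub>R grad \<phi> x + s *\<^sub>R grad \<psi> x) \<bullet> h)) (at x)"
      by (simp add: inner_add_left)
  qed
qed

lemma L2_norm_lincomb_le:
  assumes "f \<in> L2 S" "g \<in> L2 S"
  shows "L2_norm S (\<lambda>x. r *\<^sub>R f x + s *\<^sub>R g x) \<le> \<bar>r\<bar> * L2_norm S f + \<bar>s\<bar> * L2_norm S g"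
  using L2_norm_triangle[OF L2_scaleR[OF assms(1), of r] L2_scaleR[OF assms(2), of s]]
  by (simp add: L2_norm_scaleR)

lemma H10_H1: "u \<in> H10 \<Omega> \<Longrightarrow> u \<in> H1 \<Omega>"
  by (simp add: H10_def)

lemma H10_lincomb:
  assumes \<Omega>: "open \<Omega>" and u: "u \<in> H10 \<Omega>" and v: "v \<in> H10 \<Omega>"
  shows "(\<lambda>x. r * u x + s * v x) \<in> H10 \<Omega>"
  unfolding H10_iff[OF \<Omega>]
proof (intro conjI allI impI)
  note u1 = H10_H1[OF u] and v1 = H10_H1[OF v]
  show "(\<lambda>x. r * u x + s * v x) \<in> H1 \<Omega>" using H1_lincomb(1)[OF \<Omega> u1 v1] .
  fix e :: real assume e: "e > 0"
  \<comment> \<open>The added 1 keeps the denominator positive and makes the resulting bound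
    strict.\<close>
  define d where "d = e / (\<bar>r\<bar> + \<bar>s\<bar> + 1)"
  have d: "d > 0" "(\<bar>r\<bar> + \<bar>s\<bar>) * d < e"
    using e by (auto simp: d_def field_simps)
  obtain \<phi> where \<phi>: "\<phi> \<in> test_functions \<Omega>" "L2_norm \<Omega> (\<lambda>x. u x - \<phi> x) < d"
      "L2_norm \<Omega> (\<lambda>x. weak_gradient \<Omega> u x - grad \<phi> x) < d"
    using u d(1) unfolding H10_iff[OF \<Omega>] by blast
  obtain \<psi> where \<psi>: "\<psi> \<in> test_functions \<Omega>" "L2_norm \<Omega> (\<lambda>x. v x - \<psi> x) < d"
      "L2_norm \<Omega> (\<lambda>x. weak_gradient \<Omega> v x - grad \<psi> x) < d"
    using v d(1) unfolding H10_iff[OF \<Omega>] by blast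
  note \<phi>1 = test_function_H1[OF \<Omega> \<phi>(1)] and \<psi>1 = test_function_H1[OF \<Omega> \<psi>(1)]
  have small: "\<bar>r\<bar> * A + \<bar>s\<bar> * B < e" if "A < d" "B < d" for A B
  proof -
    have "\<bar>r\<bar> * A + \<bar>s\<bar> * B \<le> \<bar>r\<bar> * d + \<bar>s\<bar> * d"
      using that by (intro add_mono mult_left_mono) auto
    then show ?thesis using d(2) by (simp add: distrib_right)
  qed
  let ?w = "\<lambda>x. r * u x + s * v x" and ?\<chi> = "\<lambda>x. r * \<phi> x + s * \<psi> x"
  have "L2_norm \<Omega> (\<lambda>x. ?w x - ?\<chi> x) = L2_norm \<Omega> (\<lambda>x. r *\<^sub>R (u x - \<phi> x) + s *\<^sub>R (v x - \<psi> x))"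
    by (simp add: algebra_simps)
  also have "\<dots> < e"
    by (rule le_less_trans[OF L2_norm_lincomb_le small])
      (use \<phi> \<psi> \<phi>1 \<psi>1 H1D[OF \<Omega> u1] H1D[OF \<Omega> v1] in \<open>auto intro: L2_diff\<close>)
  finally have 1: "L2_norm \<Omega> (\<lambda>x. ?w x - ?\<chi> x) < e" .
  let ?G = "\<lambda>x. r *\<^sub>R (weak_gradient \<Omega> u x - grad \<phi> x) + s *\<^sub>R (weak_gradient \<Omega> v x - grad \<psi> x)"
  have "L2_norm \<Omega> ?G < e"
    by (rule le_less_trans[OF L2_norm_lincomb_le small])
      (use \<phi> \<psi> \<phi>1 \<psi>1 H1D[OF \<Omega> u1] H1D[OF \<Omega> v1] in \<open>auto intro: L2_diff\<close>)
  moreover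
  have G: "?G \<in> L2 \<Omega>"
    using \<phi>1 \<psi>1 H1D[OF \<Omega> u1] H1D[OF \<Omega> v1] by (intro L2_add L2_scaleR L2_diff)
  have "AE x in lebesgue_on \<Omega>. ?G x = weak_gradient \<Omega> ?w x - grad ?\<chi> x"
    using H1_lincomb(2)[OF \<Omega> u1 v1, of r s]
    by eventually_elim (simp add: test_function_lincomb[OF \<phi>(1) \<psi>(1)] algebra_simps)
  from L2_norm_cong_AE[OF open_sets_lebesgue[OF \<Omega>] G this]
  have "L2_norm \<Omega> ?G = L2_norm \<Omega> (\<lambda>x. weak_gradient \<Omega> ?w x - grad ?\<chi> x)" .
  ultimately have 2: "L2_norm \<Omega> (\<lambda>x. weak_gradient \<Omega> ?w x - grad ?\<chi> x) < e" by simp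
  show "\<exists>\<phi>\<in>test_functions \<Omega>. L2_norm \<Omega> (\<lambda>x. ?w x - \<phi> x) < e \<and>
      L2_norm \<Omega> (\<lambda>x. weak_gradient \<Omega> ?w x - grad \<phi> x) < e"
    using 1 2 test_function_lincomb(1)[OF \<phi>(1) \<psi>(1)]
    by (intro bexI[of _ ?\<chi>] conjI)
qed

section \<open>The Poincare inequality and the convection term\<close>

lemma L2_inner_real: "L2_inner S f g = (\<integral>x. f x * g x \<partial>lebesgue_on S)" for f g :: "real^'n \<Rightarrow> real"
  by (simp add: L2_inner_def)

lemma integrable_continuous_compact_support:
  fixes G :: "real^'n \<Rightarrow> real"
  assumes "\<Omega> \<in> sets lebesgue" "compact K" "K \<subseteq> \<Omega>" "continuous_on UNIV G" "\<And>x. x \<notin> K \<Longrightarrow> G x = 0"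
  shows "integrable (lebesgue_on \<Omega>) G"
proof -
  have "locally_integrable \<Omega> (\<lambda>_::real^'n. 1::real)"
    unfolding locally_integrable_def
    by (auto simp: absolutely_integrable_on_iff_integrable compact_sets_lebesgue
        intro!: finite_measure.integrable_const finite_measure_lebesgue_on lmeasurable_compact)
  from locally_integrable_mult_integrable(1)[OF assms(1) this assms(2-5)] show ?thesis by simp
qed

text \<open>With \<open>w = pi / L\<close> and \<open>s\<close> the coordinate in direction \<open>e\<close>, the function
  \<open>w cot (w s)\<close> solves \<open>k' + k\<^sup>2 = - w\<^sup>2\<close>, so that
  \<open>0 \<le> (\<partial>\<phi> - k \<phi>)\<^sup>2 = (\<partial>\<phi>)\<^sup>2 - w\<^sup>2 \<phi>\<^sup>2 - \<partial>(k \<phi>\<^sup>2)\<close>.\<close>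

lemma Poincare_direction:
  assumes \<Omega>: "open \<Omega>" and \<phi>: "\<phi> \<in> test_functions \<Omega>" and L: "0 < L" and e: "norm e = 1"
    and strip: "\<And>x. x \<in> \<Omega> \<Longrightarrow> 0 < (x - x0) \<bullet> e \<and> (x - x0) \<bullet> e < L"
  shows "(pi / L)\<^sup>2 * (L2_norm \<Omega> \<phi>)\<^sup>2 \<le> (\<integral>x. (grad \<phi> x \<bullet> e)\<^sup>2 \<partial>lebesgue_on \<Omega>)"
proof -
  obtain K where K: "compact K" "K \<subseteq> \<Omega>" "\<And>x. x \<notin> K \<Longrightarrow> \<phi> x = 0" "\<And>x. x \<notin> K \<Longrightarrow> grad \<phi> x = 0"
    using test_functionsE[OF \<phi>] by metis
  define w where "w = pi / L"
  define s where "s x = (x - x0) \<bullet> e" for x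
  have sin_pos: "sin (w * s x) > 0" if "x \<in> \<Omega>" for x
    using strip[OF that] L by (intro sin_gt_zero) (auto simp: w_def s_def field_simps)
  \<comment> \<open>\<open>F\<close> is k \<phi>^2 for the weight k = w cot (w s), \<open>D\<close>
    its derivative and \<open>G\<close> its derivative along \<open>e\<close>. The singularities of
    k lie outside \<Omega>, where \<phi> vanishes.\<close>
  define F where "F x = w * cot (w * s x) * (\<phi> x)\<^sup>2" for x
  define G where "G x = - (w\<^sup>2 / (sin (w * s x))\<^sup>2) * (\<phi> x)\<^sup>2
      + 2 * w * cot (w * s x) * \<phi> x * (grad \<phi> x \<bullet> e)" for x
  define D where "D x h = w * cot (w * s x) * (2 * \<phi> x * (grad \<phi> x \<bullet> h))
      + (- (w\<^sup>2 / (sin (w * s x))\<^sup>2) * (h \<bullet> e)) * (\<phi> x)\<^sup>2" for x h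
  have contG: "continuous_on \<Omega> G"
    unfolding G_def s_def cot_def
    by (intro continuous_intros test_function_continuous[OF \<phi>])
      (use sin_pos in \<open>auto simp: s_def less_imp_neq[symmetric]\<close>)
  have zero: "F x = 0" "G x = 0" if "x \<notin> K" for x
    using K(3)[OF that] by (auto simp: F_def G_def)
  have intG: "(\<integral>x. G x \<partial>lebesgue_on \<Omega>) = 0"
  proof (rule lebesgue_on_integral_directional_derivative_eq_0[OF \<Omega> K(1,2) _ _ contG zero])
    fix x assume x: "x \<in> \<Omega>"
    have "((\<lambda>t. w * cot (w * t)) has_field_derivative - (w\<^sup>2 / (sin (w * s x))\<^sup>2)) (at (s x))"
      using sin_pos[OF x]
      by (auto intro!: derivative_eq_intros DERIV_chain2[OF DERIV_cot]
          simp: power2_eq_square field_simps)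
    then have "((\<lambda>t. w * cot (w * t)) has_derivative (\<lambda>h. - (w\<^sup>2 / (sin (w * s x))\<^sup>2) * h)) (at (s x))"
      by (simp only: has_field_derivative_def)
    moreover have "(s has_derivative (\<lambda>h. h \<bullet> e)) (at x)"
      unfolding s_def by (auto intro!: derivative_eq_intros)
    ultimately have "((\<lambda>x. w * cot (w * s x)) has_derivative
        (\<lambda>h. - (w\<^sup>2 / (sin (w * s x))\<^sup>2) * (h \<bullet> e))) (at x)"
      by (rule has_derivative_compose[rotated])
    moreover have "((\<lambda>x. (\<phi> x)\<^sup>2) has_derivative (\<lambda>h. 2 * \<phi> x * (grad \<phi> x \<bullet> h))) (at x)"
      by (auto intro!: derivative_eq_intros test_function_derivative[OF \<phi>])
    ultimately show "(F has_derivative D x) (at x)"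
      unfolding F_def D_def by (rule has_derivative_mult)
    show "D x e = G x" using e by (simp add: D_def G_def dot_square_norm)
  qed
  have clK: "closed K" using K(1) by (rule compact_imp_closed)
  have G_int: "integrable (lebesgue_on \<Omega>) G"
    using integrable_continuous_compact_support[OF open_sets_lebesgue[OF \<Omega>] K(1,2)
        continuous_on_UNIV_extend_0[OF \<Omega> clK K(2) contG zero(2)] zero(2)] .
  have \<phi>_int: "integrable (lebesgue_on \<Omega>) (\<lambda>x. (\<phi> x)\<^sup>2)"
    using L2_integrable[OF test_function_H1(1)[OF \<Omega> \<phi>]] by simp
  have d_int: "integrable (lebesgue_on \<Omega>) (\<lambda>x. (grad \<phi> x \<bullet> e)\<^sup>2)"
  proof (rule integrable_continuous_compact_support[OF open_sets_lebesgue[OF \<Omega>] K(1,2)])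
    show "continuous_on UNIV (\<lambda>x. (grad \<phi> x \<bullet> e)\<^sup>2)"
      by (intro continuous_intros test_function_continuous[OF \<phi>])
  qed (simp add: K(4))
  have "w\<^sup>2 * (L2_norm \<Omega> \<phi>)\<^sup>2 = (\<integral>x. w\<^sup>2 * (\<phi> x)\<^sup>2 \<partial>lebesgue_on \<Omega>)"
    by (simp add: L2_norm_def)
  also have "\<dots> = (\<integral>x. G x + w\<^sup>2 * (\<phi> x)\<^sup>2 \<partial>lebesgue_on \<Omega>)"
    using G_int \<phi>_int intG by simp
  also have "\<dots> \<le> (\<integral>x. (grad \<phi> x \<bullet> e)\<^sup>2 \<partial>lebesgue_on \<Omega>)"
  proof (rule integral_mono)
    fix x assume "x \<in> space (lebesgue_on \<Omega>)"
    then have S: "sin (w * s x) > 0" using sin_pos by simp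
    define a where "a = grad \<phi> x \<bullet> e"
    have "0 \<le> (a - w * cot (w * s x) * \<phi> x)\<^sup>2" by simp
    also have "\<dots> = a\<^sup>2 - (2 * w * cot (w * s x) * \<phi> x * a) + w\<^sup>2 * (cot (w * s x))\<^sup>2 * (\<phi> x)\<^sup>2"
      by (simp add: power2_eq_square algebra_simps)
    \<comment> \<open>The equation for k enters here: cot^2 is rewritten through the 1 / sin^2 that
      occurs in \<open>G\<close>.\<close>
    also have "(cot (w * s x))\<^sup>2 = 1 / (sin (w * s x))\<^sup>2 - 1"
      using S by (simp add: cot_def power_divide cos_squared_eq diff_divide_distrib)
    also have "a\<^sup>2 - (2 * w * cot (w * s x) * \<phi> x * a)
        + w\<^sup>2 * (1 / (sin (w * s x))\<^sup>2 - 1) * (\<phi> x)\<^sup>2 = a\<^sup>2 - (G x + w\<^sup>2 * (\<phi> x)\<^sup>2)"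
      by (simp add: G_def a_def algebra_simps)
    finally show "G x + w\<^sup>2 * (\<phi> x)\<^sup>2 \<le> (grad \<phi> x \<bullet> e)\<^sup>2" by (simp add: a_def)
  qed (use G_int \<phi>_int d_int in auto)
  finally show ?thesis by (simp add: w_def)
qed

lemma Bessel_inequality:
  fixes e :: "'i \<Rightarrow> 'a::real_inner"
  assumes "finite I" "\<And>i j. i \<in> I \<Longrightarrow> j \<in> I \<Longrightarrow> e i \<bullet> e j = (if i = j then 1 else 0)"
  shows "(\<Sum>i\<in>I. (v \<bullet> e i)\<^sup>2) \<le> (norm v)\<^sup>2"
proof -
  let ?P = "\<Sum>i\<in>I. (v \<bullet> e i) *\<^sub>R e i"
  have "?P \<bullet> ?P = (\<Sum>i\<in>I. \<Sum>j\<in>I. (v \<bullet> e i) * (v \<bullet> e j) * (e j \<bullet> e i))"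
    by (simp add: inner_sum_left inner_sum_right sum_distrib_left mult.assoc)
  also have "\<dots> = (\<Sum>i\<in>I. \<Sum>j\<in>I. if i = j then (v \<bullet> e i)\<^sup>2 else 0)"
    by (intro sum.cong) (auto simp: assms(2) power2_eq_square)
  also have "\<dots> = (\<Sum>i\<in>I. (v \<bullet> e i)\<^sup>2)" using assms(1) by simp
  finally have PP: "?P \<bullet> ?P = (\<Sum>i\<in>I. (v \<bullet> e i)\<^sup>2)" .
  have vP: "v \<bullet> ?P = (\<Sum>i\<in>I. (v \<bullet> e i)\<^sup>2)"
    by (simp add: inner_sum_right power2_eq_square)
  have "0 \<le> (v - ?P) \<bullet> (v - ?P)" by simp
  also have "\<dots> = v \<bullet> v - 2 * (v \<bullet> ?P) + ?P \<bullet> ?P"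
    by (simp add: inner_diff_left inner_diff_right inner_commute)
  finally show ?thesis by (simp add: PP vP power2_norm_eq_inner)
qed

text \<open>The sum of the (pi / norm (l i))^2 is the smallest Dirichlet eigenvalue of the box, and
  the constant is its inverse square root. In this form the bounds for the single directions can
  simply be added.\<close>

lemma poincare_const_pos_power2:
  fixes l :: "'n::finite \<Rightarrow> real^'n"
  assumes "\<And>i. l i \<noteq> 0"
  shows "0 < poincare_const l" "(poincare_const l)\<^sup>2 * (\<Sum>i\<in>UNIV. (pi / norm (l i))\<^sup>2) = 1"
proof -
  let ?S = "\<Sum>i\<in>UNIV. 1 / (norm (l i))\<^sup>2"
  have S: "?S > 0" using assms by (intro sum_pos) auto
  then show "0 < poincare_const l" by (simp add: poincare_const_def)
  have "(?S powr (-1/2))\<^sup>2 * ?S = ?S powr (-1/2 + -1/2) * ?S powr 1"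
    using S by (simp only: powr_add power2_eq_square powr_one_gt_zero_iff[THEN iffD2])
  also have "\<dots> = 1" using S by (simp flip: powr_add)
  finally have "(?S powr (-1/2))\<^sup>2 * ?S = 1" .
  moreover have "(\<Sum>i\<in>UNIV. (pi / norm (l i))\<^sup>2) = pi\<^sup>2 * ?S"
    by (simp add: sum_distrib_left power_divide)
  ultimately show "(poincare_const l)\<^sup>2 * (\<Sum>i\<in>UNIV. (pi / norm (l i))\<^sup>2) = 1"
    by (simp add: poincare_const_def power_mult_distrib power_divide)
qed

text \<open>A point of an open set can be moved a little both ways along \<open>l i\<close> without
  leaving the box, so it lies on no face. Strictness keeps the cotangent weight finite on
  \<Omega>.\<close>

lemma open_subset_box_strip:
  assumes box: "is_box x0 l B" and \<Omega>: "open \<Omega>" "\<Omega> \<subseteq> B" and x: "x \<in> \<Omega>"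
  shows "0 < (x - x0) \<bullet> l i" "(x - x0) \<bullet> l i < (norm (l i))\<^sup>2"
proof -
  have orth: "i \<noteq> j \<Longrightarrow> l i \<bullet> l j = 0" and li: "l i \<noteq> 0" for j
    using box by (auto simp: is_box_def)
  have box_le: "0 \<le> (z - x0) \<bullet> l i \<and> (z - x0) \<bullet> l i \<le> (norm (l i))\<^sup>2" if "z \<in> \<Omega>" for z
  proof -
    have "z \<in> {x0 + (\<Sum>i\<in>UNIV. t i *\<^sub>R l i) | t. \<forall>i. 0 \<le> t i \<and> t i \<le> 1}"
      using box \<Omega>(2) that unfolding is_box_def by blast
    then obtain t where t: "z = x0 + (\<Sum>i\<in>UNIV. t i *\<^sub>R l i)" "\<And>i. 0 \<le> t i \<and> t i \<le> 1"
      by blast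
    have "(z - x0) \<bullet> l i = (\<Sum>j\<in>UNIV. t j * (l j \<bullet> l i))"
      by (simp add: t(1) inner_sum_left)
    also have "\<dots> = (\<Sum>j\<in>UNIV. if j = i then t i * (norm (l i))\<^sup>2 else 0)"
      using orth by (intro sum.cong) (auto simp: power2_norm_eq_inner inner_commute)
    also have "\<dots> = t i * (norm (l i))\<^sup>2" by simp
    finally show ?thesis using t(2)[of i] by (simp add: mult_left_le_one_le)
  qed
  obtain r where r: "r > 0" "ball x r \<subseteq> \<Omega>" using \<Omega>(1) x by (auto simp: open_contains_ball)
  define d where "d = r / (2 * norm (l i))"
  have d: "d > 0" "d * norm (l i) < r" using r li by (auto simp: d_def)
  then have "x + d *\<^sub>R l i \<in> \<Omega>" "x - d *\<^sub>R l i \<in> \<Omega>"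
    using r by (auto simp: subset_iff dist_norm)
  note b = box_le[OF this(1)] box_le[OF this(2)]
  have "0 < d * (l i \<bullet> l i)" using d(1) li by simp
  with b show "0 < (x - x0) \<bullet> l i" "(x - x0) \<bullet> l i < (norm (l i))\<^sup>2"
    unfolding inner_diff_left inner_add_left inner_scaleR_left by linarith+
qed

text \<open>The inequalities for the orthonormal edge directions are added. Their weights sum to the
  inverse square of the constant, and Bessel's inequality bounds the squared directional derivatives
  by the full gradient.\<close>

lemma Poincare_test_function:
  assumes \<Omega>: "open \<Omega>" and box: "is_box x0 l B" "\<Omega> \<subseteq> B" and \<phi>: "\<phi> \<in> test_functions \<Omega>"
  shows "L2_norm \<Omega> \<phi> \<le> poincare_const l * L2_norm \<Omega> (grad \<phi>)"
proof -
  have l: "l i \<noteq> 0" "i \<noteq> j \<Longrightarrow> l i \<bullet> l j = 0" for i j using box(1) by (auto simp: is_box_def)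
  define e where "e i = l i /\<^sub>R norm (l i)" for i
  have e: "norm (e i) = 1" for i using l(1) by (simp add: e_def)
  have direction: "(pi / norm (l i))\<^sup>2 * (L2_norm \<Omega> \<phi>)\<^sup>2 \<le> (\<integral>x. (grad \<phi> x \<bullet> e i)\<^sup>2 \<partial>lebesgue_on \<Omega>)" for i
  proof (rule Poincare_direction[OF \<Omega> \<phi> _ e])
    show "0 < (x - x0) \<bullet> e i \<and> (x - x0) \<bullet> e i < norm (l i)" if "x \<in> \<Omega>" for x
      using open_subset_box_strip[OF box(1) \<Omega> box(2) that, of i] l(1)[of i]
      by (simp add: e_def field_simps power2_eq_square)
  qed (simp add: l)
  have int: "integrable (lebesgue_on \<Omega>) (\<lambda>x. (grad \<phi> x \<bullet> e i)\<^sup>2)" for i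
  proof -
    obtain K where K: "compact K" "K \<subseteq> \<Omega>" "\<And>x. x \<notin> K \<Longrightarrow> grad \<phi> x = 0"
      using test_functionsE[OF \<phi>] by metis
    show ?thesis
    proof (rule integrable_continuous_compact_support[OF open_sets_lebesgue[OF \<Omega>] K(1,2)])
      show "continuous_on UNIV (\<lambda>x. (grad \<phi> x \<bullet> e i)\<^sup>2)"
        by (intro continuous_intros test_function_continuous[OF \<phi>])
    qed (simp add: K(3))
  qed
  have orthonormal: "e i \<bullet> e j = (if i = j then 1 else 0)" for i j
  proof (cases "i = j")
    case True
    then show ?thesis using e[of j] by (simp add: dot_square_norm)
  qed (simp add: e_def l(2))
  have "(\<Sum>i\<in>UNIV. (pi / norm (l i))\<^sup>2) * (L2_norm \<Omega> \<phi>)\<^sup>2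
      \<le> (\<Sum>i\<in>UNIV. \<integral>x. (grad \<phi> x \<bullet> e i)\<^sup>2 \<partial>lebesgue_on \<Omega>)"
    unfolding sum_distrib_right by (intro sum_mono direction)
  also have "\<dots> = (\<integral>x. (\<Sum>i\<in>UNIV. (grad \<phi> x \<bullet> e i)\<^sup>2) \<partial>lebesgue_on \<Omega>)"
    by (simp add: Bochner_Integration.integral_sum int)
  also have "\<dots> \<le> (\<integral>x. (norm (grad \<phi> x))\<^sup>2 \<partial>lebesgue_on \<Omega>)"
  proof (rule integral_mono)
    show "(\<Sum>i\<in>UNIV. (grad \<phi> x \<bullet> e i)\<^sup>2) \<le> (norm (grad \<phi> x))\<^sup>2" for x
      by (rule Bessel_inequality) (simp_all add: orthonormal)
    show "integrable (lebesgue_on \<Omega>) (\<lambda>x. \<Sum>i\<in>UNIV. (grad \<phi> x \<bullet> e i)\<^sup>2)"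
      by (rule Bochner_Integration.integrable_sum) (rule int)
    show "integrable (lebesgue_on \<Omega>) (\<lambda>x. (norm (grad \<phi> x))\<^sup>2)"
      by (rule L2_integrable[OF test_function_H1(2)[OF \<Omega> \<phi>]])
  qed
  also have "(\<integral>x. (norm (grad \<phi> x))\<^sup>2 \<partial>lebesgue_on \<Omega>) = (L2_norm \<Omega> (grad \<phi>))\<^sup>2"
    by (simp add: L2_norm_def)
  finally have "(poincare_const l)\<^sup>2 * ((\<Sum>i\<in>UNIV. (pi / norm (l i))\<^sup>2) * (L2_norm \<Omega> \<phi>)\<^sup>2)
      \<le> (poincare_const l)\<^sup>2 * (L2_norm \<Omega> (grad \<phi>))\<^sup>2"
    by (intro mult_left_mono) auto
  also have "(poincare_const l)\<^sup>2 * ((\<Sum>i\<in>UNIV. (pi / norm (l i))\<^sup>2) * (L2_norm \<Omega> \<phi>)\<^sup>2) = (L2_norm \<Omega> \<phi>)\<^sup>2"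
    using poincare_const_pos_power2(2)[OF l(1)] by (simp flip: mult.assoc)
  finally have "(L2_norm \<Omega> \<phi>)\<^sup>2 \<le> (poincare_const l * L2_norm \<Omega> (grad \<phi>))\<^sup>2"
    by (simp only: power_mult_distrib)
  then show ?thesis
    by (rule power2_le_imp_le)
      (intro mult_nonneg_nonneg less_imp_le[OF poincare_const_pos_power2(1)] l(1) L2_norm_nonneg)
qed

lemma L2_norm_le_add_diff:
  assumes "f \<in> L2 S" "g \<in> L2 S"
  shows "L2_norm S f \<le> L2_norm S g + L2_norm S (\<lambda>x. f x - g x)"
  using L2_norm_triangle[OF assms(2) L2_diff[OF assms]] by simp

lemma Poincare_H10:
  assumes \<Omega>: "open \<Omega>" and box: "is_box x0 l B" "\<Omega> \<subseteq> B" and u: "u \<in> H10 \<Omega>"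
  shows "L2_norm \<Omega> u \<le> poincare_const l * L2_norm \<Omega> (weak_gradient \<Omega> u)"
proof (rule field_le_epsilon)
  have C: "0 < poincare_const l" using box(1) by (intro poincare_const_pos_power2) (auto simp: is_box_def)
  note u1 = H1D[OF \<Omega> H10_H1[OF u]]
  fix e :: real assume e: "e > 0"
  \<comment> \<open>The errors \<open>d\<close> from the function and
    \<open>poincare_const l * d\<close> from its gradient then add up to exactly
    \<open>e\<close>.\<close>
  define d where "d = e / (1 + poincare_const l)"
  have "d * (1 + poincare_const l) = e" using C by (simp add: d_def)
  then have d: "d + poincare_const l * d = e" by (simp only: distrib_left mult_1_right mult.commute)
  have d0: "d > 0" using e C by (simp add: d_def)
  obtain \<phi> where \<phi>: "\<phi> \<in> test_functions \<Omega>" "L2_norm \<Omega> (\<lambda>x. u x - \<phi> x) < d"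
      "L2_norm \<Omega> (\<lambda>x. weak_gradient \<Omega> u x - grad \<phi> x) < d"
    using u d0 unfolding H10_iff[OF \<Omega>] by blast
  note \<phi>1 = test_function_H1[OF \<Omega> \<phi>(1)]
  have "L2_norm \<Omega> u \<le> L2_norm \<Omega> \<phi> + d"
    using L2_norm_le_add_diff[OF u1(1) \<phi>1(1)] \<phi>(2) by linarith
  also have "L2_norm \<Omega> \<phi> \<le> poincare_const l * L2_norm \<Omega> (grad \<phi>)"
    by (rule Poincare_test_function[OF \<Omega> box \<phi>(1)])
  also have "\<dots> \<le> poincare_const l * (L2_norm \<Omega> (weak_gradient \<Omega> u) + d)"
    using L2_norm_le_add_diff[OF \<phi>1(2) u1(3)] \<phi>(3) C
    by (intro mult_left_mono) (auto simp: L2_norm_minus_commute)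
  finally show "L2_norm \<Omega> u \<le> poincare_const l * L2_norm \<Omega> (weak_gradient \<Omega> u) + e"
    using d by (simp add: algebra_simps)
qed

section \<open>The convection field\<close>

text \<open>(c . grad \<phi>) \<phi> is half of c . grad (\<phi>^2). Since \<phi>^2 is a test
  function, the derivative moves onto \<open>c\<close> and produces its divergence.\<close>

lemma convection_test_function_eq_0:
  assumes \<Omega>: "open \<Omega>" and c: "c \<in> W1inf_vec \<Omega>" "AE x in lebesgue_on \<Omega>. weak_divergence \<Omega> c x = 0"
    and \<phi>: "\<phi> \<in> test_functions \<Omega>"
  shows "(\<integral>x. (grad \<phi> x \<bullet> c x) * \<phi> x \<partial>lebesgue_on \<Omega>) = 0"
proof -
  have w: "has_weak_gradient \<Omega> (\<lambda>x. c x $ i) (weak_gradient \<Omega> (\<lambda>x. c x $ i))" for i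
  proof -
    obtain g where "has_weak_gradient \<Omega> (\<lambda>x. c x $ i) g" using c(1) by (auto simp: W1inf_vec_def W1inf_def)
    then show ?thesis unfolding weak_gradient_def by (rule someI[of "has_weak_gradient \<Omega> _"])
  qed
  define \<psi> where "\<psi> x = \<phi> x * \<phi> x" for x
  have \<psi>: "\<psi> \<in> test_functions \<Omega>" "grad \<psi> x = (2 * \<phi> x) *\<^sub>R grad \<phi> x" for x
    using test_function_mult[OF \<phi> \<phi>] unfolding \<psi>_def by (simp_all flip: scaleR_add_left)
  obtain K where K: "compact K" "K \<subseteq> \<Omega>" "\<And>x. x \<notin> K \<Longrightarrow> \<psi> x = 0" "\<And>x. x \<notin> K \<Longrightarrow> grad \<psi> x = 0"
    using test_functionsE[OF \<psi>(1)] by metis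
  have K': "\<And>x i. x \<notin> K \<Longrightarrow> grad \<psi> x $ i = 0" using K(4) by simp
  note \<Omega>m = open_sets_lebesgue[OF \<Omega>]
  have int: "integrable (lebesgue_on \<Omega>) (\<lambda>x. c x $ i * grad \<psi> x $ i)"
    "integrable (lebesgue_on \<Omega>) (\<lambda>x. weak_gradient \<Omega> (\<lambda>x. c x $ i) x $ i * \<psi> x)" for i
    using locally_integrable_mult_integrable(1)[OF \<Omega>m has_weak_gradientD(1)[OF w[of i]] K(1,2)
        test_function_continuous(3)[OF \<psi>(1), of UNIV i] K']
      locally_integrable_mult_integrable(1)[OF \<Omega>m locally_integrable_component
        [OF has_weak_gradientD(2)[OF w[of i]]] K(1,2) test_function_continuous(1)[OF \<psi>(1), of UNIV] K(3)]
    by auto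
  have "2 * (\<integral>x. (grad \<phi> x \<bullet> c x) * \<phi> x \<partial>lebesgue_on \<Omega>)
      = (\<integral>x. (\<Sum>i\<in>UNIV. c x $ i * grad \<psi> x $ i) \<partial>lebesgue_on \<Omega>)"
    by (simp add: \<psi>(2) inner_vec_def sum_distrib_left sum_distrib_right mult_ac
        flip: Bochner_Integration.integral_mult_right_zero)
  also have "\<dots> = (\<Sum>i\<in>UNIV. \<integral>x. c x $ i * grad \<psi> x $ i \<partial>lebesgue_on \<Omega>)"
    by (intro Bochner_Integration.integral_sum int)
  also have "\<dots> = (\<Sum>i\<in>UNIV. - (\<integral>x. weak_gradient \<Omega> (\<lambda>x. c x $ i) x $ i * \<psi> x \<partial>lebesgue_on \<Omega>))"
    by (intro sum.cong refl has_weak_gradientD(3)[OF w \<psi>(1)])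
  also have "\<dots> = - (\<integral>x. (\<Sum>i\<in>UNIV. weak_gradient \<Omega> (\<lambda>x. c x $ i) x $ i * \<psi> x) \<partial>lebesgue_on \<Omega>)"
    by (simp add: sum_negf Bochner_Integration.integral_sum int)
  also have "(\<integral>x. (\<Sum>i\<in>UNIV. weak_gradient \<Omega> (\<lambda>x. c x $ i) x $ i * \<psi> x) \<partial>lebesgue_on \<Omega>) = 0"
  proof (rule integral_eq_zero_AE)
    show "AE x in lebesgue_on \<Omega>. (\<Sum>i\<in>UNIV. weak_gradient \<Omega> (\<lambda>x. c x $ i) x $ i * \<psi> x) = 0"
      using c(2) by eventually_elim (simp add: weak_divergence_def flip: sum_distrib_right)
  qed
  finally show ?thesis by simp
qed

text \<open>Boundedness is known for the components while the norm is that of the Euclidean length;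
  the sum of the component bounds mediates.\<close>

lemma Linf_norm_bound:
  fixes c :: "real^'n \<Rightarrow> real^'m"
  assumes \<Omega>: "open \<Omega>" "\<Omega> \<noteq> {}" and c: "\<And>i. (\<lambda>x. c x $ i) \<in> Linf \<Omega>"
  shows "c \<in> borel_measurable (lebesgue_on \<Omega>)" "0 \<le> Linf_norm \<Omega> c"
    "AE x in lebesgue_on \<Omega>. norm (c x) \<le> Linf_norm \<Omega> c"
proof -
  have "(\<lambda>x. \<chi> i. c x $ i) \<in> borel_measurable (lebesgue_on \<Omega>)"
    using c by (intro borel_measurable_vec_lambda) (simp add: Linf_def)
  then show meas: "c \<in> borel_measurable (lebesgue_on \<Omega>)" by simp
  define M where "M i = esssup (lebesgue_on \<Omega>) (\<lambda>x. ereal (norm (c x $ i)))" for i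
  have M: "M i < \<infinity>" "AE x in lebesgue_on \<Omega>. ereal (norm (c x $ i)) \<le> M i" for i
    using c esssup_AE by (auto simp: Linf_def M_def)
  have "AE x in lebesgue_on \<Omega>. \<forall>i\<in>UNIV. ereal (norm (c x $ i)) \<le> M i"
    using M by (intro AE_finite_allI) auto
  then have "AE x in lebesgue_on \<Omega>. ereal (norm (c x)) \<le> (\<Sum>i\<in>UNIV. M i)"
  proof eventually_elim
    case (elim x)
    have "ereal (norm (c x)) \<le> (\<Sum>i\<in>UNIV. ereal (norm (c x $ i)))"
      using norm_le_l1_cart[of "c x"] by simp
    also have "\<dots> \<le> (\<Sum>i\<in>UNIV. M i)" using elim by (intro sum_mono) auto
    finally show ?case .
  qed
  then have "esssup (lebesgue_on \<Omega>) (\<lambda>x. ereal (norm (c x))) \<le> (\<Sum>i\<in>UNIV. M i)"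
    using meas by (intro esssup_I) auto
  also have "\<dots> < \<infinity>" using M(1) by (simp add: sum_Pinfty less_top)
  finally have fin: "esssup (lebesgue_on \<Omega>) (\<lambda>x. ereal (norm (c x))) < \<infinity>" .
  have AE: "AE x in lebesgue_on \<Omega>. ereal (norm (c x)) \<le> esssup (lebesgue_on \<Omega>) (\<lambda>x. ereal (norm (c x)))"
    by (rule esssup_AE)
  \<comment> \<open>On a null domain the essential supremum would be minus infinity. A nonempty open
    set has positive measure, so the supremum is nonnegative and its conversion to a real number is
    faithful.\<close>
  have "emeasure (lebesgue_on \<Omega>) (space (lebesgue_on \<Omega>)) \<noteq> 0"
    using open_not_negligible[OF \<Omega>] \<Omega>(1)
    by (auto simp: emeasure_restrict_space negligible_iff_null_sets null_sets_def open_sets_lebesgue)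
  then have nontriv: "\<not> (AE x in lebesgue_on \<Omega>. False)"
    by (simp add: AE_iff_measurable[OF _ refl])
  have nonneg: "0 \<le> esssup (lebesgue_on \<Omega>) (\<lambda>x. ereal (norm (c x)))"
  proof (rule ccontr)
    assume "\<not> ?thesis"
    with AE have "AE x in lebesgue_on \<Omega>. False"
      by (elim eventually_mono) (metis ereal_less_eq(5) norm_ge_zero order_trans)
    then show False using nontriv by simp
  qed
  have eq: "ereal (Linf_norm \<Omega> c) = esssup (lebesgue_on \<Omega>) (\<lambda>x. ereal (norm (c x)))"
    unfolding Linf_norm_def using fin nonneg by (intro ereal_real') auto
  show "AE x in lebesgue_on \<Omega>. norm (c x) \<le> Linf_norm \<Omega> c"
    using AE unfolding eq[symmetric] by simp
  show "0 \<le> Linf_norm \<Omega> c" using nonneg unfolding eq[symmetric] by simp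
qed

section \<open>The velocity space\<close>

lemma L2_inner_lincomb_left:
  assumes "f \<in> L2 S" "g \<in> L2 S" "h \<in> L2 S"
  shows "L2_inner S (\<lambda>x. r *\<^sub>R f x + s *\<^sub>R g x) h = r * L2_inner S f h + s * L2_inner S g h"
  using assms by (simp add: L2_inner_add_left L2_scaleR L2_inner_scaleR_left)

lemma velocity_space_L2:
  assumes \<Omega>: "open \<Omega>" and \<xi>: "\<xi> \<in> velocity_space \<Omega>"
  shows "\<xi> \<in> L2 \<Omega>" "weak_jacobian \<Omega> \<xi> \<in> L2 \<Omega>" "weak_divergence \<Omega> \<xi> \<in> L2 \<Omega>"
proof -
  have H1: "(\<lambda>x. \<xi> x $ i) \<in> H1 \<Omega>" for i using \<xi> by (auto simp: velocity_space_def H10_H1)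
  show "\<xi> \<in> L2 \<Omega>" using H1D(1)[OF \<Omega> H1] by (simp add: L2_vec_iff)
  show "weak_jacobian \<Omega> \<xi> \<in> L2 \<Omega>"
    using H1D(3)[OF \<Omega> H1] by (subst L2_vec_iff) (simp add: weak_jacobian_def)
  have "(\<lambda>x. \<Sum>i\<in>UNIV. weak_gradient \<Omega> (\<lambda>y. \<xi> y $ i) x $ i) \<in> L2 \<Omega>"
    by (intro L2_sum L2_component H1D(3)[OF \<Omega> H1])
  then show "weak_divergence \<Omega> \<xi> \<in> L2 \<Omega>" unfolding weak_divergence_def .
qed

lemma velocity_space_lincomb:
  assumes \<Omega>: "open \<Omega>" and \<xi>: "\<xi> \<in> velocity_space \<Omega>" and \<zeta>: "\<zeta> \<in> velocity_space \<Omega>"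
  shows "(\<lambda>x. r *\<^sub>R \<xi> x + s *\<^sub>R \<zeta> x) \<in> velocity_space \<Omega>"
    and "AE x in lebesgue_on \<Omega>. weak_jacobian \<Omega> (\<lambda>x. r *\<^sub>R \<xi> x + s *\<^sub>R \<zeta> x) x
          = r *\<^sub>R weak_jacobian \<Omega> \<xi> x + s *\<^sub>R weak_jacobian \<Omega> \<zeta> x"
    and "AE x in lebesgue_on \<Omega>. weak_divergence \<Omega> (\<lambda>x. r *\<^sub>R \<xi> x + s *\<^sub>R \<zeta> x) x
          = r *\<^sub>R weak_divergence \<Omega> \<xi> x + s *\<^sub>R weak_divergence \<Omega> \<zeta> x"
proof -
  have H: "(\<lambda>x. \<xi> x $ i) \<in> H10 \<Omega>" "(\<lambda>x. \<zeta> x $ i) \<in> H10 \<Omega>" for i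
    using \<xi> \<zeta> by (auto simp: velocity_space_def)
  show "(\<lambda>x. r *\<^sub>R \<xi> x + s *\<^sub>R \<zeta> x) \<in> velocity_space \<Omega>"
    using H10_lincomb[OF \<Omega> H] by (simp add: velocity_space_def)
  have "AE x in lebesgue_on \<Omega>. \<forall>i\<in>UNIV. weak_gradient \<Omega> (\<lambda>y. r * \<xi> y $ i + s * \<zeta> y $ i) x
      = r *\<^sub>R weak_gradient \<Omega> (\<lambda>y. \<xi> y $ i) x + s *\<^sub>R weak_gradient \<Omega> (\<lambda>y. \<zeta> y $ i) x"
    using H1_lincomb(2)[OF \<Omega> H10_H1[OF H(1)] H10_H1[OF H(2)]] by (intro AE_finite_allI) auto
  then show "AE x in lebesgue_on \<Omega>. weak_jacobian \<Omega> (\<lambda>x. r *\<^sub>R \<xi> x + s *\<^sub>R \<zeta> x) x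
          = r *\<^sub>R weak_jacobian \<Omega> \<xi> x + s *\<^sub>R weak_jacobian \<Omega> \<zeta> x"
    "AE x in lebesgue_on \<Omega>. weak_divergence \<Omega> (\<lambda>x. r *\<^sub>R \<xi> x + s *\<^sub>R \<zeta> x) x
          = r *\<^sub>R weak_divergence \<Omega> \<xi> x + s *\<^sub>R weak_divergence \<Omega> \<zeta> x"
    by (eventually_elim, simp add: weak_jacobian_def vec_eq_iff,
        eventually_elim, simp add: weak_divergence_def sum.distrib sum_distrib_left)
qed

section \<open>The divergence form and the inf-sup condition\<close>

lemma form_B_lincomb_left:
  assumes \<Omega>: "open \<Omega>" and \<xi>: "\<xi> \<in> velocity_space \<Omega>" and \<zeta>: "\<zeta> \<in> velocity_space \<Omega>" and \<phi>: "\<phi> \<in> L2 \<Omega>"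
  shows "form_B \<Omega> (\<lambda>x. r *\<^sub>R \<xi> x + s *\<^sub>R \<zeta> x) \<phi> = r * form_B \<Omega> \<xi> \<phi> + s * form_B \<Omega> \<zeta> \<phi>"
proof -
  note div = velocity_space_L2(3)[OF \<Omega>]
  note v = velocity_space_lincomb[OF \<Omega> \<xi> \<zeta>, of r s]
  have "form_B \<Omega> (\<lambda>x. r *\<^sub>R \<xi> x + s *\<^sub>R \<zeta> x) \<phi> =
      L2_inner \<Omega> (\<lambda>x. r *\<^sub>R weak_divergence \<Omega> \<xi> x + s *\<^sub>R weak_divergence \<Omega> \<zeta> x) \<phi>"
    unfolding form_B_def L2_inner_commute[of \<Omega> \<phi>]
    by (rule L2_inner_cong_AE[OF open_sets_lebesgue[OF \<Omega>] div[OF v(1)] \<phi> v(3)]) simp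
  also have "\<dots> = r * form_B \<Omega> \<xi> \<phi> + s * form_B \<Omega> \<zeta> \<phi>"
    unfolding form_B_def L2_inner_commute[of \<Omega> \<phi>]
    by (rule L2_inner_lincomb_left[OF div[OF \<xi>] div[OF \<zeta>] \<phi>])
  finally show ?thesis .
qed

lemma form_B_diff_right:
  assumes "open \<Omega>" "\<xi> \<in> velocity_space \<Omega>" "\<phi> \<in> L2 \<Omega>" "\<psi> \<in> L2 \<Omega>"
  shows "form_B \<Omega> \<xi> (\<lambda>x. \<phi> x - \<psi> x) = form_B \<Omega> \<xi> \<phi> - form_B \<Omega> \<xi> \<psi>"
  unfolding form_B_def using assms by (intro L2_inner_diff_left velocity_space_L2)

lemma pressure_space_diff:
  assumes "bounded \<Omega>" "open \<Omega>" "\<phi> \<in> pressure_space \<Omega>" "\<psi> \<in> pressure_space \<Omega>"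
  shows "(\<lambda>x. \<phi> x - \<psi> x) \<in> pressure_space \<Omega>"
proof -
  have "finite_measure (lebesgue_on \<Omega>)"
    using assms(1,2) by (simp add: finite_measure_lebesgue_on bounded_set_imp_lmeasurable open_sets_lebesgue)
  then have one: "(\<lambda>_. 1::real) \<in> L2 \<Omega>" by (simp add: L2_def finite_measure.integrable_const)
  have "integrable (lebesgue_on \<Omega>) \<phi>" "integrable (lebesgue_on \<Omega>) \<psi>"
    using L2_inner_integrable[OF _ one, of \<phi>] L2_inner_integrable[OF _ one, of \<psi>] assms(3,4)
    by (auto simp: pressure_space_def)
  then show ?thesis using assms(3,4) by (auto simp: pressure_space_def intro: L2_diff)
qed

lemma inf_sup_bound:
  assumes \<beta>: "inf_sup_constant \<Omega> \<beta>" and r: "r \<in> pressure_space \<Omega>" and M: "0 \<le> M"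
    and bound: "\<And>\<xi>. \<xi> \<in> velocity_space \<Omega> \<Longrightarrow>
      form_B \<Omega> \<xi> r \<le> M * L2_norm \<Omega> (weak_jacobian \<Omega> \<xi>)"
  shows "\<beta> * L2_norm \<Omega> r \<le> M"
proof -
  have "ereal (\<beta> * L2_norm \<Omega> r) \<le>
      (SUP \<xi>\<in>{\<xi> \<in> velocity_space \<Omega>. \<not> (AE x in lebesgue_on \<Omega>. \<xi> x = 0)}.
             ereal (form_B \<Omega> \<xi> r / L2_norm \<Omega> (weak_jacobian \<Omega> \<xi>)))"
    using \<beta> r by (simp add: inf_sup_constant_def)
  also have "\<dots> \<le> ereal M"
  proof (rule SUP_least)
    fix \<xi> assume "\<xi> \<in> {\<xi> \<in> velocity_space \<Omega>. \<not> (AE x in lebesgue_on \<Omega>. \<xi> x = 0)}"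
    then have b: "form_B \<Omega> \<xi> r \<le> M * L2_norm \<Omega> (weak_jacobian \<Omega> \<xi>)" using bound by simp
    \<comment> \<open>If the Jacobian has norm zero, the quotient is 0 by the convention for
      division, and \<open>M\<close> bounds that too.\<close>
    have "form_B \<Omega> \<xi> r / L2_norm \<Omega> (weak_jacobian \<Omega> \<xi>) \<le> M"
    proof (cases "L2_norm \<Omega> (weak_jacobian \<Omega> \<xi>) = 0")
      case False
      then have "L2_norm \<Omega> (weak_jacobian \<Omega> \<xi>) > 0" using L2_norm_nonneg by (metis less_eq_real_def)
      then show ?thesis using b by (simp add: pos_divide_le_eq)
    qed (simp add: M)
    then show "ereal (form_B \<Omega> \<xi> r / L2_norm \<Omega> (weak_jacobian \<Omega> \<xi>)) \<le> ereal M" by simp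
  qed
  finally show ?thesis by simp
qed

text \<open>Solvability of a Galerkin system whose matrix need be neither symmetric nor, for
  dependent trial functions, invertible. Invertibility is replaced by a right-hand side that
  vanishes wherever the nonnegative quadratic form does.\<close>

lemma solve_two_equations:
  fixes m11 m12 m21 m22 r1 r2 :: real
  assumes nonneg: "\<And>\<alpha> \<beta>. 0 \<le> \<alpha> * \<alpha> * m11 + \<alpha> * \<beta> * (m12 + m21) + \<beta> * \<beta> * m22"
    and zero: "\<And>\<alpha> \<beta>. \<alpha> * \<alpha> * m11 + \<alpha> * \<beta> * (m12 + m21) + \<beta> * \<beta> * m22 = 0 \<Longrightarrow> \<alpha> * r1 + \<beta> * r2 = 0"
  obtains \<alpha> \<beta> where "\<alpha> * m11 + \<beta> * m21 = r1" "\<alpha> * m12 + \<beta> * m22 = r2"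
proof (cases "m11 * m22 - m12 * m21 = 0")
  case False
  show ?thesis
    by (rule that[of "(r1 * m22 - r2 * m21) / (m11 * m22 - m12 * m21)"
          "(r2 * m11 - r1 * m12) / (m11 * m22 - m12 * m21)"])
      (use False in \<open>simp_all add: divide_simps, simp_all add: algebra_simps\<close>)
next
  case det: True
  show ?thesis
  proof (cases "m11 = 0")
    case False
    \<comment> \<open>At (m12, - m11) the form is m11 times the determinant, so it vanishes and the
      two equations are compatible.\<close>
    have "m12 * m12 * m11 + m12 * (- m11) * (m12 + m21) + (- m11) * (- m11) * m22
        = m11 * (m11 * m22 - m12 * m21)" by (simp add: algebra_simps)
    from zero[of m12 "- m11", unfolded this] have "m12 * r1 = m11 * r2"
      using det by simp
    then show ?thesis
      using False by (intro that[of "r1 / m11" 0]) (simp_all add: field_simps)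
  next
    case True
    have r1: "r1 = 0" using zero[of 1 0] True by simp
    \<comment> \<open>With m11 = 0 the form is affine in its first argument, and the witness below
      would give it the value -1. As m12 m21 = 0 by the determinant, both off-diagonal entries
      vanish.\<close>
    have "m12 + m21 = 0"
    proof (rule ccontr)
      assume *: "m12 + m21 \<noteq> 0"
      show False
        using nonneg[of "- (m22 + 1) / (m12 + m21)" 1] True * by simp
    qed
    then have z: "m12 = 0" "m21 = 0" using det True by (auto simp: add_eq_0_iff)
    show ?thesis
    proof (cases "m22 = 0")
      case True
      then show ?thesis using zero[of 0 1] r1 z \<open>m11 = 0\<close> by (intro that[of 0 0]) auto
    next
      case False
      then show ?thesis using r1 z True by (intro that[of 0 "r2 / m22"]) auto
    qed
  qed
qed

section \<open>The Oseen setting and its energy norm\<close>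

locale oseen =
  fixes \<Omega> B :: "(real^'n) set" and c :: "real^'n \<Rightarrow> real^'n" and \<epsilon> \<kappa> :: real
    and x0 :: "real^'n" and l :: "'n \<Rightarrow> real^'n"
  assumes open_\<Omega>: "open \<Omega>" and nonempty: "\<Omega> \<noteq> {}" and bounded_\<Omega>: "bounded \<Omega>"
    and box: "is_box x0 l B" "\<Omega> \<subseteq> B"
    and eps: "0 < \<epsilon>" and kap: "0 \<le> \<kappa>"
    and c: "c \<in> W1inf_vec \<Omega>" "AE x in lebesgue_on \<Omega>. weak_divergence \<Omega> c x = 0"
begin

abbreviation "V \<equiv> velocity_space \<Omega>"
abbreviation "J \<equiv> weak_jacobian \<Omega>"
abbreviation "ip \<equiv> L2_inner \<Omega>"
abbreviation "n2 \<equiv> L2_norm \<Omega>"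
abbreviation "nV \<equiv> V_norm \<Omega> \<epsilon> \<kappa> \<Omega>"
abbreviation "C\<^sub>P \<equiv> poincare_const l"
abbreviation "C \<equiv> C_Omega \<epsilon> \<kappa> C\<^sub>P"
abbreviation "M \<equiv> Linf_norm \<Omega> c"
abbreviation "C\<^sub>c\<^sub>t \<equiv> 1 + C / sqrt \<epsilon> * M"

lemmas \<Omega>_sets = open_sets_lebesgue[OF open_\<Omega>]
lemmas V_L2 = velocity_space_L2[OF open_\<Omega>]
lemmas V_lincomb = velocity_space_lincomb[OF open_\<Omega>]

lemma c_bound:
  "c \<in> borel_measurable (lebesgue_on \<Omega>)" "0 \<le> M" "AE x in lebesgue_on \<Omega>. norm (c x) \<le> M"
  using Linf_norm_bound[OF open_\<Omega> nonempty, of c] c by (auto simp: W1inf_vec_def W1inf_def)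

lemma C\<^sub>P_pos: "0 < C\<^sub>P"
  using box(1) by (intro poincare_const_pos_power2) (auto simp: is_box_def)

lemma C_nonneg: "0 \<le> C"
  using C\<^sub>P_pos eps kap by (simp add: C_Omega_def)

lemma C\<^sub>c\<^sub>t_nonneg: "0 \<le> C\<^sub>c\<^sub>t"
  using C_nonneg eps c_bound(2) by simp

text \<open>The scalar inequalities are squared before they are summed, so the constant picks up no
  factor from the dimension.\<close>

lemma Poincare_V:
  assumes \<xi>: "\<xi> \<in> V"
  shows "n2 \<xi> \<le> C\<^sub>P * n2 (J \<xi>)"
proof (rule power2_le_imp_le)
  have "n2 (\<lambda>x. \<xi> x $ i) \<le> C\<^sub>P * n2 (\<lambda>x. J \<xi> x $ i)" for i
    using Poincare_H10[OF open_\<Omega> box, of "\<lambda>x. \<xi> x $ i"] \<xi>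
    by (simp add: velocity_space_def weak_jacobian_def)
  then have "(n2 (\<lambda>x. \<xi> x $ i))\<^sup>2 \<le> C\<^sub>P\<^sup>2 * (n2 (\<lambda>x. J \<xi> x $ i))\<^sup>2" for i
    using power_mono[OF _ L2_norm_nonneg, of _ _ _ 2] by (metis power_mult_distrib)
  then have "(\<Sum>i\<in>UNIV. ip (\<lambda>x. \<xi> x $ i) (\<lambda>x. \<xi> x $ i))
      \<le> (\<Sum>i\<in>UNIV. C\<^sub>P\<^sup>2 * ip (\<lambda>x. J \<xi> x $ i) (\<lambda>x. J \<xi> x $ i))"
    unfolding L2_norm_power2 by (intro sum_mono) auto
  then show "(n2 \<xi>)\<^sup>2 \<le> (C\<^sub>P * n2 (J \<xi>))\<^sup>2"
    by (simp add: power_mult_distrib L2_norm_power2 L2_inner_vec V_L2[OF \<xi>] sum_distrib_left)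
qed (simp add: C\<^sub>P_pos less_imp_le L2_norm_nonneg)

text \<open>With \<open>conv\<close> it splits both bilinear forms into a symmetric energy part and
  a skew convection part; state and adjoint differ only in the sign of the latter.\<close>

definition V_inner where "V_inner \<xi> \<zeta> = \<epsilon> * ip (J \<xi>) (J \<zeta>) + \<kappa> * ip \<xi> \<zeta>"

definition conv where "conv \<xi> \<zeta> = ip (convection \<Omega> c \<xi>) \<zeta>"

lemma nV_power2: "(nV \<xi>)\<^sup>2 = V_inner \<xi> \<xi>"
  using eps kap by (simp add: V_norm_def V_inner_def L2_norm_power2[symmetric])

lemma nV_nonneg: "0 \<le> nV \<xi>"
  using eps kap by (simp add: V_norm_def)

lemma V_inner_commute: "V_inner \<xi> \<zeta> = V_inner \<zeta> \<xi>"
  by (simp add: V_inner_def L2_inner_commute)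

lemma V_inner_lincomb_left:
  assumes \<xi>: "\<xi> \<in> V" and \<zeta>: "\<zeta> \<in> V" and \<eta>: "\<eta> \<in> V"
  shows "V_inner (\<lambda>x. r *\<^sub>R \<xi> x + s *\<^sub>R \<zeta> x) \<eta> = r * V_inner \<xi> \<eta> + s * V_inner \<zeta> \<eta>"
proof -
  note v = V_lincomb[OF \<xi> \<zeta>, of r s]
  have "ip (J (\<lambda>x. r *\<^sub>R \<xi> x + s *\<^sub>R \<zeta> x)) (J \<eta>) = ip (\<lambda>x. r *\<^sub>R J \<xi> x + s *\<^sub>R J \<zeta> x) (J \<eta>)"
    by (rule L2_inner_cong_AE[OF \<Omega>_sets V_L2(2)[OF v(1)] V_L2(2)[OF \<eta>] v(2)]) simp
  then show ?thesis
    using V_L2[OF \<xi>] V_L2[OF \<zeta>] V_L2[OF \<eta>]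
    by (simp add: V_inner_def L2_inner_lincomb_left algebra_simps)
qed

lemma V_Cauchy_Schwarz:
  assumes \<xi>: "\<xi> \<in> V" and \<zeta>: "\<zeta> \<in> V"
  shows "\<bar>V_inner \<xi> \<zeta>\<bar> \<le> nV \<xi> * nV \<zeta>"
proof (rule Cauchy_Schwarz_from_expansion)
  fix s t :: real
  let ?w = "\<lambda>x. s *\<^sub>R \<xi> x + (- t) *\<^sub>R \<zeta> x"
  have w: "?w \<in> V" by (rule V_lincomb[OF \<xi> \<zeta>])
  have "0 \<le> V_inner ?w ?w" by (simp flip: nV_power2)
  also have "\<dots> = s * V_inner ?w \<xi> + (- t) * V_inner ?w \<zeta>"
    unfolding V_inner_lincomb_left[OF \<xi> \<zeta> w] V_inner_commute[of ?w] by simp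
  also have "\<dots> = s\<^sup>2 * (nV \<xi>)\<^sup>2 - 2 * s * t * V_inner \<xi> \<zeta> + t\<^sup>2 * (nV \<zeta>)\<^sup>2"
    unfolding V_inner_lincomb_left[OF \<xi> \<zeta> \<xi>] V_inner_lincomb_left[OF \<xi> \<zeta> \<zeta>] nV_power2
      V_inner_commute[of \<zeta> \<xi>]
    by (simp add: power2_eq_square algebra_simps)
  finally show "0 \<le> s\<^sup>2 * (nV \<xi>)\<^sup>2 - 2 * s * t * V_inner \<xi> \<zeta> + t\<^sup>2 * (nV \<zeta>)\<^sup>2" .
qed (simp_all add: nV_nonneg)

lemma nV_diff_power2:
  assumes \<xi>: "\<xi> \<in> V" and \<zeta>: "\<zeta> \<in> V"
  shows "(nV (\<lambda>x. \<xi> x - \<zeta> x))\<^sup>2 = (nV \<xi>)\<^sup>2 - 2 * V_inner \<xi> \<zeta> + (nV \<zeta>)\<^sup>2"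
proof -
  let ?w = "\<lambda>x. 1 *\<^sub>R \<xi> x + (- 1) *\<^sub>R \<zeta> x"
  have w: "?w \<in> V" by (rule V_lincomb[OF \<xi> \<zeta>])
  have "(nV ?w)\<^sup>2 = V_inner \<xi> ?w - V_inner \<zeta> ?w"
    unfolding nV_power2 V_inner_lincomb_left[OF \<xi> \<zeta> w] by simp
  also have "\<dots> = (nV \<xi>)\<^sup>2 - 2 * V_inner \<xi> \<zeta> + (nV \<zeta>)\<^sup>2"
    unfolding V_inner_commute[of _ ?w] V_inner_lincomb_left[OF \<xi> \<zeta> \<xi>]
      V_inner_lincomb_left[OF \<xi> \<zeta> \<zeta>] nV_power2 V_inner_commute[of \<zeta> \<xi>] by simp
  finally show ?thesis by simp
qed

lemma nV_triangle:
  assumes \<xi>: "\<xi> \<in> V" and \<zeta>: "\<zeta> \<in> V"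
  shows "nV (\<lambda>x. \<xi> x - \<zeta> x) \<le> nV \<xi> + nV \<zeta>"
proof (rule power2_le_imp_le)
  show "(nV (\<lambda>x. \<xi> x - \<zeta> x))\<^sup>2 \<le> (nV \<xi> + nV \<zeta>)\<^sup>2"
    using V_Cauchy_Schwarz[OF \<xi> \<zeta>] by (simp add: nV_diff_power2[OF \<xi> \<zeta>] power2_sum)
qed (simp add: nV_nonneg)

lemma nV_jacobian_le: "sqrt \<epsilon> * n2 (J \<xi>) \<le> nV \<xi>"
proof -
  have "sqrt (\<epsilon> * (n2 (J \<xi>))\<^sup>2) \<le> nV \<xi>"
    using eps kap by (simp add: V_norm_def)
  then show ?thesis by (simp add: real_sqrt_mult L2_norm_nonneg)
qed

text \<open>The Poincare inequality controls the L2 norm by the gradient term, and for positive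
  \<kappa> the reaction term controls it directly; \<open>C_Omega\<close> takes the better of the
  two.\<close>

lemma V_embedding:
  assumes \<xi>: "\<xi> \<in> V"
  shows "n2 \<xi> \<le> C * nV \<xi>"
proof -
  have "n2 \<xi> \<le> C\<^sub>P * n2 (J \<xi>)" by (rule Poincare_V[OF \<xi>])
  also have "\<dots> = C\<^sub>P / sqrt \<epsilon> * (sqrt \<epsilon> * n2 (J \<xi>))" using eps by simp
  also have "\<dots> \<le> C\<^sub>P / sqrt \<epsilon> * nV \<xi>"
    using C\<^sub>P_pos eps by (intro mult_left_mono nV_jacobian_le) simp
  finally have 1: "n2 \<xi> \<le> C\<^sub>P / sqrt \<epsilon> * nV \<xi>" .
  show ?thesis
  proof (cases "\<kappa> = 0")
    case False
    then have k: "\<kappa> > 0" using kap by simp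
    have "sqrt (\<kappa> * (n2 \<xi>)\<^sup>2) \<le> nV \<xi>"
      using eps kap by (simp add: V_norm_def)
    then have "sqrt \<kappa> * n2 \<xi> \<le> nV \<xi>" by (simp add: real_sqrt_mult L2_norm_nonneg)
    then have "n2 \<xi> \<le> 1 / sqrt \<kappa> * nV \<xi>" using k by (simp add: field_simps)
    with 1 show ?thesis using False by (simp add: C_Omega_def min_def)
  qed (use 1 in \<open>simp add: C_Omega_def\<close>)
qed

text \<open>The inf-sup condition is normalized by the gradient alone, so energy norms must be
  converted back; this is the origin of the numerator of C_is.\<close>

lemma nV_le_jacobian:
  assumes \<xi>: "\<xi> \<in> V"
  shows "nV \<xi> \<le> sqrt (\<epsilon> + \<kappa> * C\<^sub>P\<^sup>2) * n2 (J \<xi>)"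
proof -
  have "(n2 \<xi>)\<^sup>2 \<le> (C\<^sub>P * n2 (J \<xi>))\<^sup>2"
    by (intro power_mono Poincare_V \<xi> L2_norm_nonneg)
  then have "\<epsilon> * (n2 (J \<xi>))\<^sup>2 + \<kappa> * (n2 \<xi>)\<^sup>2 \<le> \<epsilon> * (n2 (J \<xi>))\<^sup>2 + \<kappa> * (C\<^sub>P * n2 (J \<xi>))\<^sup>2"
    using kap by (intro add_left_mono mult_left_mono)
  also have "\<dots> = (\<epsilon> + \<kappa> * C\<^sub>P\<^sup>2) * (n2 (J \<xi>))\<^sup>2" by (simp add: algebra_simps power_mult_distrib)
  finally have "nV \<xi> \<le> sqrt ((\<epsilon> + \<kappa> * C\<^sub>P\<^sup>2) * (n2 (J \<xi>))\<^sup>2)" by (simp add: V_norm_def)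
  then show ?thesis by (simp add: real_sqrt_mult L2_norm_nonneg)
qed

section \<open>The convection term\<close>

lemma convection_L2:
  assumes \<xi>: "\<xi> \<in> V"
  shows "convection \<Omega> c \<xi> \<in> L2 \<Omega>" "n2 (convection \<Omega> c \<xi>) \<le> M * n2 (J \<xi>)"
proof -
  note J = L2_measurable[OF V_L2(2)[OF \<xi>]]
  have "(\<lambda>x. \<chi> i. J \<xi> x $ i \<bullet> c x) \<in> borel_measurable (lebesgue_on \<Omega>)"
    using L2_measurable[OF L2_component[OF V_L2(2)[OF \<xi>]]] c_bound(1)
    by (intro borel_measurable_vec_lambda borel_measurable_inner)
  moreover have "convection \<Omega> c \<xi> = (\<lambda>x. \<chi> i. J \<xi> x $ i \<bullet> c x)"
    by (auto simp: convection_def matrix_vector_mult_def inner_vec_def vec_eq_iff)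
  ultimately have meas: "convection \<Omega> c \<xi> \<in> borel_measurable (lebesgue_on \<Omega>)" by simp
  have "AE x in lebesgue_on \<Omega>. norm (convection \<Omega> c \<xi> x) \<le> M * norm (J \<xi> x)"
    using c_bound(3)
  proof eventually_elim
    case (elim x)
    \<comment> \<open>Cauchy-Schwarz is applied row by row, which leaves the Frobenius norm of the
      Jacobian without a factor depending on the dimension.\<close>
    have "(norm (convection \<Omega> c \<xi> x))\<^sup>2 = (\<Sum>i\<in>UNIV. (J \<xi> x $ i \<bullet> c x)\<^sup>2)"
      by (simp add: convection_def norm_vec_def L2_set_def sum_nonneg matrix_vector_mult_def inner_vec_def)
    also have "\<dots> \<le> (\<Sum>i\<in>UNIV. (norm (J \<xi> x $ i))\<^sup>2 * (norm (c x))\<^sup>2)"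
    proof (rule sum_mono)
      fix i
      have "\<bar>J \<xi> x $ i \<bullet> c x\<bar>\<^sup>2 \<le> (norm (J \<xi> x $ i) * norm (c x))\<^sup>2"
        by (intro power_mono Cauchy_Schwarz_ineq2) simp
      then show "(J \<xi> x $ i \<bullet> c x)\<^sup>2 \<le> (norm (J \<xi> x $ i))\<^sup>2 * (norm (c x))\<^sup>2"
        by (simp add: power_mult_distrib)
    qed
    also have "\<dots> = (norm (J \<xi> x) * norm (c x))\<^sup>2"
      by (simp add: norm_vec_def[of "J \<xi> x"] L2_set_def sum_nonneg power_mult_distrib sum_distrib_right)
    finally have "norm (convection \<Omega> c \<xi> x) \<le> norm (J \<xi> x) * norm (c x)"
      by (rule power2_le_imp_le) simp
    also have "\<dots> \<le> norm (J \<xi> x) * M" using elim by (intro mult_left_mono) auto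
    finally show ?case by (simp add: mult.commute)
  qed
  then show "convection \<Omega> c \<xi> \<in> L2 \<Omega>" "n2 (convection \<Omega> c \<xi>) \<le> M * n2 (J \<xi>)"
    using L2_bounded_mult[OF V_L2(2)[OF \<xi>] meas] L2_norm_mono_AE[OF V_L2(2)[OF \<xi>] meas] c_bound(2)
    by blast+
qed

lemma convection_lincomb:
  assumes \<xi>: "\<xi> \<in> V" and \<zeta>: "\<zeta> \<in> V"
  shows "AE x in lebesgue_on \<Omega>. convection \<Omega> c (\<lambda>x. r *\<^sub>R \<xi> x + s *\<^sub>R \<zeta> x) x
      = r *\<^sub>R convection \<Omega> c \<xi> x + s *\<^sub>R convection \<Omega> c \<zeta> x"
  using V_lincomb(2)[OF \<xi> \<zeta>, of r s]
  by eventually_elim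
    (simp add: convection_def matrix_vector_mult_add_rdistrib scaleR_matrix_vector_assoc)

lemma conv_lincomb_left:
  assumes \<xi>: "\<xi> \<in> V" and \<zeta>: "\<zeta> \<in> V" and \<eta>: "\<eta> \<in> V"
  shows "conv (\<lambda>x. r *\<^sub>R \<xi> x + s *\<^sub>R \<zeta> x) \<eta> = r * conv \<xi> \<eta> + s * conv \<zeta> \<eta>"
proof -
  have "conv (\<lambda>x. r *\<^sub>R \<xi> x + s *\<^sub>R \<zeta> x) \<eta> =
      ip (\<lambda>x. r *\<^sub>R convection \<Omega> c \<xi> x + s *\<^sub>R convection \<Omega> c \<zeta> x) \<eta>"
    unfolding conv_def
    by (rule L2_inner_cong_AE[OF \<Omega>_sets convection_L2(1)[OF V_lincomb(1)[OF \<xi> \<zeta>]] V_L2(1)[OF \<eta>]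
          convection_lincomb[OF \<xi> \<zeta>]]) simp
  then show ?thesis
    using convection_L2(1) V_L2 \<xi> \<zeta> \<eta> by (simp add: conv_def L2_inner_lincomb_left)
qed

lemma conv_lincomb_right:
  assumes \<xi>: "\<xi> \<in> V" and \<zeta>: "\<zeta> \<in> V" and \<eta>: "\<eta> \<in> V"
  shows "conv \<eta> (\<lambda>x. r *\<^sub>R \<xi> x + s *\<^sub>R \<zeta> x) = r * conv \<eta> \<xi> + s * conv \<eta> \<zeta>"
  using L2_inner_lincomb_left[OF V_L2(1)[OF \<xi>] V_L2(1)[OF \<zeta>] convection_L2(1)[OF \<eta>], of r s]
  by (simp add: conv_def L2_inner_commute[of \<Omega> "convection \<Omega> c \<eta>"])

end

section \<open>Energy, duality and inf-sup estimates\<close>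

context oseen
begin

lemma inner_c_L2:
  assumes g: "g \<in> L2 \<Omega>"
  shows "(\<lambda>x. g x \<bullet> c x) \<in> L2 \<Omega>" "n2 (\<lambda>x. g x \<bullet> c x) \<le> M * n2 g"
proof -
  have meas: "(\<lambda>x. g x \<bullet> c x) \<in> borel_measurable (lebesgue_on \<Omega>)"
    using L2_measurable[OF g] c_bound(1) by (rule borel_measurable_inner)
  have "AE x in lebesgue_on \<Omega>. norm (g x \<bullet> c x) \<le> M * norm (g x)"
    using c_bound(3)
  proof eventually_elim
    case (elim x)
    have "\<bar>g x \<bullet> c x\<bar> \<le> norm (g x) * norm (c x)" by (rule Cauchy_Schwarz_ineq2)
    also have "\<dots> \<le> norm (g x) * M" using elim by (intro mult_left_mono) auto
    finally show ?case by (simp add: mult.commute)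
  qed
  then show "(\<lambda>x. g x \<bullet> c x) \<in> L2 \<Omega>" "n2 (\<lambda>x. g x \<bullet> c x) \<le> M * n2 g"
    using L2_bounded_mult[OF g meas] L2_norm_mono_AE[OF g meas] c_bound(2) by blast+
qed

text \<open>The identity for test functions passes to the limit: with \<phi> within \<open>d\<close>
  of \<open>u\<close>, only (c . grad (u - \<phi>), u) and (c . grad \<phi>, u - \<phi>) remain.
  Both are linear in \<open>d\<close>, and \<open>d \<le> 1\<close> keeps the gradient of \<phi>
  bounded.\<close>

lemma convection_H10_eq_0:
  assumes u: "u \<in> H10 \<Omega>"
  shows "ip (\<lambda>x. weak_gradient \<Omega> u x \<bullet> c x) u = 0"
proof -
  let ?g = "weak_gradient \<Omega> u"
  note u1 = H1D[OF open_\<Omega> H10_H1[OF u]]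
  define K where "K = M * (n2 u + n2 ?g + 1)"
  have bound: "\<bar>ip (\<lambda>x. ?g x \<bullet> c x) u\<bar> \<le> d * K" if d: "0 < d" "d \<le> 1" for d
  proof -
    obtain \<phi> where \<phi>: "\<phi> \<in> test_functions \<Omega>" "n2 (\<lambda>x. u x - \<phi> x) < d"
        "n2 (\<lambda>x. ?g x - grad \<phi> x) < d"
      using u d(1) unfolding H10_iff[OF open_\<Omega>] by blast
    note \<phi>1 = test_function_H1[OF open_\<Omega> \<phi>(1)]
    note gd = L2_diff[OF u1(3) \<phi>1(2)] and ud = L2_diff[OF u1(1) \<phi>1(1)]
    have "ip (\<lambda>x. grad \<phi> x \<bullet> c x) \<phi> = 0"
      using convection_test_function_eq_0[OF open_\<Omega> c \<phi>(1)] by (simp add: L2_inner_real)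
    then have "ip (\<lambda>x. grad \<phi> x \<bullet> c x) (\<lambda>x. u x - \<phi> x) = ip (\<lambda>x. grad \<phi> x \<bullet> c x) u"
      using L2_inner_diff_right[OF u1(1) \<phi>1(1) inner_c_L2(1)[OF \<phi>1(2)]] by simp
    moreover have "ip (\<lambda>x. (?g x - grad \<phi> x) \<bullet> c x) u
        = ip (\<lambda>x. ?g x \<bullet> c x) u - ip (\<lambda>x. grad \<phi> x \<bullet> c x) u"
      using L2_inner_diff_left[OF inner_c_L2(1)[OF u1(3)] inner_c_L2(1)[OF \<phi>1(2)] u1(1)]
      by (simp add: inner_diff_left)
    ultimately have "\<bar>ip (\<lambda>x. ?g x \<bullet> c x) u\<bar> \<le> \<bar>ip (\<lambda>x. (?g x - grad \<phi> x) \<bullet> c x) u\<bar>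
        + \<bar>ip (\<lambda>x. grad \<phi> x \<bullet> c x) (\<lambda>x. u x - \<phi> x)\<bar>" by linarith
    also have "\<bar>ip (\<lambda>x. (?g x - grad \<phi> x) \<bullet> c x) u\<bar> \<le> (M * d) * n2 u"
    proof (rule order_trans[OF L2_Cauchy_Schwarz[OF inner_c_L2(1)[OF gd] u1(1)]])
      have "n2 (\<lambda>x. (?g x - grad \<phi> x) \<bullet> c x) \<le> M * n2 (\<lambda>x. ?g x - grad \<phi> x)"
        by (rule inner_c_L2(2)[OF gd])
      also have "\<dots> \<le> M * d" using \<phi>(3) c_bound(2) by (intro mult_left_mono) auto
      finally show "n2 (\<lambda>x. (?g x - grad \<phi> x) \<bullet> c x) * n2 u \<le> (M * d) * n2 u"
        by (intro mult_right_mono L2_norm_nonneg)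
    qed
    also have "\<bar>ip (\<lambda>x. grad \<phi> x \<bullet> c x) (\<lambda>x. u x - \<phi> x)\<bar> \<le> (M * (n2 ?g + 1)) * d"
    proof (rule order_trans[OF L2_Cauchy_Schwarz[OF inner_c_L2(1)[OF \<phi>1(2)] ud]])
      have "n2 (grad \<phi>) \<le> n2 ?g + 1"
        using L2_norm_le_add_diff[OF \<phi>1(2) u1(3)] \<phi>(3) d(2)
          L2_norm_minus_commute[of \<Omega> ?g "grad \<phi>"] by linarith
      then have "M * n2 (grad \<phi>) \<le> M * (n2 ?g + 1)" using c_bound(2) by (intro mult_left_mono)
      with inner_c_L2(2)[OF \<phi>1(2)] have "n2 (\<lambda>x. grad \<phi> x \<bullet> c x) \<le> M * (n2 ?g + 1)" by linarith
      then show "n2 (\<lambda>x. grad \<phi> x \<bullet> c x) * n2 (\<lambda>x. u x - \<phi> x) \<le> (M * (n2 ?g + 1)) * d"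
        using \<phi>(2) by (intro mult_mono) (auto simp: c_bound(2) L2_norm_nonneg)
    qed
    finally show ?thesis by (simp add: K_def algebra_simps)
  qed
  have "K \<ge> 0" by (simp add: K_def c_bound(2) L2_norm_nonneg)
  have "\<bar>ip (\<lambda>x. ?g x \<bullet> c x) u\<bar> \<le> 0 + e" if e: "e > 0" for e
  proof -
    define d where "d = min 1 (e / (K + 1))"
    have "d * K \<le> e / (K + 1) * K" using \<open>K \<ge> 0\<close> by (intro mult_right_mono) (auto simp: d_def)
    also have "\<dots> \<le> e" using e \<open>K \<ge> 0\<close> by (simp add: field_simps)
    finally show ?thesis using bound[of d] e \<open>K \<ge> 0\<close> by (simp add: d_def)
  qed
  then have "\<bar>ip (\<lambda>x. ?g x \<bullet> c x) u\<bar> \<le> 0" by (rule field_le_epsilon)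
  then show ?thesis by simp
qed

lemma conv_diag:
  assumes \<xi>: "\<xi> \<in> V"
  shows "conv \<xi> \<xi> = 0"
proof -
  have comp: "convection \<Omega> c \<xi> x $ i = weak_gradient \<Omega> (\<lambda>y. \<xi> y $ i) x \<bullet> c x" for x i
    by (simp add: convection_def matrix_vector_mult_def inner_vec_def weak_jacobian_def)
  have "conv \<xi> \<xi> = (\<Sum>i\<in>UNIV. ip (\<lambda>x. weak_gradient \<Omega> (\<lambda>y. \<xi> y $ i) x \<bullet> c x) (\<lambda>x. \<xi> x $ i))"
    unfolding conv_def L2_inner_vec[OF convection_L2(1)[OF \<xi>] V_L2(1)[OF \<xi>]] comp ..
  also have "\<dots> = 0"
    using \<xi> by (intro sum.neutral ballI convection_H10_eq_0) (simp add: velocity_space_def)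
  finally show ?thesis .
qed

text \<open>Polarization of \<open>conv_diag\<close>. It makes the adjoint form the transpose of the
  state form.\<close>

lemma conv_skew:
  assumes \<xi>: "\<xi> \<in> V" and \<zeta>: "\<zeta> \<in> V"
  shows "conv \<xi> \<zeta> = - conv \<zeta> \<xi>"
proof -
  let ?w = "\<lambda>x. 1 *\<^sub>R \<xi> x + 1 *\<^sub>R \<zeta> x"
  have w: "?w \<in> V" by (rule V_lincomb[OF \<xi> \<zeta>])
  have "0 = conv ?w ?w" by (rule conv_diag[OF w, symmetric])
  also have "\<dots> = conv \<xi> \<zeta> + conv \<zeta> \<xi>"
    unfolding conv_lincomb_left[OF \<xi> \<zeta> w] conv_lincomb_right[OF \<xi> \<zeta> \<xi>]
      conv_lincomb_right[OF \<xi> \<zeta> \<zeta>] conv_diag[OF \<xi>] conv_diag[OF \<zeta>] by simp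
  finally show ?thesis by simp
qed

text \<open>The state form for \<open>\<sigma> = 1\<close>, the adjoint form for \<open>\<sigma> = -1\<close>.\<close>

definition form where "form \<sigma> \<xi> \<zeta> = V_inner \<xi> \<zeta> + \<sigma> * conv \<xi> \<zeta>"

lemma form_A_eq:
  assumes "\<xi> \<in> V" "\<zeta> \<in> V"
  shows "form_A \<Omega> \<epsilon> \<kappa> c \<xi> \<zeta> = form 1 \<xi> \<zeta>"
  using assms by (simp add: form_A_def form_def V_inner_def conv_def L2_inner_add_left L2_scaleR
      L2_inner_scaleR_left V_L2 convection_L2)

lemma form_C_eq:
  assumes "\<xi> \<in> V" "\<zeta> \<in> V"
  shows "form_C \<Omega> \<epsilon> \<kappa> c \<xi> \<zeta> = form (- 1) \<xi> \<zeta>"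
  using assms by (simp add: form_C_def form_def V_inner_def conv_def L2_inner_diff_left L2_scaleR
      L2_inner_scaleR_left V_L2 convection_L2)

lemma form_lincomb_left:
  assumes "\<xi> \<in> V" "\<zeta> \<in> V" "\<eta> \<in> V"
  shows "form \<sigma> (\<lambda>x. r *\<^sub>R \<xi> x + s *\<^sub>R \<zeta> x) \<eta> = r * form \<sigma> \<xi> \<eta> + s * form \<sigma> \<zeta> \<eta>"
  by (simp add: form_def V_inner_lincomb_left[OF assms] conv_lincomb_left[OF assms] algebra_simps)

lemma form_transpose: "\<xi> \<in> V \<Longrightarrow> \<zeta> \<in> V \<Longrightarrow> form \<sigma> \<xi> \<zeta> = form (- \<sigma>) \<zeta> \<xi>"
  using conv_skew[of \<xi> \<zeta>] by (simp add: form_def V_inner_commute)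

lemma form_lincomb_right:
  assumes "\<xi> \<in> V" "\<zeta> \<in> V" "\<eta> \<in> V"
  shows "form \<sigma> \<eta> (\<lambda>x. r *\<^sub>R \<xi> x + s *\<^sub>R \<zeta> x) = r * form \<sigma> \<eta> \<xi> + s * form \<sigma> \<eta> \<zeta>"
  using form_lincomb_left[OF assms, of "- \<sigma>" r s] assms
  by (simp add: form_transpose[of \<eta> _ \<sigma>] V_lincomb(1))

lemma form_diag: "\<xi> \<in> V \<Longrightarrow> form \<sigma> \<xi> \<xi> = (nV \<xi>)\<^sup>2"
  by (simp add: form_def conv_diag nV_power2)

text \<open>The second summand of C_ct is the convection bound: M / sqrt \<epsilon> for the gradient
  of the first argument and C for the L2 norm of the second.\<close>

lemma form_bound:
  assumes \<xi>: "\<xi> \<in> V" and \<zeta>: "\<zeta> \<in> V" and \<sigma>: "\<bar>\<sigma>\<bar> = 1"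
  shows "\<bar>form \<sigma> \<xi> \<zeta>\<bar> \<le> C\<^sub>c\<^sub>t * nV \<xi> * nV \<zeta>"
proof -
  have "\<bar>conv \<xi> \<zeta>\<bar> \<le> n2 (convection \<Omega> c \<xi>) * n2 \<zeta>"
    unfolding conv_def by (rule L2_Cauchy_Schwarz[OF convection_L2(1)[OF \<xi>] V_L2(1)[OF \<zeta>]])
  also have "\<dots> \<le> (M * (nV \<xi> / sqrt \<epsilon>)) * (C * nV \<zeta>)"
  proof (rule mult_mono)
    have "n2 (J \<xi>) \<le> nV \<xi> / sqrt \<epsilon>"
      using nV_jacobian_le[of \<xi>] eps by (simp add: field_simps)
    then have "M * n2 (J \<xi>) \<le> M * (nV \<xi> / sqrt \<epsilon>)"
      using c_bound(2) by (rule mult_left_mono)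
    then show "n2 (convection \<Omega> c \<xi>) \<le> M * (nV \<xi> / sqrt \<epsilon>)"
      using convection_L2(2)[OF \<xi>] by linarith
    show "n2 \<zeta> \<le> C * nV \<zeta>" by (rule V_embedding[OF \<zeta>])
  qed (use c_bound(2) nV_nonneg eps L2_norm_nonneg in auto)
  finally have "\<bar>conv \<xi> \<zeta>\<bar> \<le> C / sqrt \<epsilon> * M * nV \<xi> * nV \<zeta>" by (simp add: algebra_simps)
  moreover have "\<bar>form \<sigma> \<xi> \<zeta>\<bar> \<le> \<bar>V_inner \<xi> \<zeta>\<bar> + \<bar>conv \<xi> \<zeta>\<bar>"
    using \<sigma> abs_triangle_ineq[of "V_inner \<xi> \<zeta>" "\<sigma> * conv \<xi> \<zeta>"] by (simp add: form_def abs_mult)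
  ultimately show ?thesis
    using V_Cauchy_Schwarz[OF \<xi> \<zeta>] by (simp add: algebra_simps)
qed

text \<open>Only the test with \<open>e\<close> itself enters, so the bound serves true errors and
  Galerkin functions alike.\<close>

lemma energy_estimate:
  assumes e: "e \<in> V" and g: "g \<in> L2 \<Omega>" and eq: "form \<sigma> e e = ip g e"
  shows "nV e \<le> C * n2 g"
proof (cases "nV e = 0")
  case True
  then show ?thesis by (simp add: C_nonneg L2_norm_nonneg)
next
  case False
  then have pos: "nV e > 0" using nV_nonneg[of e] by simp
  have "nV e * nV e = ip g e" using eq form_diag[OF e, of \<sigma>] by (simp add: power2_eq_square)
  also have "\<dots> \<le> n2 g * n2 e" using L2_Cauchy_Schwarz[OF g V_L2(1)[OF e]] by simp
  also have "\<dots> \<le> n2 g * (C * nV e)" by (intro mult_left_mono V_embedding e L2_norm_nonneg)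
  finally have "nV e * nV e \<le> (C * n2 g) * nV e" by (simp add: mult_ac)
  then show ?thesis using pos by simp
qed

lemma ip_lincomb_right:
  assumes "f \<in> L2 \<Omega>" "g \<in> L2 \<Omega>" "h \<in> L2 \<Omega>"
  shows "ip h (\<lambda>x. r *\<^sub>R f x + s *\<^sub>R g x) = r * ip h f + s * ip h g"
  using L2_inner_lincomb_left[OF assms] by (simp add: L2_inner_commute[of \<Omega> h])

text \<open>Galerkin solutions in two-dimensional trial spaces replace the Lax-Milgram theorem.\<close>

lemma Galerkin:
  assumes e: "e1 \<in> V" "e2 \<in> V" and g: "g \<in> L2 \<Omega>"
  obtains \<alpha> \<beta> where
    "\<And>a b. form \<sigma> (\<lambda>x. \<alpha> *\<^sub>R e1 x + \<beta> *\<^sub>R e2 x) (\<lambda>x. a *\<^sub>R e1 x + b *\<^sub>R e2 x)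
      = ip g (\<lambda>x. a *\<^sub>R e1 x + b *\<^sub>R e2 x)"
proof -
  let ?z = "\<lambda>\<alpha> \<beta> x. \<alpha> *\<^sub>R e1 x + \<beta> *\<^sub>R e2 x"
  have z: "?z \<alpha> \<beta> \<in> V" for \<alpha> \<beta> by (rule V_lincomb[OF e])
  have ipz: "ip g (?z \<alpha> \<beta>) = \<alpha> * ip g e1 + \<beta> * ip g e2" for \<alpha> \<beta>
    by (rule ip_lincomb_right[OF V_L2(1)[OF e(1)] V_L2(1)[OF e(2)] g])
  have expand: "form \<sigma> (?z \<alpha> \<beta>) (?z a b) = a * (\<alpha> * form \<sigma> e1 e1 + \<beta> * form \<sigma> e2 e1)
      + b * (\<alpha> * form \<sigma> e1 e2 + \<beta> * form \<sigma> e2 e2)" for \<alpha> \<beta> a b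
    unfolding form_lincomb_right[OF e z] form_lincomb_left[OF e e(1)] form_lincomb_left[OF e e(2)] ..
  have quad: "\<alpha> * \<alpha> * form \<sigma> e1 e1 + \<alpha> * \<beta> * (form \<sigma> e1 e2 + form \<sigma> e2 e1)
      + \<beta> * \<beta> * form \<sigma> e2 e2 = (nV (?z \<alpha> \<beta>))\<^sup>2" for \<alpha> \<beta>
    using form_diag[OF z, of \<sigma> \<alpha> \<beta>] unfolding expand by (simp add: algebra_simps)
  obtain \<alpha> \<beta> where "\<alpha> * form \<sigma> e1 e1 + \<beta> * form \<sigma> e2 e1 = ip g e1"
      "\<alpha> * form \<sigma> e1 e2 + \<beta> * form \<sigma> e2 e2 = ip g e2"
  proof (rule solve_two_equations)
    fix \<alpha> \<beta>
    show "0 \<le> \<alpha> * \<alpha> * form \<sigma> e1 e1 + \<alpha> * \<beta> * (form \<sigma> e1 e2 + form \<sigma> e2 e1)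
      + \<beta> * \<beta> * form \<sigma> e2 e2" unfolding quad by simp
    assume "\<alpha> * \<alpha> * form \<sigma> e1 e1 + \<alpha> * \<beta> * (form \<sigma> e1 e2 + form \<sigma> e2 e1)
      + \<beta> * \<beta> * form \<sigma> e2 e2 = 0"
    \<comment> \<open>A combination with vanishing form has energy norm zero, hence L2 norm zero,
      and the right-hand side cannot see it. This is the compatibility that dependent trial
      functions require.\<close>
    then have "nV (?z \<alpha> \<beta>) = 0" unfolding quad by simp
    then have "n2 (?z \<alpha> \<beta>) = 0"
      using V_embedding[OF z, of \<alpha> \<beta>] L2_norm_nonneg[of \<Omega> "?z \<alpha> \<beta>"] by simp
    then have "ip g (?z \<alpha> \<beta>) = 0"
      using L2_Cauchy_Schwarz[OF g V_L2(1)[OF z], of \<alpha> \<beta>] by simp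
    then show "\<alpha> * ip g e1 + \<beta> * ip g e2 = 0" unfolding ipz .
  qed
  then show thesis by (intro that[of \<alpha> \<beta>]) (simp add: expand ipz)
qed

text \<open>The divergence-free velocities, that is, the kernel of the divergence form. Tested with
  them, the equations lose their pressure terms.\<close>

definition Z where "Z = {\<xi> \<in> V. \<forall>\<phi>\<in>pressure_space \<Omega>. form_B \<Omega> \<xi> \<phi> = 0}"

lemma Z_V: "\<xi> \<in> Z \<Longrightarrow> \<xi> \<in> V"
  by (simp add: Z_def)

lemma Z_lincomb: "\<xi> \<in> Z \<Longrightarrow> \<zeta> \<in> Z \<Longrightarrow> (\<lambda>x. r *\<^sub>R \<xi> x + s *\<^sub>R \<zeta> x) \<in> Z"
  using V_lincomb(1) form_B_lincomb_left[OF open_\<Omega>] by (auto simp: Z_def pressure_space_def)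

text \<open>Here \<open>e\<close> is the state response to \<open>e\<^sub>u\<close> and \<open>W\<close> the adjoint response to \<open>r - e\<close>. The
  response \<open>z\<close> to \<open>d\<close> is needed only against \<open>e\<close> and \<open>W\<close>.\<close>

lemma adjoint_duality_estimate:
  assumes e: "e \<in> Z" and W: "W \<in> Z" and r: "r \<in> V" and eu: "e\<^sub>u \<in> L2 \<Omega>" and d: "d \<in> L2 \<Omega>"
    and e_eq: "\<And>\<xi>. \<xi> \<in> Z \<Longrightarrow> form 1 e \<xi> = ip e\<^sub>u \<xi>"
    and W_eq: "\<And>\<xi>. \<xi> \<in> Z \<Longrightarrow> form (- 1) W \<xi> = ip (\<lambda>x. r x - e x) \<xi>"
  shows "ip (\<lambda>x. e\<^sub>u x - d x) W \<le> C ^ 3 * (nV r + C * n2 d) * n2 (\<lambda>x. e\<^sub>u x - d x)"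
proof -
  note eV = Z_V[OF e] and WV = Z_V[OF W]
  let ?span = "\<lambda>a b x. a *\<^sub>R e x + b *\<^sub>R W x"
  let ?\<delta> = "\<lambda>x. e\<^sub>u x - d x"
  have \<delta>: "?\<delta> \<in> L2 \<Omega>" by (rule L2_diff[OF eu d])
  have span: "?span a b \<in> Z" for a b by (rule Z_lincomb[OF e W])
  \<comment> \<open>In the application \<open>z\<close> stands for the state driven by the projected
    control, measured relative to the auxiliary state.\<close>
  obtain \<alpha> \<beta> where z_eq: "\<And>a b. form 1 (?span \<alpha> \<beta>) (?span a b) = ip d (?span a b)"
    using Galerkin[OF eV WV d, of 1] by blast
  define z where "z = ?span \<alpha> \<beta>"
  have z: "z \<in> V" unfolding z_def by (rule Z_V[OF span])
  define g where "g = (\<lambda>x. 1 *\<^sub>R r x + (- 1) *\<^sub>R z x)"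
  have gV: "g \<in> V" unfolding g_def by (rule V_lincomb[OF r z])
  \<comment> \<open>\<open>W2\<close> is the adjoint response to r - z and stands for the auxiliary
    adjoint minus the adjoint of the state driven by the projected control.\<close>
  obtain \<alpha>' \<beta>' where W2_eq: "\<And>a b. form (- 1) (?span \<alpha>' \<beta>') (?span a b) = ip g (?span a b)"
    using Galerkin[OF eV WV V_L2(1)[OF gV], of "- 1"] by blast
  define W2 where "W2 = ?span \<alpha>' \<beta>'"
  have W2: "W2 \<in> Z" "W2 \<in> V" unfolding W2_def using span Z_V by auto
  define h where "h = (\<lambda>x. 1 *\<^sub>R e x + (- 1) *\<^sub>R z x)"
  have hV: "h \<in> V" unfolding h_def by (rule V_lincomb[OF eV z])
  \<comment> \<open>Since \<open>h\<close> lies in the span itself, the equations of both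
    \<open>W\<close> and \<open>W2\<close> can be tested with it.\<close>
  have h_span: "h = ?span (1 - \<alpha>) (- \<beta>)"
    by (auto simp: h_def z_def algebra_simps)
  have test: "form 1 h (?span a b) = ip ?\<delta> (?span a b)" for a b
  proof -
    have "form 1 h (?span a b) = ip e\<^sub>u (?span a b) - ip d (?span a b)"
      unfolding h_def form_lincomb_left[OF eV z Z_V[OF span]] e_eq[OF span]
      by (simp add: z_def z_eq)
    then show ?thesis
      using L2_inner_diff_left[OF eu d V_L2(1)[OF Z_V[OF span]], of a b] by simp
  qed
  have W_span: "W = ?span 0 1" by simp
  have "ip ?\<delta> W = form 1 h W" using test[of 0 1] by simp
  also have "\<dots> = form (- 1) W h" using form_transpose[OF hV WV, of 1] by simp
  also have "\<dots> = ip (\<lambda>x. r x - e x) h" using W_eq[OF span, of "1 - \<alpha>" "- \<beta>"] by (simp add: h_span)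
  also have "\<dots> = ip (\<lambda>x. g x - h x) h" by (simp add: g_def h_def)
  also have "\<dots> = ip g h - ip h h"
    using V_L2(1) gV hV by (intro L2_inner_diff_left) auto
  \<comment> \<open>The dropped term - ip h h is the sign produced by duality; what remains is a
    pairing with \<open>W2\<close> alone.\<close>
  also have "\<dots> \<le> ip g h" by (simp flip: L2_norm_power2)
  also have "\<dots> = form (- 1) W2 h" using W2_eq[of "1 - \<alpha>" "- \<beta>"] by (simp add: h_span W2_def)
  also have "\<dots> = form 1 h W2" using form_transpose[OF hV W2(2), of 1] by simp
  also have "\<dots> = ip ?\<delta> W2" using test by (simp add: W2_def)
  also have "\<dots> \<le> n2 ?\<delta> * n2 W2" using L2_Cauchy_Schwarz[OF \<delta> V_L2(1)[OF W2(2)]] by simp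
  also have "\<dots> \<le> n2 ?\<delta> * (C ^ 3 * (nV r + C * n2 d))"
  \<comment> \<open>The cube comes from embedding \<open>g\<close>, the energy bound for
    \<open>W2\<close> and embedding \<open>W2\<close>; the factor at n2 d is the energy bound for
    \<open>z\<close>.\<close>
  proof (intro mult_left_mono L2_norm_nonneg)
    have "nV z \<le> C * n2 d"
      by (rule energy_estimate[OF z d, of 1]) (use z_eq[of \<alpha> \<beta>] in \<open>simp add: z_def\<close>)
    then have "nV g \<le> nV r + C * n2 d" using nV_triangle[OF r z] by (simp add: g_def)
    then have "n2 g \<le> C * (nV r + C * n2 d)"
      using V_embedding[OF gV] mult_left_mono[OF _ C_nonneg] by (meson order_trans)
    moreover have "nV W2 \<le> C * n2 g"
      by (rule energy_estimate[OF W2(2) V_L2(1)[OF gV], of "- 1"])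
        (use W2_eq[of \<alpha>' \<beta>'] in \<open>simp add: W2_def\<close>)
    ultimately have "nV W2 \<le> C * (C * (nV r + C * n2 d))"
      using mult_left_mono[OF _ C_nonneg] by (meson order_trans)
    then have "n2 W2 \<le> C * (C * (C * (nV r + C * n2 d)))"
      using V_embedding[OF W2(2)] mult_left_mono[OF _ C_nonneg] by (meson order_trans)
    then show "n2 W2 \<le> C ^ 3 * (nV r + C * n2 d)" by (simp add: power3_eq_cube mult.assoc)
  qed
  finally show ?thesis by (simp add: mult_ac)
qed

text \<open>The momentum residual is at most (1 + C_ct) (C n2 g) times the energy norm of the test
  function: C_ct from the form, 1 from the data. Conversion to the gradient norm and division by
  \<beta> complete the constant; absolute values in \<open>eq\<close> cover both signs of the
  pressure term.\<close>

lemma pressure_estimate: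
  assumes \<beta>: "inf_sup_constant \<Omega> \<beta>" and e: "e \<in> V" and g: "g \<in> L2 \<Omega>" and r: "r \<in> pressure_space \<Omega>"
    and energy: "nV e \<le> C * n2 g" and \<sigma>: "\<bar>\<sigma>\<bar> = 1"
    and eq: "\<And>\<xi>. \<xi> \<in> V \<Longrightarrow> \<bar>form_B \<Omega> \<xi> r\<bar> = \<bar>form \<sigma> e \<xi> - ip g \<xi>\<bar>"
  shows "n2 r \<le> sqrt (\<epsilon> + \<kappa> * C\<^sub>P\<^sup>2) / \<beta> * (1 + C\<^sub>c\<^sub>t) * (C * n2 g)"
proof -
  let ?D = "(1 + C\<^sub>c\<^sub>t) * (C * n2 g)"
  have D: "0 \<le> ?D" using C\<^sub>c\<^sub>t_nonneg C_nonneg L2_norm_nonneg[of \<Omega> g] by simp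
  have "\<beta> * n2 r \<le> ?D * sqrt (\<epsilon> + \<kappa> * C\<^sub>P\<^sup>2)"
  proof (rule inf_sup_bound[OF \<beta> r])
    show "0 \<le> ?D * sqrt (\<epsilon> + \<kappa> * C\<^sub>P\<^sup>2)" using D eps kap by simp
    fix \<xi> assume \<xi>: "\<xi> \<in> V"
    have "form_B \<Omega> \<xi> r \<le> \<bar>form \<sigma> e \<xi>\<bar> + \<bar>ip g \<xi>\<bar>"
      using eq[OF \<xi>] by linarith
    also have "\<bar>form \<sigma> e \<xi>\<bar> \<le> C\<^sub>c\<^sub>t * (C * n2 g) * nV \<xi>"
      using form_bound[OF e \<xi> \<sigma>] mult_right_mono[OF mult_left_mono[OF energy C\<^sub>c\<^sub>t_nonneg] nV_nonneg[of \<xi>]]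
      by linarith
    also have "\<bar>ip g \<xi>\<bar> \<le> n2 g * (C * nV \<xi>)"
      using L2_Cauchy_Schwarz[OF g V_L2(1)[OF \<xi>]]
        mult_left_mono[OF V_embedding[OF \<xi>] L2_norm_nonneg[of \<Omega> g]] by linarith
    also have "C\<^sub>c\<^sub>t * (C * n2 g) * nV \<xi> + n2 g * (C * nV \<xi>) = ?D * nV \<xi>" by (simp add: algebra_simps)
    also have "\<dots> \<le> ?D * (sqrt (\<epsilon> + \<kappa> * C\<^sub>P\<^sup>2) * n2 (J \<xi>))"
      by (intro mult_left_mono nV_le_jacobian \<xi> D)
    finally show "form_B \<Omega> \<xi> r \<le> ?D * sqrt (\<epsilon> + \<kappa> * C\<^sub>P\<^sup>2) * n2 (J \<xi>)" by (simp add: mult.assoc)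
  qed
  moreover have "0 < \<beta>" using \<beta> by (simp add: inf_sup_constant_def)
  ultimately show ?thesis by (simp add: field_simps)
qed

end

section \<open>Mesh sums, control and stability estimates\<close>

lemma negligible_convex_lowdim:
  fixes S :: "'a::euclidean_space set"
  assumes "convex S" "aff_dim S < int DIM('a)"
  shows "negligible S"
proof -
  have "interior S = {}"
    using assms(2) aff_dim_nonempty_interior by (metis less_irrefl)
  then show ?thesis using assms(1) by (simp add: negligible_convex_interior)
qed

lemma negligible_frontier_polytopal:
  fixes \<Omega> :: "(real^'n) set"
  assumes "polytopal \<Omega>"
  shows "negligible (frontier \<Omega>)"
proof -
  obtain \<F> where F: "finite \<F>" "\<And>F. F \<in> \<F> \<Longrightarrow> polytope F \<and> aff_dim F = int CARD('n) - 1"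
    "frontier \<Omega> = \<Union>\<F>"
    using assms unfolding polytopal_def by blast
  have "negligible F" if "F \<in> \<F>" for F
    using F(2)[OF that] by (intro negligible_convex_lowdim) (auto simp: polytope_imp_convex)
  then show ?thesis unfolding F(3) by (intro negligible_Union F(1))
qed

text \<open>The integral \<open>has_integral\<close> adds over finite unions with negligible
  overlaps. As the cells cover the closure, the null boundary has to be adjoined to
  \<Omega>.\<close>

lemma conforming_partition_mesh_integral:
  fixes \<Omega> :: "(real^'n) set" and h :: "real^'n \<Rightarrow> real"
  assumes \<Omega>: "open \<Omega>" "polytopal \<Omega>" and T: "conforming_partition \<Omega> \<T>"
    and h: "integrable (lebesgue_on \<Omega>) h" "\<And>x. 0 \<le> h x"
  shows "(\<Sum>K\<in>\<T>. \<integral>x. h x \<partial>lebesgue_on K) = (\<integral>x. h x \<partial>lebesgue_on \<Omega>)"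
proof -
  note \<Omega>m = open_sets_lebesgue[OF \<Omega>(1)]
  have simplex: "int CARD('n) simplex K" if "K \<in> \<T>" for K
    using T that by (auto simp: conforming_partition_def)
  have fin: "finite \<T>" and face: "\<And>K K'. K \<in> \<T> \<Longrightarrow> K' \<in> \<T> \<Longrightarrow> K \<inter> K' face_of K"
    and cover: "\<Union>\<T> = closure \<Omega>"
    using T by (auto simp: conforming_partition_def triangulation_def)
  have neg: "negligible (closure \<Omega> - \<Omega>)"
    using negligible_frontier_polytopal[OF \<Omega>(2)] \<Omega>(1) by (simp add: frontier_def interior_open)
  have habs: "h absolutely_integrable_on \<Omega>"
    using h(1) \<Omega>m by (simp add: absolutely_integrable_on_iff_integrable)
  have K: "(h has_integral (\<integral>x. h x \<partial>lebesgue_on K)) K" if "K \<in> \<T>" for K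
  proof -
    have Km: "K \<in> sets lebesgue" using compact_simplex[OF simplex[OF that]] by (rule compact_sets_lebesgue)
    have "h absolutely_integrable_on (K \<inter> \<Omega>)"
      using set_integrable_subset[OF habs, of "K \<inter> \<Omega>"] Km \<Omega>m by auto
    \<comment> \<open>Integrability of \<open>h\<close> is given on \<Omega> only, but a cell leaves
      \<Omega> only within the null boundary.\<close>
    moreover have "K - \<Omega> \<subseteq> closure \<Omega> - \<Omega>" using that cover by auto
    then have "negligible (K - \<Omega>)" by (rule negligible_subset[OF neg])
    then have "negligible {x \<in> K \<inter> \<Omega> - K. h x \<noteq> 0}" "negligible {x \<in> K - K \<inter> \<Omega>. h x \<noteq> 0}"
      by (auto intro: negligible_subset)
    ultimately have "h absolutely_integrable_on K"
      by (simp add: absolutely_integrable_spike_set_eq[of "K \<inter> \<Omega>" K h])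
    then have "integrable (lebesgue_on K) h"
      using Km by (simp add: absolutely_integrable_on_iff_integrable)
    then show ?thesis using Km by (rule has_integral_integral_lebesgue_on)
  qed
  have pair: "pairwise (\<lambda>K K'. negligible (K \<inter> K')) \<T>"
  proof (rule pairwiseI)
    fix K K' assume K: "K \<in> \<T>" "K' \<in> \<T>" "K \<noteq> K'"
    have conv: "convex (K \<inter> K')"
      using simplex K by (intro convex_Int convex_simplex) auto
    \<comment> \<open>The intersection is a face of both cells and differs from at least one, so it
      is a proper face there and has lower dimension.\<close>
    have "K \<inter> K' \<noteq> K \<or> K \<inter> K' \<noteq> K'" using K(3) by auto
    then have "aff_dim (K \<inter> K') < int DIM(real^'n)"
    proof
      assume "K \<inter> K' \<noteq> K"
      with face_of_aff_dim_lt[OF convex_simplex[OF simplex[OF K(1)]] face[OF K(1,2)]]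
      show ?thesis using aff_dim_simplex[OF simplex[OF K(1)]] by simp
    next
      assume "K \<inter> K' \<noteq> K'"
      with face_of_aff_dim_lt[OF convex_simplex[OF simplex[OF K(2)]] face[OF K(2,1)]]
      show ?thesis using aff_dim_simplex[OF simplex[OF K(2)]] by (simp add: Int_commute)
    qed
    then show "negligible (K \<inter> K')" by (rule negligible_convex_lowdim[OF conv])
  qed
  have "(h has_integral (\<Sum>K\<in>\<T>. \<integral>x. h x \<partial>lebesgue_on K)) (closure \<Omega>)"
    using has_integral_Union[OF fin K pair] by (simp add: cover)
  moreover have "(h has_integral (\<integral>x. h x \<partial>lebesgue_on \<Omega>)) (closure \<Omega>)"
  proof -
    have "(h has_integral (\<integral>x. h x \<partial>lebesgue_on \<Omega>)) \<Omega>"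
      using h(1) \<Omega>m by (rule has_integral_integral_lebesgue_on)
    moreover have "negligible {x \<in> \<Omega> - closure \<Omega>. h x \<noteq> 0}" "negligible {x \<in> closure \<Omega> - \<Omega>. h x \<noteq> 0}"
      using neg closure_subset[of \<Omega>] by (auto intro: negligible_subset)
    ultimately show ?thesis by (simp add: has_integral_spike_set_eq[of \<Omega> "closure \<Omega>" h])
  qed
  ultimately show ?thesis by (rule has_integral_unique)
qed

lemma mesh_L2_norm:
  fixes \<Omega> :: "(real^'n) set"
  assumes "open \<Omega>" "polytopal \<Omega>" "conforming_partition \<Omega> \<T>" "f \<in> L2 \<Omega>"
  shows "(\<Sum>K\<in>\<T>. (L2_norm K f)\<^sup>2) = (L2_norm \<Omega> f)\<^sup>2"
  using conforming_partition_mesh_integral[OF assms(1-3) L2_integrable[OF assms(4)]]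
  by (simp add: L2_norm_def)

lemma mesh_V_norm:
  fixes \<Omega> :: "(real^'n) set"
  assumes \<Omega>: "open \<Omega>" "polytopal \<Omega>" "conforming_partition \<Omega> \<T>" and \<xi>: "\<xi> \<in> velocity_space \<Omega>"
    and pos: "0 \<le> \<epsilon>" "0 \<le> \<kappa>"
  shows "(\<Sum>K\<in>\<T>. (V_norm \<Omega> \<epsilon> \<kappa> K \<xi>)\<^sup>2) = (V_norm \<Omega> \<epsilon> \<kappa> \<Omega> \<xi>)\<^sup>2"
  using mesh_L2_norm[OF \<Omega> velocity_space_L2(1)[OF \<Omega>(1) \<xi>]]
    mesh_L2_norm[OF \<Omega> velocity_space_L2(2)[OF \<Omega>(1) \<xi>]] pos
  by (simp add: V_norm_def sum.distrib flip: sum_distrib_left)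

section \<open>The projected control and the arithmetic of the constants\<close>

lemma box_projection_admissible:
  fixes \<Omega> :: "(real^'n) set" and a b :: "real^'n"
  assumes \<Omega>: "open \<Omega>" "bounded \<Omega>" and ab: "\<And>i. a $ i \<le> b $ i" and w: "w \<in> L2 \<Omega>"
  shows "box_projection a b w \<in> admissible_controls \<Omega> a b"
proof -
  have bounds: "a $ i \<le> box_projection a b w x $ i" "box_projection a b w x $ i \<le> b $ i" for x i
    using ab by (auto simp: box_projection_def)
  have "finite_measure (lebesgue_on \<Omega>)"
    using \<Omega> by (simp add: finite_measure_lebesgue_on bounded_set_imp_lmeasurable open_sets_lebesgue)
  then have one: "(\<lambda>_. 1::real) \<in> L2 \<Omega>" by (simp add: L2_def finite_measure.integrable_const)
  have "box_projection a b w \<in> L2 \<Omega>"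
  proof (subst L2_vec_iff, rule allI, rule L2_bounded_mult[OF one])
    fix i
    show "(\<lambda>x. box_projection a b w x $ i) \<in> borel_measurable (lebesgue_on \<Omega>)"
      using L2_measurable[OF L2_component[OF w, of i]] by (simp add: box_projection_def)
    have "\<bar>box_projection a b w x $ i\<bar> \<le> \<bar>a $ i\<bar> + \<bar>b $ i\<bar>" for x
      using bounds[where x = x and i = i] by linarith
    then show "AE x in lebesgue_on \<Omega>. norm (box_projection a b w x $ i) \<le> (\<bar>a $ i\<bar> + \<bar>b $ i\<bar>) * norm (1::real)"
      by simp
  qed
  then show ?thesis using bounds by (simp add: admissible_controls_def)
qed

text \<open>The inequality holds pointwise in each component. If m is the projection of t = - w /
  \<theta> onto the interval, then w + \<theta> m = \<theta> (m - t), and m - t and v - m never have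
  opposite signs for v in the interval.\<close>

lemma box_projection_variational_inequality:
  fixes a b :: "real^'n"
  assumes \<theta>: "0 < \<theta>" and v: "AE x in lebesgue_on \<Omega>. \<forall>i. a $ i \<le> v x $ i \<and> v x $ i \<le> b $ i"
  shows "0 \<le> L2_inner \<Omega> (\<lambda>x. w x + \<theta> *\<^sub>R box_projection a b (\<lambda>z. (- 1 / \<theta>) *\<^sub>R w z) x)
      (\<lambda>x. v x - box_projection a b (\<lambda>z. (- 1 / \<theta>) *\<^sub>R w z) x)"
  unfolding L2_inner_def
proof (rule integral_nonneg_AE)
  show "AE x in lebesgue_on \<Omega>. 0 \<le> (w x + \<theta> *\<^sub>R box_projection a b (\<lambda>z. (- 1 / \<theta>) *\<^sub>R w z) x)
      \<bullet> (v x - box_projection a b (\<lambda>z. (- 1 / \<theta>) *\<^sub>R w z) x)"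
    using v
  proof eventually_elim
    case (elim x)
    have "0 \<le> (w x $ i + \<theta> * m) * (v x $ i - m)"
      if m: "m = min (b $ i) (max (a $ i) (- (w x $ i / \<theta>)))" for i m
    proof -
      define t where "t = - (w x $ i / \<theta>)"
      have wt: "w x $ i + \<theta> * m = \<theta> * (m - t)" using \<theta> by (simp add: t_def algebra_simps)
      have "0 \<le> (m - t) * (v x $ i - m)"
        using elim[rule_format, of i] m unfolding t_def[symmetric]
        by (auto simp: min_def max_def zero_le_mult_iff split: if_splits)
      then show ?thesis unfolding wt using \<theta> by (simp add: mult.assoc)
    qed
    then show ?case
      unfolding inner_vec_def by (intro sum_nonneg) (simp add: box_projection_def)
  qed
qed

text \<open>Pure arithmetic. \<open>Y\<close>, \<open>P\<close>, \<open>W\<close>, \<open>Q\<close>,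
  \<open>U\<close> are the errors, \<open>\<eta>y\<close> to \<open>\<eta>q\<close> the distances of
  the discrete to the auxiliary solutions, \<open>D\<close> and \<open>\<eta>u\<close> the distances
  of the projected control to the optimal and to the discrete one, and \<open>s\<close> is C_is (1 +
  C_ct).\<close>

lemma error_constants:
  fixes Y P W Q U D \<eta>y \<eta>p \<eta>w \<eta>q \<eta>u C s \<rho> \<theta> :: real
  assumes pos: "0 \<le> C" "0 < \<theta>" "0 \<le> \<rho>" "0 \<le> s"
    and nonneg: "0 \<le> Y" "0 \<le> P" "0 \<le> W" "0 \<le> Q" "0 \<le> U" "0 \<le> D"
    and Y: "Y \<le> \<eta>y + C * U" and P: "P \<le> \<eta>p + s * C * U"
    and W: "W \<le> \<eta>w + C\<^sup>2 * Y" and Q: "Q \<le> \<eta>q + s * C\<^sup>2 * Y"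
    and U: "U \<le> D + \<eta>u" and D: "\<theta> * D \<le> C * (\<eta>w + C\<^sup>2 * \<eta>y + C ^ 3 * \<eta>u)"
    and \<mu>: "\<mu> = 4 / \<theta>\<^sup>2" and \<omega>: "\<omega> = s\<^sup>2"
  shows "Y\<^sup>2 + \<rho> * P\<^sup>2 + W\<^sup>2 + \<rho> * Q\<^sup>2 + U\<^sup>2 \<le>
      (2 + 2 * \<mu> * C^6 + 4 * (1 + \<rho> * \<omega>) * (C^4 + \<mu> * C^8 + 2 * \<mu> * C^12)) * \<eta>y\<^sup>2 + 2 * \<rho> * \<eta>p\<^sup>2
      + (2 + \<mu> * C^2 + 2 * \<mu> * (1 + \<rho> * \<omega>) * (C^4 + 2 * C^8)) * \<eta>w\<^sup>2 + 2 * \<rho> * \<eta>q\<^sup>2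
      + (2 + 2 * \<mu> * C^8 + 4 * (1 + \<rho> * \<omega>) * (C^2 + 2 * C^6 + \<mu> * C^10 + 2 * \<mu> * C^14)) * \<eta>u\<^sup>2"
proof -
  have sq: "X\<^sup>2 \<le> 2 * A\<^sup>2 + 2 * B\<^sup>2" if "X \<le> A + B" "0 \<le> X" for X A B :: real
  proof -
    have "X\<^sup>2 \<le> (A + B)\<^sup>2" using that by (intro power_mono) auto
    also have "\<dots> \<le> 2 * A\<^sup>2 + 2 * B\<^sup>2" using sum_squares_bound[of A B] by (simp add: power2_sum)
    finally show ?thesis .
  qed
  define T where "T = 1 + \<rho> * \<omega>"
  have T: "0 \<le> T" using pos by (simp add: T_def \<omega>)
  have Y2: "Y\<^sup>2 \<le> 2 * \<eta>y\<^sup>2 + 2 * (C^2 * U\<^sup>2)"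
    using sq[OF Y nonneg(1)] by (simp add: power_mult_distrib)
  have P2: "\<rho> * P\<^sup>2 \<le> \<rho> * (2 * \<eta>p\<^sup>2 + 2 * (\<omega> * C^2 * U\<^sup>2))"
    using sq[OF P nonneg(2)] pos by (intro mult_left_mono) (simp_all add: power_mult_distrib \<omega>)
  have W2: "W\<^sup>2 \<le> 2 * \<eta>w\<^sup>2 + 2 * (C^4 * Y\<^sup>2)"
    using sq[OF W nonneg(3)] by (simp add: power_mult_distrib)
  have Q2: "\<rho> * Q\<^sup>2 \<le> \<rho> * (2 * \<eta>q\<^sup>2 + 2 * (\<omega> * C^4 * Y\<^sup>2))"
    using sq[OF Q nonneg(4)] pos by (intro mult_left_mono) (simp_all add: power_mult_distrib \<omega>)
  have U2: "U\<^sup>2 \<le> 2 * D\<^sup>2 + 2 * \<eta>u\<^sup>2" by (rule sq[OF U nonneg(5)])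
  have D2: "D\<^sup>2 \<le> \<mu> * (C^2 * \<eta>w\<^sup>2 / 2 + C^6 * \<eta>y\<^sup>2 + C^8 * \<eta>u\<^sup>2)"
  proof -
    \<comment> \<open>The adjoint term is split off first and carries the factor 2, the other two
      carry 4; normalizing by \<mu> = 4 / \<theta>^2 leaves the 1/2 at
      \<open>\<eta>w\<close>.\<close>
    have "(\<theta> * D)\<^sup>2 \<le> 2 * (C * \<eta>w)\<^sup>2 + 2 * (C ^ 3 * \<eta>y + C ^ 4 * \<eta>u)\<^sup>2"
      using D pos nonneg by (intro sq) (simp_all add: algebra_simps power_def numeral_eq_Suc)
    also have "(C ^ 3 * \<eta>y + C ^ 4 * \<eta>u)\<^sup>2 \<le> 2 * (C ^ 3 * \<eta>y)\<^sup>2 + 2 * (C ^ 4 * \<eta>u)\<^sup>2"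
      using sum_squares_bound[of "C ^ 3 * \<eta>y" "C ^ 4 * \<eta>u"] by (simp add: power2_sum)
    finally have "\<theta>\<^sup>2 * D\<^sup>2 \<le> 4 * (C^2 * \<eta>w\<^sup>2 / 2 + C^6 * \<eta>y\<^sup>2 + C^8 * \<eta>u\<^sup>2)"
      by (simp add: power_mult_distrib flip: power_mult)
    then show ?thesis using pos by (simp add: \<mu> field_simps)
  qed
  \<comment> \<open>\<open>k\<close> collects the weight of U^2: 1 for itself, 2 T C^2 from the
    state and its pressure, 4 T C^6 from the adjoint and its pressure through
    \<open>Y\<close>.\<close>
  define k where "k = 1 + 2 * T * C^2 + 4 * T * C^6"
  have k: "0 \<le> k" using T pos by (simp add: k_def)
  have "Y\<^sup>2 + \<rho> * P\<^sup>2 + W\<^sup>2 + \<rho> * Q\<^sup>2 + U\<^sup>2 \<le>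
      2 * \<eta>y\<^sup>2 + 2 * \<rho> * \<eta>p\<^sup>2 + 2 * \<eta>w\<^sup>2 + 2 * \<rho> * \<eta>q\<^sup>2 + (1 + 2 * T * C^2) * U\<^sup>2 + 2 * T * C^4 * Y\<^sup>2"
    using Y2 P2 W2 Q2 by (simp add: T_def algebra_simps)
  also have "2 * T * C^4 * Y\<^sup>2 \<le> 2 * T * C^4 * (2 * \<eta>y\<^sup>2 + 2 * (C^2 * U\<^sup>2))"
    using Y2 T by (intro mult_left_mono) auto
  also have "2 * \<eta>y\<^sup>2 + 2 * \<rho> * \<eta>p\<^sup>2 + 2 * \<eta>w\<^sup>2 + 2 * \<rho> * \<eta>q\<^sup>2 + (1 + 2 * T * C^2) * U\<^sup>2
      + 2 * T * C^4 * (2 * \<eta>y\<^sup>2 + 2 * (C^2 * U\<^sup>2)) =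
      (2 + 4 * T * C^4) * \<eta>y\<^sup>2 + 2 * \<rho> * \<eta>p\<^sup>2 + 2 * \<eta>w\<^sup>2 + 2 * \<rho> * \<eta>q\<^sup>2 + k * U\<^sup>2"
    by (simp add: k_def algebra_simps numeral_eq_Suc)
  also have "k * U\<^sup>2 \<le> k * (2 * (\<mu> * (C^2 * \<eta>w\<^sup>2 / 2 + C^6 * \<eta>y\<^sup>2 + C^8 * \<eta>u\<^sup>2)) + 2 * \<eta>u\<^sup>2)"
    using U2 D2 k by (intro mult_left_mono) auto
  also have "(2 + 4 * T * C^4) * \<eta>y\<^sup>2 + 2 * \<rho> * \<eta>p\<^sup>2 + 2 * \<eta>w\<^sup>2 + 2 * \<rho> * \<eta>q\<^sup>2
      + k * (2 * (\<mu> * (C^2 * \<eta>w\<^sup>2 / 2 + C^6 * \<eta>y\<^sup>2 + C^8 * \<eta>u\<^sup>2)) + 2 * \<eta>u\<^sup>2) =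
      (2 + 2 * \<mu> * C^6 + 4 * T * (C^4 + \<mu> * C^8 + 2 * \<mu> * C^12)) * \<eta>y\<^sup>2 + 2 * \<rho> * \<eta>p\<^sup>2
      + (2 + \<mu> * C^2 + 2 * \<mu> * T * (C^4 + 2 * C^8)) * \<eta>w\<^sup>2 + 2 * \<rho> * \<eta>q\<^sup>2
      + (2 + 2 * \<mu> * C^8 + 4 * T * (C^2 + 2 * C^6 + \<mu> * C^10 + 2 * \<mu> * C^14)) * \<eta>u\<^sup>2"
    unfolding k_def by algebra
  finally show ?thesis by (simp add: T_def)
qed

section \<open>Stability of the state and adjoint systems\<close>

context oseen
begin

lemma V_diff: "\<xi> \<in> V \<Longrightarrow> \<zeta> \<in> V \<Longrightarrow> (\<lambda>x. \<xi> x - \<zeta> x) \<in> V"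
  using V_lincomb(1)[of \<xi> \<zeta> 1 "- 1"] by simp

lemma nV_minus_commute:
  assumes \<xi>: "\<xi> \<in> V" and \<zeta>: "\<zeta> \<in> V"
  shows "nV (\<lambda>x. \<xi> x - \<zeta> x) = nV (\<lambda>x. \<zeta> x - \<xi> x)"
proof -
  have "(nV (\<lambda>x. \<xi> x - \<zeta> x))\<^sup>2 = (nV (\<lambda>x. \<zeta> x - \<xi> x))\<^sup>2"
    by (simp add: nV_diff_power2 \<xi> \<zeta> V_inner_commute[of \<xi> \<zeta>])
  then show ?thesis by (simp add: nV_nonneg)
qed

lemma form_diff_left:
  assumes "\<xi> \<in> V" "\<zeta> \<in> V" "\<eta> \<in> V"
  shows "form \<sigma> (\<lambda>x. \<xi> x - \<zeta> x) \<eta> = form \<sigma> \<xi> \<eta> - form \<sigma> \<zeta> \<eta>"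
  using form_lincomb_left[OF assms, of \<sigma> 1 "- 1"] by simp

lemma pressure_space_L2: "\<phi> \<in> pressure_space \<Omega> \<Longrightarrow> \<phi> \<in> L2 \<Omega>"
  by (simp add: pressure_space_def)

text \<open>The sign \<sigma> covers both systems at once, since it switches convection and pressure
  together. The difference of two solutions is divergence-free, so its pressure drops out when it is
  tested with itself, and the inf-sup condition then recovers the pressure.\<close>

lemma Oseen_stability:
  assumes y: "y \<in> V" "y' \<in> V" and p: "p \<in> pressure_space \<Omega>" "p' \<in> pressure_space \<Omega>"
    and g: "g \<in> L2 \<Omega>" "g' \<in> L2 \<Omega>" and \<sigma>: "\<bar>\<sigma>\<bar> = 1"
    and eq: "\<And>\<xi>. \<xi> \<in> V \<Longrightarrow> form \<sigma> y \<xi> - \<sigma> * form_B \<Omega> \<xi> p = ip g \<xi>"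
      "\<And>\<xi>. \<xi> \<in> V \<Longrightarrow> form \<sigma> y' \<xi> - \<sigma> * form_B \<Omega> \<xi> p' = ip g' \<xi>"
    and div: "\<And>\<phi>. \<phi> \<in> pressure_space \<Omega> \<Longrightarrow> form_B \<Omega> y \<phi> = 0"
      "\<And>\<phi>. \<phi> \<in> pressure_space \<Omega> \<Longrightarrow> form_B \<Omega> y' \<phi> = 0"
  shows "(\<lambda>x. y x - y' x) \<in> Z"
    and "\<xi> \<in> Z \<Longrightarrow> form \<sigma> (\<lambda>x. y x - y' x) \<xi> = ip (\<lambda>x. g x - g' x) \<xi>"
    and "nV (\<lambda>x. y x - y' x) \<le> C * n2 (\<lambda>x. g x - g' x)"
    and "inf_sup_constant \<Omega> \<beta> \<Longrightarrow> n2 (\<lambda>x. p x - p' x)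
      \<le> sqrt (\<epsilon> + \<kappa> * C\<^sub>P\<^sup>2) / \<beta> * (1 + C\<^sub>c\<^sub>t) * (C * n2 (\<lambda>x. g x - g' x))"
proof -
  let ?e = "\<lambda>x. y x - y' x" and ?g = "\<lambda>x. g x - g' x" and ?r = "\<lambda>x. p x - p' x"
  have e: "?e \<in> V" by (rule V_diff[OF y])
  have gd: "?g \<in> L2 \<Omega>" by (rule L2_diff[OF g])
  have r: "?r \<in> pressure_space \<Omega>" by (rule pressure_space_diff[OF bounded_\<Omega> open_\<Omega> p])
  have diff: "form \<sigma> ?e \<xi> - \<sigma> * form_B \<Omega> \<xi> ?r = ip ?g \<xi>" if \<xi>: "\<xi> \<in> V" for \<xi>
    using eq(1)[OF \<xi>] eq(2)[OF \<xi>]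
    unfolding form_diff_left[OF y \<xi>] form_B_diff_right[OF open_\<Omega> \<xi> pressure_space_L2[OF p(1)]
        pressure_space_L2[OF p(2)]] L2_inner_diff_left[OF g V_L2(1)[OF \<xi>]]
    by (simp add: algebra_simps)
  have "y \<in> Z" "y' \<in> Z" using y div by (auto simp: Z_def)
  then show eZ: "?e \<in> Z" using Z_lincomb[of y y' 1 "- 1"] by simp
  show eqZ: "form \<sigma> ?e \<xi> = ip ?g \<xi>" if \<xi>: "\<xi> \<in> Z" for \<xi>
    using diff[OF Z_V[OF \<xi>]] \<xi> r by (simp add: Z_def)
  show energy: "nV ?e \<le> C * n2 ?g"
    by (rule energy_estimate[OF e gd eqZ[OF eZ]])
  show "n2 ?r \<le> sqrt (\<epsilon> + \<kappa> * C\<^sub>P\<^sup>2) / \<beta> * (1 + C\<^sub>c\<^sub>t) * (C * n2 ?g)" if \<beta>: "inf_sup_constant \<Omega> \<beta>"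
  proof (rule pressure_estimate[OF \<beta> e gd r energy \<sigma>])
    fix \<xi> assume "\<xi> \<in> V"
    from diff[OF this] have "\<sigma> * form_B \<Omega> \<xi> ?r = form \<sigma> ?e \<xi> - ip ?g \<xi>" by simp
    then have "\<bar>\<sigma>\<bar> * \<bar>form_B \<Omega> \<xi> ?r\<bar> = \<bar>form \<sigma> ?e \<xi> - ip ?g \<xi>\<bar>" by (simp flip: abs_mult)
    then show "\<bar>form_B \<Omega> \<xi> ?r\<bar> = \<bar>form \<sigma> ?e \<xi> - ip ?g \<xi>\<bar>" using \<sigma> by simp
  qed
qed

lemma state_solutionD:
  assumes "state_solution \<Omega> \<epsilon> \<kappa> c g y p"
  shows "y \<in> V" "p \<in> pressure_space \<Omega>"
    "\<xi> \<in> V \<Longrightarrow> form 1 y \<xi> - 1 * form_B \<Omega> \<xi> p = ip g \<xi>"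
    "\<phi> \<in> pressure_space \<Omega> \<Longrightarrow> form_B \<Omega> y \<phi> = 0"
  using assms by (auto simp: state_solution_def form_A_eq)

lemma adjoint_solutionD:
  assumes "adjoint_solution \<Omega> \<epsilon> \<kappa> c g w q"
  shows "w \<in> V" "q \<in> pressure_space \<Omega>"
    "\<xi> \<in> V \<Longrightarrow> form (- 1) w \<xi> - (- 1) * form_B \<Omega> \<xi> q = ip g \<xi>"
    "\<phi> \<in> pressure_space \<Omega> \<Longrightarrow> form_B \<Omega> w \<phi> = 0"
  using assms by (auto simp: adjoint_solution_def form_C_eq)

lemma state_stability:
  assumes "state_solution \<Omega> \<epsilon> \<kappa> c g y p" "state_solution \<Omega> \<epsilon> \<kappa> c g' y' p'" "g \<in> L2 \<Omega>" "g' \<in> L2 \<Omega>"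
  shows "(\<lambda>x. y x - y' x) \<in> Z"
    and "\<xi> \<in> Z \<Longrightarrow> form 1 (\<lambda>x. y x - y' x) \<xi> = ip (\<lambda>x. g x - g' x) \<xi>"
    and "nV (\<lambda>x. y x - y' x) \<le> C * n2 (\<lambda>x. g x - g' x)"
    and "inf_sup_constant \<Omega> \<beta> \<Longrightarrow> n2 (\<lambda>x. p x - p' x)
      \<le> sqrt (\<epsilon> + \<kappa> * C\<^sub>P\<^sup>2) / \<beta> * (1 + C\<^sub>c\<^sub>t) * (C * n2 (\<lambda>x. g x - g' x))"
  using Oseen_stability[OF state_solutionD(1)[OF assms(1)] state_solutionD(1)[OF assms(2)]
      state_solutionD(2)[OF assms(1)] state_solutionD(2)[OF assms(2)] assms(3,4) _
      state_solutionD(3)[OF assms(1)] state_solutionD(3)[OF assms(2)]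
      state_solutionD(4)[OF assms(1)] state_solutionD(4)[OF assms(2)]] by simp_all

lemma adjoint_stability:
  assumes "adjoint_solution \<Omega> \<epsilon> \<kappa> c g w q" "adjoint_solution \<Omega> \<epsilon> \<kappa> c g' w' q'" "g \<in> L2 \<Omega>" "g' \<in> L2 \<Omega>"
  shows "(\<lambda>x. w x - w' x) \<in> Z"
    and "\<xi> \<in> Z \<Longrightarrow> form (- 1) (\<lambda>x. w x - w' x) \<xi> = ip (\<lambda>x. g x - g' x) \<xi>"
    and "nV (\<lambda>x. w x - w' x) \<le> C * n2 (\<lambda>x. g x - g' x)"
    and "inf_sup_constant \<Omega> \<beta> \<Longrightarrow> n2 (\<lambda>x. q x - q' x)
      \<le> sqrt (\<epsilon> + \<kappa> * C\<^sub>P\<^sup>2) / \<beta> * (1 + C\<^sub>c\<^sub>t) * (C * n2 (\<lambda>x. g x - g' x))"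
  using Oseen_stability[OF adjoint_solutionD(1)[OF assms(1)] adjoint_solutionD(1)[OF assms(2)]
      adjoint_solutionD(2)[OF assms(1)] adjoint_solutionD(2)[OF assms(2)] assms(3,4) _
      adjoint_solutionD(3)[OF assms(1)] adjoint_solutionD(3)[OF assms(2)]
      adjoint_solutionD(4)[OF assms(1)] adjoint_solutionD(4)[OF assms(2)]] by simp_all

section \<open>The control error\<close>

lemma control_estimate:
  assumes sol: "state_solution \<Omega> \<epsilon> \<kappa> c (\<lambda>x. f x + u x) y p"
      "adjoint_solution \<Omega> \<epsilon> \<kappa> c (\<lambda>x. y x - y\<^sub>d x) w q"
    and hat: "state_solution \<Omega> \<epsilon> \<kappa> c (\<lambda>x. f x + u\<^sub>T x) yh ph"
      "adjoint_solution \<Omega> \<epsilon> \<kappa> c (\<lambda>x. y\<^sub>T x - y\<^sub>d x) wh qh"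
    and L2: "f \<in> L2 \<Omega>" "y\<^sub>d \<in> L2 \<Omega>" "u \<in> L2 \<Omega>" "u\<^sub>T \<in> L2 \<Omega>" "ut \<in> L2 \<Omega>"
    and T: "y\<^sub>T \<in> V" "w\<^sub>T \<in> V" and \<theta>: "0 < \<theta>"
    and vi: "0 \<le> ip (\<lambda>x. w x + \<theta> *\<^sub>R u x) (\<lambda>x. ut x - u x)"
      "0 \<le> ip (\<lambda>x. w\<^sub>T x + \<theta> *\<^sub>R ut x) (\<lambda>x. u x - ut x)"
  shows "\<theta> * n2 (\<lambda>x. u x - ut x) \<le> C * (nV (\<lambda>x. wh x - w\<^sub>T x)
      + C\<^sup>2 * nV (\<lambda>x. yh x - y\<^sub>T x) + C ^ 3 * n2 (\<lambda>x. ut x - u\<^sub>T x))"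
proof -
  note yV = state_solutionD(1)[OF sol(1)] and yhV = state_solutionD(1)[OF hat(1)]
    and wV = adjoint_solutionD(1)[OF sol(2)] and whV = adjoint_solutionD(1)[OF hat(2)]
  let ?\<delta> = "\<lambda>x. u x - ut x"
  define D where "D = n2 ?\<delta>"
  have \<delta>: "?\<delta> \<in> L2 \<Omega>" by (rule L2_diff[OF L2(3,5)])
  \<comment> \<open>\<open>wh\<close> is inserted between \<open>w\<^sub>T\<close> and
    \<open>w\<close>: the first difference is what the adjoint indicator bounds, the second solves
    an adjoint system to which duality applies.\<close>
  have "\<theta> * ip ?\<delta> ?\<delta> \<le> ip (\<lambda>x. w\<^sub>T x - wh x) ?\<delta> + ip ?\<delta> (\<lambda>x. wh x - w x)"
  proof -
    note in_L2 = L2 \<delta> V_L2(1)[OF wV] V_L2(1)[OF whV] V_L2(1)[OF T(2)]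
    have neg: "ip h (\<lambda>x. ut x - u x) = - ip h ?\<delta>" for h
      using L2_inner_scaleR_right[of \<Omega> h "- 1" ?\<delta>] by simp
    have "ip w ?\<delta> + \<theta> * ip u ?\<delta> \<le> 0"
      using vi(1) in_L2 unfolding neg by (simp add: L2_inner_add_left L2_scaleR L2_inner_scaleR_left)
    moreover have "0 \<le> ip w\<^sub>T ?\<delta> + \<theta> * ip ut ?\<delta>"
      using vi(2) in_L2 by (simp add: L2_inner_add_left L2_scaleR L2_inner_scaleR_left)
    moreover have "ip ?\<delta> ?\<delta> = ip u ?\<delta> - ip ut ?\<delta>"
      by (rule L2_inner_diff_left[OF L2(3,5) \<delta>])
    then have "\<theta> * ip ?\<delta> ?\<delta> = \<theta> * ip u ?\<delta> - \<theta> * ip ut ?\<delta>" by (simp add: right_diff_distrib)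
    moreover have "ip (\<lambda>x. w\<^sub>T x - wh x) ?\<delta> = ip w\<^sub>T ?\<delta> - ip wh ?\<delta>"
      "ip ?\<delta> (\<lambda>x. wh x - w x) = ip wh ?\<delta> - ip w ?\<delta>"
      using in_L2 by (simp_all add: L2_inner_commute[of \<Omega> ?\<delta> "\<lambda>x. wh x - w x"] L2_inner_diff_left)
    ultimately show ?thesis by linarith
  qed
  also have "ip (\<lambda>x. w\<^sub>T x - wh x) ?\<delta> \<le> C * nV (\<lambda>x. wh x - w\<^sub>T x) * D"
  proof -
    have "ip (\<lambda>x. w\<^sub>T x - wh x) ?\<delta> \<le> n2 (\<lambda>x. w\<^sub>T x - wh x) * D"
      using L2_Cauchy_Schwarz[OF V_L2(1)[OF V_diff[OF T(2) whV]] \<delta>] by (simp add: D_def)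
    also have "\<dots> \<le> C * nV (\<lambda>x. w\<^sub>T x - wh x) * D"
      by (intro mult_right_mono V_embedding V_diff T whV) (simp add: D_def L2_norm_nonneg)
    finally show ?thesis by (simp add: nV_minus_commute[OF T(2) whV])
  qed
  \<comment> \<open>Everything is taken relative to \<open>yh\<close>: the state response y - yh has
    data u - u_T, the projected control is shifted to ut - u_T, and the adjoint data y_T - y become
    r - e with r = y_T - yh.\<close>
  also have "ip ?\<delta> (\<lambda>x. wh x - w x) \<le> C ^ 3 * (nV (\<lambda>x. yh x - y\<^sub>T x) + C * n2 (\<lambda>x. ut x - u\<^sub>T x)) * D"
  proof -
    have rhs: "(\<lambda>x. f x + u x) \<in> L2 \<Omega>" "(\<lambda>x. f x + u\<^sub>T x) \<in> L2 \<Omega>"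
      "(\<lambda>x. y\<^sub>T x - y\<^sub>d x) \<in> L2 \<Omega>" "(\<lambda>x. y x - y\<^sub>d x) \<in> L2 \<Omega>"
      using L2 V_L2(1)[OF yV] V_L2(1)[OF T(1)] by (auto intro: L2_add L2_diff)
    note st = state_stability[OF sol(1) hat(1) rhs(1,2)]
    note ad = adjoint_stability[OF hat(2) sol(2) rhs(3,4)]
    have "ip (\<lambda>x. (u x - u\<^sub>T x) - (ut x - u\<^sub>T x)) (\<lambda>x. wh x - w x)
        \<le> C ^ 3 * (nV (\<lambda>x. y\<^sub>T x - yh x) + C * n2 (\<lambda>x. ut x - u\<^sub>T x))
          * n2 (\<lambda>x. (u x - u\<^sub>T x) - (ut x - u\<^sub>T x))"
    proof (rule adjoint_duality_estimate[OF st(1) ad(1) V_diff[OF T(1) yhV]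
          L2_diff[OF L2(3,4)] L2_diff[OF L2(5,4)]])
      show "form 1 (\<lambda>x. y x - yh x) \<xi> = ip (\<lambda>x. u x - u\<^sub>T x) \<xi>" if "\<xi> \<in> Z" for \<xi>
        using st(2)[OF that] by simp
      show "form (- 1) (\<lambda>x. wh x - w x) \<xi> = ip (\<lambda>x. y\<^sub>T x - yh x - (y x - yh x)) \<xi>" if "\<xi> \<in> Z" for \<xi>
        using ad(2)[OF that] by simp
    qed
    then show ?thesis by (simp add: D_def nV_minus_commute[OF T(1) yhV])
  qed
  finally have "\<theta> * ip ?\<delta> ?\<delta> \<le> (C * (nV (\<lambda>x. wh x - w\<^sub>T x)
      + C\<^sup>2 * nV (\<lambda>x. yh x - y\<^sub>T x) + C ^ 3 * n2 (\<lambda>x. ut x - u\<^sub>T x))) * D" (is "_ \<le> ?R * D")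
    by (simp add: algebra_simps power2_eq_square power3_eq_cube)
  moreover have "ip ?\<delta> ?\<delta> = D * D"
    unfolding D_def L2_norm_power2[symmetric] power2_eq_square ..
  ultimately have main: "(\<theta> * D) * D \<le> ?R * D" by (simp add: mult.assoc)
  have "\<theta> * D \<le> ?R"
  proof (cases "D = 0")
    case True
    then show ?thesis by (simp add: C_nonneg nV_nonneg L2_norm_nonneg)
  next
    case False
    then have "D > 0" using L2_norm_nonneg[of \<Omega> ?\<delta>] by (simp add: D_def)
    then show ?thesis using main by simp
  qed
  then show ?thesis by (simp add: D_def)
qed

end

section \<open>The a posteriori error estimate\<close>

theorem theorem5p2:
  fixes \<Omega> B\<^sub>\<Omega> :: "(real^'n) set"
    and \<TT> :: "(real^'n) set set set" and \<T> :: "(real^'n) set set"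
    and f y\<^sub>\<Omega> c :: "real^'n \<Rightarrow> real^'n"
    and \<epsilon> \<kappa> \<theta> \<rho> \<beta> :: real
    and a b x\<^sub>0 :: "real^'n" and l :: "'n \<Rightarrow> real^'n"
    and V\<^sub>T U\<^sub>T :: "(real^'n \<Rightarrow> real^'n) set" and Q\<^sub>T :: "(real^'n \<Rightarrow> real) set"
    and \<S> \<Q> :: "(real^'n \<Rightarrow> real^'n) \<Rightarrow> (real^'n \<Rightarrow> real) \<Rightarrow> (real^'n \<Rightarrow> real^'n) \<Rightarrow>
                (real^'n \<Rightarrow> real^'n) \<Rightarrow> real"
    and \<H> \<K> :: "(real^'n \<Rightarrow> real^'n) \<Rightarrow> (real^'n \<Rightarrow> real) \<Rightarrow> (real^'n \<Rightarrow> real^'n) \<Rightarrow>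
                (real^'n \<Rightarrow> real) \<Rightarrow> real"
    and y w u y\<^sub>T w\<^sub>T u\<^sub>T yh wh :: "real^'n \<Rightarrow> real^'n"
    and p q p\<^sub>T q\<^sub>T ph qh :: "real^'n \<Rightarrow> real"
    and \<eta>\<^sub>y \<eta>\<^sub>p \<eta>\<^sub>w \<eta>\<^sub>q \<eta>\<^sub>u :: "(real^'n) set \<Rightarrow> real"
    and C\<^sub>P C\<^sub>\<Omega> C\<^sub>c\<^sub>t C\<^sub>i\<^sub>s \<mu> \<omega> CC\<^sub>y CC\<^sub>w CC\<^sub>u :: real
  assumes dim: "CARD('n) \<in> {2, 3}"
    and domain: "polytopal_lipschitz_domain \<Omega>"
    and family: "\<forall>\<T>'\<in>\<TT>. conforming_partition \<Omega> \<T>'" "shape_regular_family \<TT>"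
    and mesh: "\<T> \<in> \<TT>"
    and data: "f \<in> L2 \<Omega>" "y\<^sub>\<Omega> \<in> L2 \<Omega>"
    and params: "0 < \<epsilon>" "0 \<le> \<kappa>" "0 < \<theta>" "0 \<le> \<rho>"
    and c: "c \<in> W1inf_vec \<Omega>" "AE x in lebesgue_on \<Omega>. weak_divergence \<Omega> c x = 0"
    and bounds: "\<forall>i. a $ i < b $ i"
    and box: "is_box x\<^sub>0 l B\<^sub>\<Omega>" "\<Omega> \<subseteq> B\<^sub>\<Omega>"
    and C\<^sub>P: "C\<^sub>P = poincare_const l"
    and C\<^sub>\<Omega>: "C\<^sub>\<Omega> = C_Omega \<epsilon> \<kappa> C\<^sub>P"
    and C\<^sub>c\<^sub>t: "C\<^sub>c\<^sub>t = 1 + C\<^sub>\<Omega> / sqrt \<epsilon> * Linf_norm \<Omega> c"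
    and \<beta>: "inf_sup_constant \<Omega> \<beta>"
    and C\<^sub>i\<^sub>s: "C\<^sub>i\<^sub>s = sqrt (\<epsilon> + \<kappa> * C\<^sub>P\<^sup>2) / \<beta>"
    and optimal: "optimality_system \<Omega> \<epsilon> \<kappa> c \<theta> f y\<^sub>\<Omega> a b y p w q u"
    and discrete_spaces: "V\<^sub>T \<subseteq> velocity_space \<Omega>" "function_subspace V\<^sub>T"
      "Q\<^sub>T \<subseteq> pressure_space \<Omega>" "function_subspace Q\<^sub>T"
      "U\<^sub>T \<subseteq> admissible_controls \<Omega> a b"
    and discrete:
      "discrete_optimality_system \<Omega> \<epsilon> \<kappa> c \<theta> f y\<^sub>\<Omega> V\<^sub>T Q\<^sub>T U\<^sub>T \<S> \<H> \<Q> \<K> y\<^sub>T p\<^sub>T w\<^sub>T q\<^sub>T u\<^sub>T"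
    and hat_state: "state_solution \<Omega> \<epsilon> \<kappa> c (\<lambda>x. f x + u\<^sub>T x) yh ph"
    and hat_adjoint: "adjoint_solution \<Omega> \<epsilon> \<kappa> c (\<lambda>x. y\<^sub>T x - y\<^sub>\<Omega> x) wh qh"
    and \<eta>\<^sub>u: "\<eta>\<^sub>u = control_indicator \<theta> a b w\<^sub>T u\<^sub>T"
    and \<eta>\<^sub>y: "(V_norm_mesh \<Omega> \<epsilon> \<kappa> \<T> (\<lambda>x. yh x - y\<^sub>T x))\<^sup>2 \<le> (\<Sum>K\<in>\<T>. (\<eta>\<^sub>y K)\<^sup>2)"
    and \<eta>\<^sub>p: "(Q_norm_mesh \<T> (\<lambda>x. ph x - p\<^sub>T x))\<^sup>2 \<le> (\<Sum>K\<in>\<T>. (\<eta>\<^sub>p K)\<^sup>2)"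
    and \<eta>\<^sub>w: "(V_norm_mesh \<Omega> \<epsilon> \<kappa> \<T> (\<lambda>x. wh x - w\<^sub>T x))\<^sup>2 \<le> (\<Sum>K\<in>\<T>. (\<eta>\<^sub>w K)\<^sup>2)"
    and \<eta>\<^sub>q: "(Q_norm_mesh \<T> (\<lambda>x. qh x - q\<^sub>T x))\<^sup>2 \<le> (\<Sum>K\<in>\<T>. (\<eta>\<^sub>q K)\<^sup>2)"
    and \<mu>: "\<mu> = 4 / \<theta>\<^sup>2"
    and \<omega>: "\<omega> = C\<^sub>i\<^sub>s\<^sup>2 * (1 + C\<^sub>c\<^sub>t)\<^sup>2"
    and CC\<^sub>y: "CC\<^sub>y = 2 + 2 * \<mu> * C\<^sub>\<Omega>^6
        + 4 * (1 + \<rho> * \<omega>) * (C\<^sub>\<Omega>^4 + \<mu> * C\<^sub>\<Omega>^8 + 2 * \<mu> * C\<^sub>\<Omega>^12)"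
    and CC\<^sub>w: "CC\<^sub>w = 2 + \<mu> * C\<^sub>\<Omega>^2 + 2 * \<mu> * (1 + \<rho> * \<omega>) * (C\<^sub>\<Omega>^4 + 2 * C\<^sub>\<Omega>^8)"
    and CC\<^sub>u: "CC\<^sub>u = 2 + 2 * \<mu> * C\<^sub>\<Omega>^8
        + 4 * (1 + \<rho> * \<omega>) * (C\<^sub>\<Omega>^2 + 2 * C\<^sub>\<Omega>^6 + \<mu> * C\<^sub>\<Omega>^10 + 2 * \<mu> * C\<^sub>\<Omega>^14)"
  shows "(total_error \<Omega> \<epsilon> \<kappa> \<rho> \<T> (\<lambda>x. y x - y\<^sub>T x) (\<lambda>x. p x - p\<^sub>T x)
            (\<lambda>x. w x - w\<^sub>T x) (\<lambda>x. q x - q\<^sub>T x) (\<lambda>x. u x - u\<^sub>T x))\<^sup>2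
         \<le> (\<Sum>K\<in>\<T>. CC\<^sub>y * (\<eta>\<^sub>y K)\<^sup>2 + 2 * \<rho> * (\<eta>\<^sub>p K)\<^sup>2
                  + CC\<^sub>w * (\<eta>\<^sub>w K)\<^sup>2 + 2 * \<rho> * (\<eta>\<^sub>q K)\<^sup>2 + CC\<^sub>u * (\<eta>\<^sub>u K)\<^sup>2)"
proof -
  have \<Omega>: "open \<Omega>" "\<Omega> \<noteq> {}" "bounded \<Omega>" "polytopal \<Omega>"
    using domain by (auto simp: polytopal_lipschitz_domain_def)
  have part: "conforming_partition \<Omega> \<T>" using family mesh by blast
  interpret O: oseen \<Omega> B\<^sub>\<Omega> c \<epsilon> \<kappa> x\<^sub>0 l
    using \<Omega> box params c by unfold_locales auto
  define ut where "ut = box_projection a b (\<lambda>z. (- 1 / \<theta>) *\<^sub>R w\<^sub>T z)"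
  have state: "state_solution \<Omega> \<epsilon> \<kappa> c (\<lambda>x. f x + u x) y p"
    and adjoint: "adjoint_solution \<Omega> \<epsilon> \<kappa> c (\<lambda>x. y x - y\<^sub>\<Omega> x) w q"
    and u: "u \<in> admissible_controls \<Omega> a b"
    and vi: "\<And>v. v \<in> admissible_controls \<Omega> a b \<Longrightarrow>
      0 \<le> L2_inner \<Omega> (\<lambda>x. w x + \<theta> *\<^sub>R u x) (\<lambda>x. v x - u x)"
    using optimal by (auto simp: optimality_system_def)
  have yT: "y\<^sub>T \<in> O.V" and pT: "p\<^sub>T \<in> pressure_space \<Omega>" and wT: "w\<^sub>T \<in> O.V"
    and qT: "q\<^sub>T \<in> pressure_space \<Omega>" and uT: "u\<^sub>T \<in> admissible_controls \<Omega> a b"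
    using discrete discrete_spaces by (auto simp: discrete_optimality_system_def)
  note y = O.state_solutionD(1)[OF state] and p = O.state_solutionD(2)[OF state]
    and w = O.adjoint_solutionD(1)[OF adjoint] and q = O.adjoint_solutionD(2)[OF adjoint]
    and yh = O.state_solutionD(1)[OF hat_state] and ph = O.state_solutionD(2)[OF hat_state]
    and wh = O.adjoint_solutionD(1)[OF hat_adjoint] and qh = O.adjoint_solutionD(2)[OF hat_adjoint]
  have ut: "ut \<in> admissible_controls \<Omega> a b"
    unfolding ut_def using bounds
    by (intro box_projection_admissible \<Omega> L2_scaleR O.V_L2(1) wT) (simp add: less_imp_le)
  have L2: "u \<in> L2 \<Omega>" "u\<^sub>T \<in> L2 \<Omega>" "ut \<in> L2 \<Omega>"
    using u uT ut by (auto simp: admissible_controls_def)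
  have vi_ut: "0 \<le> L2_inner \<Omega> (\<lambda>x. w\<^sub>T x + \<theta> *\<^sub>R ut x) (\<lambda>x. u x - ut x)"
    unfolding ut_def using params(3) u
    by (intro box_projection_variational_inequality) (auto simp: admissible_controls_def)
  have rhs: "(\<lambda>x. f x + u x) \<in> L2 \<Omega>" "(\<lambda>x. f x + u\<^sub>T x) \<in> L2 \<Omega>"
    "(\<lambda>x. y x - y\<^sub>\<Omega> x) \<in> L2 \<Omega>" "(\<lambda>x. y\<^sub>T x - y\<^sub>\<Omega> x) \<in> L2 \<Omega>"
    using data L2 O.V_L2(1)[OF y] O.V_L2(1)[OF yT] by (auto intro: L2_add L2_diff)
  have C_eq: "O.C = C\<^sub>\<Omega>" by (simp add: C\<^sub>\<Omega> C\<^sub>P)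
  have C_nonneg: "0 \<le> C\<^sub>\<Omega>" using O.C_nonneg by (simp add: C_eq)
  \<comment> \<open>The combined pressure stability constant; its square is \<omega>.\<close>
  define s where "s = C\<^sub>i\<^sub>s * (1 + C\<^sub>c\<^sub>t)"
  have s_eq: "sqrt (\<epsilon> + \<kappa> * O.C\<^sub>P\<^sup>2) / \<beta> * (1 + O.C\<^sub>c\<^sub>t) = s"
    by (simp add: s_def C\<^sub>i\<^sub>s C\<^sub>c\<^sub>t C_eq C\<^sub>P)
  have "0 < \<beta>" using \<beta> by (simp add: inf_sup_constant_def)
  then have s_nonneg: "0 \<le> s"
    unfolding s_eq[symmetric] using O.C\<^sub>c\<^sub>t_nonneg params by simp
  \<comment> \<open>The load \<open>f\<close> cancels in the difference of the two right-hand
    sides.\<close>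
  note st = O.state_stability[OF state hat_state rhs(1,2), unfolded add_diff_cancel_left]
  note ad = O.adjoint_stability[OF adjoint hat_adjoint rhs(3,4)]
  note y_bound = st(3)[unfolded C_eq] and p_bound = st(4)[OF \<beta>, unfolded s_eq, unfolded C_eq]
    and w_bound = ad(3)[unfolded C_eq] and q_bound = ad(4)[OF \<beta>, unfolded s_eq, unfolded C_eq]

  define Y P W Q U where "Y = O.nV (\<lambda>x. y x - y\<^sub>T x)" and "P = L2_norm \<Omega> (\<lambda>x. p x - p\<^sub>T x)"
    and "W = O.nV (\<lambda>x. w x - w\<^sub>T x)" and "Q = L2_norm \<Omega> (\<lambda>x. q x - q\<^sub>T x)"
    and "U = L2_norm \<Omega> (\<lambda>x. u x - u\<^sub>T x)"
  define Hy Hp Hw Hq Hu where "Hy = O.nV (\<lambda>x. yh x - y\<^sub>T x)" and "Hp = L2_norm \<Omega> (\<lambda>x. ph x - p\<^sub>T x)"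
    and "Hw = O.nV (\<lambda>x. wh x - w\<^sub>T x)" and "Hq = L2_norm \<Omega> (\<lambda>x. qh x - q\<^sub>T x)"
    and "Hu = L2_norm \<Omega> (\<lambda>x. ut x - u\<^sub>T x)"
  define D where "D = L2_norm \<Omega> (\<lambda>x. u x - ut x)"
  note defs = Y_def P_def W_def Q_def U_def Hy_def Hp_def Hw_def Hq_def Hu_def D_def
  have V_split: "O.nV (\<lambda>x. \<xi> x - \<zeta> x) \<le> O.nV (\<lambda>x. \<eta> x - \<zeta> x) + O.nV (\<lambda>x. \<xi> x - \<eta> x)"
    if "\<xi> \<in> O.V" "\<zeta> \<in> O.V" "\<eta> \<in> O.V" for \<xi> \<zeta> \<eta>
    using O.nV_triangle[OF O.V_diff[OF that(1,3)] O.V_diff[OF that(2,3)]]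
    by (simp add: O.nV_minus_commute[OF that(2,3)])
  have L2_split: "L2_norm \<Omega> (\<lambda>x. g x - h x) \<le> L2_norm \<Omega> (\<lambda>x. k x - h x) + L2_norm \<Omega> (\<lambda>x. g x - k x)"
    if "g \<in> L2 \<Omega>" "h \<in> L2 \<Omega>" "k \<in> L2 \<Omega>" for g h k :: "real^'n \<Rightarrow> 'z::euclidean_space"
    using L2_norm_triangle[OF L2_diff[OF that(3,2)] L2_diff[OF that(1,3)]] by (simp add: algebra_simps)
  \<comment> \<open>The adjoint data differ by y - y_T, whose L2 norm costs a second factor C_Omega;
    hence the squares in the bounds for \<open>W\<close> and \<open>Q\<close>.\<close>
  have yT_error: "L2_norm \<Omega> (\<lambda>x. y x - y\<^sub>\<Omega> x - (y\<^sub>T x - y\<^sub>\<Omega> x)) \<le> C\<^sub>\<Omega> * Y"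
    using O.V_embedding[OF O.V_diff[OF y yT]] by (simp add: Y_def C_eq)
  have "Y \<le> Hy + C\<^sub>\<Omega> * U"
    using V_split[OF y yT yh] y_bound by (simp add: defs)
  moreover have "P \<le> Hp + s * C\<^sub>\<Omega> * U"
    using L2_split[OF O.pressure_space_L2[OF p] O.pressure_space_L2[OF pT] O.pressure_space_L2[OF ph]]
      p_bound by (simp add: defs mult.assoc)
  moreover have "W \<le> Hw + C\<^sub>\<Omega>\<^sup>2 * Y"
    using V_split[OF w wT wh] w_bound mult_left_mono[OF yT_error C_nonneg]
    by (simp add: W_def Hw_def power2_eq_square mult.assoc)
  moreover have "Q \<le> Hq + s * C\<^sub>\<Omega>\<^sup>2 * Y"
  proof -
    have "s * (C\<^sub>\<Omega> * L2_norm \<Omega> (\<lambda>x. y x - y\<^sub>\<Omega> x - (y\<^sub>T x - y\<^sub>\<Omega> x))) \<le> s * (C\<^sub>\<Omega> * (C\<^sub>\<Omega> * Y))"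
      by (intro mult_left_mono yT_error C_nonneg s_nonneg)
    then show ?thesis
      using L2_split[OF O.pressure_space_L2[OF q] O.pressure_space_L2[OF qT] O.pressure_space_L2[OF qh]]
        q_bound by (simp add: Q_def Hq_def power2_eq_square mult.assoc)
  qed
  moreover have "U \<le> D + Hu"
    using L2_split[OF L2(1,2,3)] by (simp add: defs)
  moreover have "\<theta> * D \<le> C\<^sub>\<Omega> * (Hw + C\<^sub>\<Omega>\<^sup>2 * Hy + C\<^sub>\<Omega> ^ 3 * Hu)"
    using O.control_estimate[OF state adjoint hat_state hat_adjoint data L2 yT wT params(3) vi[OF ut] vi_ut]
    by (simp add: defs C_eq)
  moreover have "0 \<le> Y" "0 \<le> P" "0 \<le> W" "0 \<le> Q" "0 \<le> U" "0 \<le> D"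
    by (simp_all add: defs O.nV_nonneg L2_norm_nonneg)
  moreover have "\<omega> = s\<^sup>2" by (simp add: \<omega> s_def power_mult_distrib)
  ultimately have bound: "Y\<^sup>2 + \<rho> * P\<^sup>2 + W\<^sup>2 + \<rho> * Q\<^sup>2 + U\<^sup>2 \<le>
      CC\<^sub>y * Hy\<^sup>2 + 2 * \<rho> * Hp\<^sup>2 + CC\<^sub>w * Hw\<^sup>2 + 2 * \<rho> * Hq\<^sup>2 + CC\<^sub>u * Hu\<^sup>2"
    unfolding CC\<^sub>y CC\<^sub>w CC\<^sub>u using C_nonneg s_nonneg params \<mu> by (intro error_constants) auto

  \<comment> \<open>The bound so far concerns norms over \<Omega>; sums of squared cell norms
    collapse to these.\<close>
  note mesh_V = mesh_V_norm[OF \<Omega>(1,4) part _ less_imp_le[OF params(1)] params(2)]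
    and mesh_L2 = mesh_L2_norm[OF \<Omega>(1,4) part]
  have total: "(total_error \<Omega> \<epsilon> \<kappa> \<rho> \<T> (\<lambda>x. y x - y\<^sub>T x) (\<lambda>x. p x - p\<^sub>T x)
      (\<lambda>x. w x - w\<^sub>T x) (\<lambda>x. q x - q\<^sub>T x) (\<lambda>x. u x - u\<^sub>T x))\<^sup>2
      = Y\<^sup>2 + \<rho> * P\<^sup>2 + W\<^sup>2 + \<rho> * Q\<^sup>2 + U\<^sup>2"
    using params(4) mesh_V[OF O.V_diff[OF y yT]] mesh_V[OF O.V_diff[OF w wT]]
      mesh_L2[OF L2_diff[OF O.pressure_space_L2[OF p] O.pressure_space_L2[OF pT]]]
      mesh_L2[OF L2_diff[OF O.pressure_space_L2[OF q] O.pressure_space_L2[OF qT]]]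
      mesh_L2[OF L2_diff[OF L2(1,2)]]
    by (simp add: total_error_def local_error_def defs sum_nonneg sum.distrib flip: sum_distrib_left)
  have Hy: "Hy\<^sup>2 \<le> (\<Sum>K\<in>\<T>. (\<eta>\<^sub>y K)\<^sup>2)"
    using \<eta>\<^sub>y mesh_V[OF O.V_diff[OF yh yT]] by (simp add: V_norm_mesh_def Hy_def sum_nonneg)
  have Hw: "Hw\<^sup>2 \<le> (\<Sum>K\<in>\<T>. (\<eta>\<^sub>w K)\<^sup>2)"
    using \<eta>\<^sub>w mesh_V[OF O.V_diff[OF wh wT]] by (simp add: V_norm_mesh_def Hw_def sum_nonneg)
  have Hp: "Hp\<^sup>2 \<le> (\<Sum>K\<in>\<T>. (\<eta>\<^sub>p K)\<^sup>2)"
    using \<eta>\<^sub>p mesh_L2[OF L2_diff[OF O.pressure_space_L2[OF ph] O.pressure_space_L2[OF pT]]]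
    by (simp add: Q_norm_mesh_def Hp_def sum_nonneg)
  have Hq: "Hq\<^sup>2 \<le> (\<Sum>K\<in>\<T>. (\<eta>\<^sub>q K)\<^sup>2)"
    using \<eta>\<^sub>q mesh_L2[OF L2_diff[OF O.pressure_space_L2[OF qh] O.pressure_space_L2[OF qT]]]
    by (simp add: Q_norm_mesh_def Hq_def sum_nonneg)
  have Hu: "Hu\<^sup>2 = (\<Sum>K\<in>\<T>. (\<eta>\<^sub>u K)\<^sup>2)"
    using mesh_L2[OF L2_diff[OF L2(3,2)]] by (simp add: \<eta>\<^sub>u control_indicator_def Hu_def ut_def)
  \<comment> \<open>The control indicator enters by an equality, so among the three composite
    coefficients only those of the state and the adjoint need a sign.\<close>
  have "0 \<le> \<mu>" "0 \<le> 1 + \<rho> * \<omega>" using params by (simp_all add: \<mu> \<omega>)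
  then have "0 \<le> CC\<^sub>y" "0 \<le> CC\<^sub>w"
    using C_nonneg by (simp_all add: CC\<^sub>y CC\<^sub>w)
  then have "CC\<^sub>y * Hy\<^sup>2 + 2 * \<rho> * Hp\<^sup>2 + CC\<^sub>w * Hw\<^sup>2 + 2 * \<rho> * Hq\<^sup>2 + CC\<^sub>u * Hu\<^sup>2
      \<le> CC\<^sub>y * (\<Sum>K\<in>\<T>. (\<eta>\<^sub>y K)\<^sup>2) + 2 * \<rho> * (\<Sum>K\<in>\<T>. (\<eta>\<^sub>p K)\<^sup>2)
        + CC\<^sub>w * (\<Sum>K\<in>\<T>. (\<eta>\<^sub>w K)\<^sup>2) + 2 * \<rho> * (\<Sum>K\<in>\<T>. (\<eta>\<^sub>q K)\<^sup>2) + CC\<^sub>u * (\<Sum>K\<in>\<T>. (\<eta>\<^sub>u K)\<^sup>2)"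
    unfolding Hu using params(4) by (intro add_mono mult_left_mono Hy Hp Hw Hq order_refl) simp_all
  also have "\<dots> = (\<Sum>K\<in>\<T>. CC\<^sub>y * (\<eta>\<^sub>y K)\<^sup>2 + 2 * \<rho> * (\<eta>\<^sub>p K)\<^sup>2
      + CC\<^sub>w * (\<eta>\<^sub>w K)\<^sup>2 + 2 * \<rho> * (\<eta>\<^sub>q K)\<^sup>2 + CC\<^sub>u * (\<eta>\<^sub>u K)\<^sup>2)"
    by (simp add: sum.distrib sum_distrib_left)
  finally show ?thesis using bound unfolding total by linarith
qed

end
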